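(* Let $d\in\mathbb{N}$, $n\in\mathbb{N}_0$, let $s=(s_\gamma)_{0\le|\gamma|\le 2n}$ ($\gamma\in\mathbb{N}_0^d$) be a given multisequence of real numbers, let $\kappa_\pm:=i_\pm(M(n))$, $r:=\operatorname{rank}M(n)$, and let $\mathcal{B}=\{X^{\lambda^{(a)}}\}_{a=1}^r$ be a monomial basis of $\mathcal{C}_{M(n)}$. Then $s$ has a signed representing measure $\mu$ with Jordan decomposition $\mu=\mu_+-\mu_-$ satisfying $\operatorname{card}\operatorname{supp}\mu_\pm=\kappa_\pm$ if and only if $M(n)$ has a rank preserving extension $M(n+1)$ such that (a) $T_j:=M_{\mathcal{B}}(n)^{-1}M_{\mathcal{B},\mathcal{B}+\mathrm{e}_j}(n+1)$ is diagonalisable (over $\mathbb{C}$) for all $j=1,\ldots,d$, and (b) $\mathcal{V}(M(n+1))\subseteq\mathbb{R}^d$. In this case $\mu$ can be constructed as $\mu=\sum_{a=1}^r\varrho_a\delta_{z^{(a)}}$ with $\{z^{(1)},\ldots,z^{(r)}\}=\mathcal{V}(M(n+1))$ and (choosing $\mathcal{B}$ with $\lambda^{(1)}=0$) $(\varrho_1,\ldots,\varrho_r)^T=V_{\mathcal{B}}^{-T}M_{\mathcal{B}}(n)\,(1,0,\ldots,0)^T$.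
   Context: For $\gamma\in\mathbb{N}_0^d$, $|\gamma|=\gamma_1+\cdots+\gamma_d$ and $z^\gamma=\prod_j z_j^{\gamma_j}$; $\mathrm{e}_j$ is the $j$-th standard unit multi-index. $d$-Hankel matrix: for a real multisequence $s=(s_\gamma)_{0\le|\gamma|\le 2m}$, $M(m)=(s_{\lambda+\xi})_{0\le|\lambda|,|\xi|\le m}$, with rows and columns indexed by the monomials $X^\lambda$, $0\le|\lambda|\le m$ (in graded lexicographic order). $\mathcal{C}_{M(m)}$ is its column space, $X^\lambda\in\mathcal{C}_{M(m)}$ denotes the column indexed by $X^\lambda$, and for $p(x)=\sum_{0\le|\lambda|\le m}p_\lambda x^\lambda$ one writes $p(X)=\sum p_\lambda X^\lambda\in\mathcal{C}_{M(m)}$. A rank preserving extension $M(n+1)$ of $M(n)$ is the $d$-Hankel matrix of an extended sequence $(s_\gamma)_{0\le|\gamma|\le 2n+2}$, for some choice of real numbers $(s_\gamma)_{2n+1\le|\gamma|\le 2n+2}$, such that $\operatorname{rank}M(n+1)=\operatorname{rank}M(n)$. For a monomial basis $\mathcal{B}=\{X^{\lambda^{(a)}}\}_{a=1}^r$ of $\mathcal{C}_{M(n)}$, $M_{\mathcal{B}}(n)=(s_{\lambda^{(a)}+\lambda^{(b)}})_{a,b=1}^r$ (which is invertible) and $M_{\mathcal{B},\mathcal{B}+\mathrm{e}_j}(n+1)=(s_{\lambda^{(a)}+\lambda^{(b)}+\mathrm{e}_j})_{a,b=1}^r$. For points $z^{(1)},\ldots,z^{(r)}$, $V_{\mathcal{B}}=((z^{(a)})^{\lambda^{(b)}})_{a,b=1}^r$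 and $V_{\mathcal{B}}^{-T}=(V_{\mathcal{B}}^T)^{-1}$. Variety: $\mathcal{V}(M(m))=\{z\in\mathbb{C}^d: p(z)=0$ for all real polynomials $p$ in $d$ variables of degree at most $m$ with $p(X)=\mathbf{0}\in\mathcal{C}_{M(m)}\}$. A signed representing measure for $s$ is a real-valued (signed) Borel measure $\mu$ supported in $\mathbb{R}^d$, with absolutely convergent moments up to degree $2n$, such that $s_\gamma=\int_{\mathbb{R}^d}x^\gamma\,d\mu(x)$ for $0\le|\gamma|\le 2n$. $i_+(A)$ and $i_-(A)$ are the numbers of positive and negative eigenvalues of a Hermitian matrix $A$, counted with multiplicity. *)

theory Defs
  imports
    "HOL-Probability.Giry_Monad"
    "HOL-Library.List_Lexorder"
    "Jordan_Normal_Form.Gauss_Jordan_Elimination"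
    "Jordan_Normal_Form.Char_Poly"
    "Jordan_Normal_Form.DL_Rank"
begin

text \<open>
  The dimension \<open>d\<close> is the cardinality of a finite linearly ordered index type \<open>'d\<close>.
  Multi-indices are elements of \<^typ>\<open>nat ^ 'd\<close>, and \<open>axis j 1\<close> is the unit multi-index
  at position \<open>j\<close>.  Points of d-space are elements of \<^typ>\<open>real ^ 'd\<close> and
  \<^typ>\<open>complex ^ 'd\<close>, whereas the (numerically indexed) moment matrices are matrices in the
  sense of \<open>Jordan_Normal_Form.Matrix\<close>.  A truncated multisequence is a function on all
  multi-indices of which only the values up to the stated degree are ever used.
\<close>

type_synonym 'd multi_index = "(nat, 'd) Finite_Cartesian_Product.vec"

no_notation vec_index (infixl \<open>$\<close> 100)

definition mdeg :: "'d::finite multi_index \<Rightarrow> nat" where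
  "mdeg \<gamma> = (\<Sum>j\<in>UNIV. \<gamma> $ j)"

definition mpow :: "'a::comm_semiring_1 ^ 'd::finite \<Rightarrow> 'd multi_index \<Rightarrow> 'a" where
  "mpow z \<gamma> = (\<Prod>j\<in>UNIV. (z $ j) ^ (\<gamma> $ j))"

text \<open>
  Graded lexicographic order \<open>1, X\<^sub>1, \<dots>, X\<^sub>d, X\<^sub>1\<^sup>2, X\<^sub>1X\<^sub>2, \<dots>\<close>: compare degrees first; among
  multi-indices of equal degree, the one with the larger leading exponent comes first, which is
  why the exponents enter the (lexicographically compared) key through their complements.
\<close>

definition grlex_key :: "'d::{finite,linorder} multi_index \<Rightarrow> nat list" where
  "grlex_key \<gamma> = mdeg \<gamma> # map (\<lambda>j. mdeg \<gamma> - \<gamma> $ j) (sorted_list_of_set UNIV)"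

definition monomials :: "nat \<Rightarrow> 'd::{finite,linorder} multi_index list" where
  "monomials m = sorted_key_list_of_set grlex_key {\<gamma>. mdeg \<gamma> \<le> m}"

definition hankel :: "nat \<Rightarrow> ('d::{finite,linorder} multi_index \<Rightarrow> real) \<Rightarrow> real mat" where
  "hankel m s =
     (let L = monomials m in
      Matrix.mat (length L) (length L) (\<lambda>(a, b). s (L ! a + L ! b)))"

text \<open>The column \<open>X\<^sup>\<lambda>\<close> of \<open>M(m)\<close>; meaningful for \<open>mdeg \<lambda> \<le> m\<close>.\<close>

definition hankel_col ::
    "nat \<Rightarrow> ('d::{finite,linorder} multi_index \<Rightarrow> real) \<Rightarrow> 'd multi_index \<Rightarrow> real Matrix.vec" where
  "hankel_col m s l = vec_of_list (map (\<lambda>x. s (x + l)) (monomials m))"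

definition mat_rank :: "real mat \<Rightarrow> nat" where
  "mat_rank A = vec_space.rank (dim_row A) A"

text \<open>
  Numbers of positive and negative eigenvalues, counted with multiplicity.  The matrices in
  question are real symmetric, so that all their eigenvalues are real and the algebraic and
  geometric multiplicities agree.
\<close>

definition inertia_pos :: "real mat \<Rightarrow> nat" where
  "inertia_pos A = (\<Sum>x\<in>{x. eigenvalue A x \<and> 0 < x}. Polynomial.order x (char_poly A))"

definition inertia_neg :: "real mat \<Rightarrow> nat" where
  "inertia_neg A = (\<Sum>x\<in>{x. eigenvalue A x \<and> x < 0}. Polynomial.order x (char_poly A))"

definition monomial_basis ::
    "nat \<Rightarrow> ('d::{finite,linorder} multi_index \<Rightarrow> real) \<Rightarrow> 'd multi_index list \<Rightarrow> bool" where
  "monomial_basis n s bs \<longleftrightarrow>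
     (let N = dim_row (hankel n s); cs = map (hankel_col n s) bs in
      (\<forall>l\<in>set bs. mdeg l \<le> n) \<and> distinct cs \<and>
      \<not> LinearCombinations.module.lin_dep class_ring (module_vec TYPE(real) N) (set cs) \<and>
      LinearCombinations.module.span class_ring (module_vec TYPE(real) N) (set cs)
        = vec_space.col_space N (hankel n s))"

definition rank_preserving_extension ::
    "nat \<Rightarrow> ('d::{finite,linorder} multi_index \<Rightarrow> real) \<Rightarrow> ('d multi_index \<Rightarrow> real) \<Rightarrow> bool" where
  "rank_preserving_extension n s t \<longleftrightarrow>
     (\<forall>\<gamma>. mdeg \<gamma> \<le> 2 * n \<longrightarrow> t \<gamma> = s \<gamma>) \<and>
     mat_rank (hankel (n + 1) t) = mat_rank (hankel n s)"

text \<open>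
  \<open>basis_mat s bs e\<close> has the entries \<open>s (\<lambda>\<^sup>a + \<lambda>\<^sup>b + e)\<close>: for \<open>e = 0\<close> it is \<open>M\<^sub>B(n)\<close>, and for
  \<open>e = axis j 1\<close> (and an extended sequence) it is the matrix of \<open>M(n+1)\<close> with rows \<open>B\<close> and
  columns \<open>B + e\<^sub>j\<close>.
\<close>

definition basis_mat ::
    "('d::finite multi_index \<Rightarrow> real) \<Rightarrow> 'd multi_index list \<Rightarrow> 'd multi_index \<Rightarrow> real mat" where
  "basis_mat s bs e =
     Matrix.mat (length bs) (length bs) (\<lambda>(a, b). s (bs ! a + bs ! b + e))"

definition mat_inv :: "'a::field mat \<Rightarrow> 'a mat" where
  "mat_inv A = the (mat_inverse A)"

definition mult_mat ::
    "('d::finite multi_index \<Rightarrow> real) \<Rightarrow> ('d multi_index \<Rightarrow> real) \<Rightarrow> 'd multi_index list \<Rightarrow> 'd \<Rightarrow> real mat" where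
  "mult_mat s t bs j = mat_inv (basis_mat s bs 0) * basis_mat t bs (axis j 1)"

definition diagonalisable_over_C :: "real mat \<Rightarrow> bool" where
  "diagonalisable_over_C A \<longleftrightarrow>
     (\<exists>D. diagonal_mat D \<and> similar_mat (map_mat complex_of_real A) D)"

text \<open>
  A polynomial of degree at most \<open>m\<close> is given by its coefficients \<open>p \<lambda>\<close>, \<open>mdeg \<lambda> \<le> m\<close>; the
  vector \<open>p(X)\<close> of the column space is the corresponding combination of the columns of \<open>M(m)\<close>,
  i.e. \<open>M(m)\<close> times the coefficient vector.
\<close>

definition poly_col ::
    "nat \<Rightarrow> ('d::{finite,linorder} multi_index \<Rightarrow> real) \<Rightarrow> ('d multi_index \<Rightarrow> real) \<Rightarrow> real Matrix.vec" where
  "poly_col m s p = hankel m s *\<^sub>v vec_of_list (map p (monomials m))"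

definition variety ::
    "nat \<Rightarrow> ('d::{finite,linorder} multi_index \<Rightarrow> real) \<Rightarrow> (complex ^ 'd::{finite,linorder}) set" where
  "variety m s =
     {z. \<forall>p. poly_col m s p = 0\<^sub>v (dim_row (hankel m s)) \<longrightarrow>
             (\<Sum>l\<in>{l. mdeg l \<le> m}. complex_of_real (p l) * mpow z l) = 0}"

definition complexify :: "real ^ 'd::finite \<Rightarrow> complex ^ 'd" where
  "complexify x = (\<chi> j. complex_of_real (x $ j))"

definition vandermonde :: "(real ^ 'd::finite) list \<Rightarrow> 'd multi_index list \<Rightarrow> real mat" where
  "vandermonde zs bs = Matrix.mat (length zs) (length bs) (\<lambda>(a, b). mpow (zs ! a) (bs ! b))"

definition weights ::
    "('d::finite multi_index \<Rightarrow> real) \<Rightarrow> 'd multi_index list \<Rightarrow> (real ^ 'd::finite) list \<Rightarrow> real Matrix.vec" where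
  "weights s bs zs =
     mat_inv (transpose_mat (vandermonde zs bs)) *\<^sub>v
       (basis_mat s bs 0 *\<^sub>v unit_vec (length bs) 0)"

text \<open>
  A real-valued signed Borel measure is a countably additive real function on the Borel sets
  (its values on other sets are irrelevant).
\<close>

definition signed_borel_measure :: "('a::topological_space set \<Rightarrow> real) \<Rightarrow> bool" where
  "signed_borel_measure \<mu> \<longleftrightarrow> \<mu> {} = 0 \<and>
     (\<forall>A :: nat \<Rightarrow> 'a set. range A \<subseteq> sets borel \<and> disjoint_family A \<longrightarrow>
        (\<lambda>i. \<mu> (A i)) sums \<mu> (\<Union>i. A i))"

definition jordan_decomposition ::
    "('a::topological_space set \<Rightarrow> real) \<Rightarrow> 'a measure \<Rightarrow> 'a measure \<Rightarrow> bool" where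
  "jordan_decomposition \<mu> \<mu>p \<mu>m \<longleftrightarrow>
     sets \<mu>p = sets borel \<and> sets \<mu>m = sets borel \<and>
     finite_measure \<mu>p \<and> finite_measure \<mu>m \<and>
     (\<exists>P\<in>sets borel. emeasure \<mu>p (- P) = 0 \<and> emeasure \<mu>m P = 0) \<and>
     (\<forall>A\<in>sets borel. \<mu> A = measure \<mu>p A - measure \<mu>m A)"

text \<open>
  The Jordan decomposition of a signed measure exists and is unique; absolute integrability and
  the integral with respect to a signed measure are defined through its two parts.
\<close>

definition signed_representing_measure ::
    "nat \<Rightarrow> ('d::finite multi_index \<Rightarrow> real) \<Rightarrow> ((real ^ 'd::finite) set \<Rightarrow> real) \<Rightarrow> bool" where
  "signed_representing_measure n s \<mu> \<longleftrightarrow>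
     signed_borel_measure \<mu> \<and>
     (\<exists>\<mu>p \<mu>m. jordan_decomposition \<mu> \<mu>p \<mu>m \<and>
        (\<forall>\<gamma>. mdeg \<gamma> \<le> 2 * n \<longrightarrow>
           integrable \<mu>p (\<lambda>x. mpow x \<gamma>) \<and> integrable \<mu>m (\<lambda>x. mpow x \<gamma>) \<and>
           s \<gamma> = (\<integral>x. mpow x \<gamma> \<partial>\<mu>p) - (\<integral>x. mpow x \<gamma> \<partial>\<mu>m)))"

definition msupport :: "'a::topological_space measure \<Rightarrow> 'a set" where
  "msupport M = {x. \<forall>U. open U \<and> x \<in> U \<longrightarrow> emeasure M U \<noteq> 0}"

text \<open>Finiteness is required explicitly because \<^const>\<open>card\<close> is 0 on infinite sets.\<close>

definition jordan_support_cards ::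
    "('a::topological_space set \<Rightarrow> real) \<Rightarrow> nat \<Rightarrow> nat \<Rightarrow> bool" where
  "jordan_support_cards \<mu> kp km \<longleftrightarrow>
     (\<exists>\<mu>p \<mu>m. jordan_decomposition \<mu> \<mu>p \<mu>m \<and>
        finite (msupport \<mu>p) \<and> card (msupport \<mu>p) = kp \<and>
        finite (msupport \<mu>m) \<and> card (msupport \<mu>m) = km)"

definition atomic_signed_measure ::
    "real Matrix.vec \<Rightarrow> (real ^ 'd::finite) list \<Rightarrow> (real ^ 'd) set \<Rightarrow> real" where
  "atomic_signed_measure w zs A =
     (\<Sum>a<length zs. vec_index w a * measure (return borel (zs ! a)) A)"

lemma component_le_mdeg: "\<gamma> $ j \<le> mdeg \<gamma>"
  unfolding mdeg_def by (rule member_le_sum) auto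

lemma finite_mdeg_le: "finite {\<gamma> :: 'd::finite multi_index. mdeg \<gamma> \<le> m}"
proof -
  have "finite (UNIV \<rightarrow>\<^sub>E {..m} :: ('d \<Rightarrow> nat) set)"
    by (rule finite_PiE) auto
  moreover have "vec_nth ` {\<gamma> :: 'd multi_index. mdeg \<gamma> \<le> m} \<subseteq> (UNIV \<rightarrow>\<^sub>E {..m})"
    using component_le_mdeg order_trans by (fastforce simp: PiE_def)
  ultimately have "finite (vec_nth ` {\<gamma> :: 'd multi_index. mdeg \<gamma> \<le> m})"
    by (rule finite_subset[rotated])
  then show ?thesis
    by (rule finite_imageD) (auto simp: inj_on_def Finite_Cartesian_Product.vec_eq_iff)
qed

lemma inj_grlex_key: "inj (grlex_key :: 'd::{finite,linorder} multi_index \<Rightarrow> nat list)"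
proof (rule injI)
  fix x y :: "'d multi_index"
  assume eq: "grlex_key x = grlex_key y"
  then have d: "mdeg x = mdeg y" and k: "\<And>j. mdeg x - x $ j = mdeg y - y $ j"
    by (auto simp: grlex_key_def)
  show "x = y"
    unfolding Finite_Cartesian_Product.vec_eq_iff
  proof
    fix j
    show "x $ j = y $ j"
      using d k[of j] component_le_mdeg[of x j] component_le_mdeg[of y j] by linarith
  qed
qed

lemma
  shows set_monomials: "set (monomials m) = {\<gamma> :: 'd::{finite,linorder} multi_index. mdeg \<gamma> \<le> m}"
    and distinct_monomials: "distinct (monomials m :: 'd multi_index list)"
    and sorted_monomials: "sorted (map grlex_key (monomials m :: 'd multi_index list))"
proof -
  interpret folding_insort_key "(\<le>)" "(<)" UNIV "grlex_key :: 'd multi_index \<Rightarrow> nat list"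
    by unfold_locales (rule inj_grlex_key)
  have "linorder.insort_key (\<le>) grlex_key = (insort_key grlex_key :: 'd multi_index \<Rightarrow> _)"
  proof (intro ext)
    fix x :: "'d multi_index" and xs
    show "linorder.insort_key (\<le>) grlex_key x xs = insort_key grlex_key x xs"
      by (induction xs) (auto simp: linorder.insort_key.simps[OF linorder_class.linorder_axioms])
  qed
  then have eq: "linorder.sorted_key_list_of_set (\<le>) grlex_key
      = (sorted_key_list_of_set grlex_key :: 'd multi_index set \<Rightarrow> _)"
    by (simp add: sorted_key_list_of_set_def
        linorder.sorted_key_list_of_set_def[OF linorder_class.linorder_axioms])
  show "set (monomials m) = {\<gamma> :: 'd multi_index. mdeg \<gamma> \<le> m}"
    and "distinct (monomials m :: 'd multi_index list)"
    and "sorted (map grlex_key (monomials m :: 'd multi_index list))"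
    unfolding monomials_def
    using finite_mdeg_le[of m, where 'd = 'd]
      set_sorted_key_list_of_set[of "{\<gamma>. mdeg \<gamma> \<le> m}", unfolded eq]
      sorted_sorted_key_list_of_set[of "{\<gamma>. mdeg \<gamma> \<le> m}", unfolded eq]
      distinct_sorted_key_list_of_set[of "{\<gamma>. mdeg \<gamma> \<le> m}", unfolded eq]
    by (auto simp: distinct_map)
qed

lemma hankel_col_eq_col:
  assumes "k < length (monomials m :: 'd::{finite,linorder} multi_index list)"
  shows "hankel_col m s (monomials m ! k :: 'd multi_index) = col (hankel m s) k"
  using assms by (auto simp: hankel_col_def hankel_def Let_def vec_of_list_index)

end

theory Submission
  imports Defs "Jordan_Normal_Form.Jordan_Normal_Form"
begin

text \<open>
  A rank preserving extension \<open>t\<close> makes the polynomials of degree at most \<open>n + 1\<close> modulo the kernel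
  of \<open>M(n + 1)\<close> an \<open>r\<close>-dimensional space with basis \<open>B\<close> and nondegenerate form \<open>(p, q) \<mapsto> L\<^sub>t(p q)\<close>.
  Multiplication by the coordinates acts on it through the commuting self-adjoint operators \<open>T\<^sub>j\<close>,
  and the points of the variety are exactly the evaluations, that is, the normalised joint left
  eigenvectors of the \<open>T\<^sub>j\<close>.  Evaluations at distinct points are independent, so there are at most
  \<open>r\<close> points; if all \<open>T\<^sub>j\<close> are diagonalisable, the joint eigenvectors span and there are exactly \<open>r\<close>.
  When these are real, expanding the functionals \<open>\<xi> \<mapsto> t (\<eta> + \<xi>)\<close> in the evaluations represents \<open>s\<close>
  by \<open>r\<close> signed point masses, and Sylvester's law of inertia counts their signs.  Conversely, the
  moments of \<open>\<kappa>\<^sub>+ + \<kappa>\<^sub>- = r\<close> point masses of a representing measure define the extension.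
\<close>

text \<open>Moments exist only up to degree 2n + 2, so there is no quotient ring to compute in: a
  product with x_j may leave degree n + 1. What saves the argument is that \<open>bs\<close> has
  degree at most n, so \<open>bs\<close> shifted by e_j still indexes columns of M(n + 1), and that
  a surplus factor x_j can be moved to the other argument of the form. The form is indefinite, so
  self-adjointness yields neither diagonalisability nor real eigenvalues; both are genuine
  conditions. Left eigenvectors occur because functionals compose with T_j from the left. The
  monomial 1 may be missing from \<open>bs\<close>, hence a functional is first extended to all
  monomials of degree at most n + 1, and its value at 1 is the normalising factor. Linear algebra is
  carried out with finite sums over arbitrary index sets, since the unknowns are in turn basis
  positions, columns and points, over the reals as well as over the complex numbers.\<close>

no_notation vec_index (infixl \<open>$\<close> 100)

section \<open>Linear systems and joint eigenvectors\<close>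

text \<open>Gaussian elimination, one equation per induction step: a vacuous equation is dropped,
  any other eliminates one unknown. The dimension counts below (ranks, inertia, number of points of
  the variety) all reduce to this, with numbers, column vectors and points as indices.\<close>

lemma nontrivial_kernel:
  fixes f :: "'i \<Rightarrow> 'j \<Rightarrow> 'a::field"
  assumes "finite I" "finite J" "card I < card J"
  shows "\<exists>x. (\<exists>j\<in>J. x j \<noteq> 0) \<and> (\<forall>i\<in>I. (\<Sum>j\<in>J. f i j * x j) = 0)"
  using assms
proof (induction I arbitrary: J f rule: finite_induct)
  case empty
  then have "J \<noteq> {}" by auto
  then show ?case by (intro exI[of _ "\<lambda>_. 1"]) auto
next
  case (insert i I)
  show ?case
  proof (cases "\<forall>j\<in>J. f i j = 0")
    case True
    have "card I < card J" using insert.hyps insert.prems by simp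
    from insert.IH[OF insert.prems(1) this, of f]
    show ?thesis using True by auto
  next
    case False
    then obtain j0 where j0: "j0 \<in> J" "f i j0 \<noteq> 0" by blast
    \<comment> \<open>\<open>g\<close> is the system left after equation \<open>i\<close> has
      eliminated the unknown \<open>j0\<close>; \<open>y\<close> below restores that unknown by back
      substitution.\<close>
    define g where "g i' j = f i' j - f i' j0 / f i j0 * f i j" for i' j
    have "card I < card (J - {j0})"
      using insert.hyps insert.prems j0 by simp
    from insert.IH[OF _ this, of g] insert.prems obtain x
      where x: "\<exists>j\<in>J - {j0}. x j \<noteq> 0"
        "\<forall>i\<in>I. (\<Sum>j\<in>J - {j0}. g i j * x j) = 0"
      by auto
    define S where "S = (\<Sum>j\<in>J - {j0}. f i j * x j)"
    define y where "y = x(j0 := - S / f i j0)"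
    have split: "(\<Sum>j\<in>J. h j * y j) = h j0 * (- S / f i j0) + (\<Sum>j\<in>J - {j0}. h j * x j)" for h
      unfolding sum.remove[OF insert.prems(1) j0(1)]
      by (auto simp: y_def intro!: sum.cong)
    have "\<exists>j\<in>J. y j \<noteq> 0" using x(1) by (auto simp: y_def)
    moreover have "(\<Sum>j\<in>J. f i j * y j) = 0"
      using j0 by (simp add: split S_def[symmetric])
    moreover have "(\<Sum>j\<in>J. f i' j * y j) = 0" if "i' \<in> I" for i'
    proof -
      have "0 = (\<Sum>j\<in>J - {j0}. g i' j * x j)" using x(2) that by auto
      also have "\<dots> = (\<Sum>j\<in>J - {j0}. f i' j * x j) - f i' j0 / f i j0 * S"
        by (simp add: g_def S_def algebra_simps sum_subtractf sum_distrib_left)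
      finally show ?thesis by (simp add: split)
    qed
    ultimately show ?thesis by (intro exI[of _ y]) auto
  qed
qed

text \<open>Homogenise: the right-hand side becomes the column of an extra unknown
  \<open>None\<close>, so there is one unknown more than equations. Injectivity forces that unknown
  to be nonzero in a nontrivial solution, and dividing by it solves the original system.\<close>

lemma square_system_solvable:
  fixes f :: "'i \<Rightarrow> 'j \<Rightarrow> 'a::field"
  assumes fin: "finite I" "finite J" "card I = card J"
    and inj: "\<And>x. (\<And>i. i \<in> I \<Longrightarrow> (\<Sum>j\<in>J. f i j * x j) = 0) \<Longrightarrow> \<forall>j\<in>J. x j = 0"
  shows "\<exists>x. \<forall>i\<in>I. (\<Sum>j\<in>J. f i j * x j) = y i"
proof -
  define g where "g i j = (case j of None \<Rightarrow> - y i | Some j \<Rightarrow> f i j)" for i j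
  let ?J = "insert None (Some ` J)"
  have J: "finite ?J" "card I < card ?J"
    using fin by (auto simp: card_image)
  from nontrivial_kernel[OF fin(1) J, of g] obtain x where x: "\<exists>j\<in>?J. x j \<noteq> 0"
    "\<And>i. i \<in> I \<Longrightarrow> (\<Sum>j\<in>?J. g i j * x j) = 0" by blast
  have eq: "(\<Sum>j\<in>J. f i j * x (Some j)) = y i * x None" if "i \<in> I" for i
    using x(2)[OF that] fin(2) by (simp add: g_def sum.reindex)
  have "x None \<noteq> 0"
  proof
    assume "x None = 0"
    then have "\<forall>j\<in>J. x (Some j) = 0" using eq by (intro inj) auto
    then show False using x(1) \<open>x None = 0\<close> by auto
  qed
  then have "\<forall>i\<in>I. (\<Sum>j\<in>J. f i j * (x (Some j) / x None)) = y i"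
    using eq by (auto simp: sum_divide_distrib[symmetric] field_simps)
  then show ?thesis by (intro exI[of _ "\<lambda>j. x (Some j) / x None"])
qed

text \<open>The vectors \<open>w z\<close> may be zero, so independence takes the form that a
  vanishing sum has vanishing summands. Applying \<open>T j\<close> to the relation and subtracting
  \<open>e z0 j\<close> times it removes \<open>z0\<close> and multiplies each other
  \<open>w z\<close> by \<open>e z j - e z0 j\<close>; distinct eigenvalue tuples differ for some
  \<open>j\<close>.\<close>

lemma joint_eigenvectors_independent:
  fixes T :: "'j \<Rightarrow> nat \<Rightarrow> nat \<Rightarrow> 'a::field" and e :: "'p \<Rightarrow> 'j \<Rightarrow> 'a"
  assumes "finite Z" "inj_on e Z"
    and "\<And>z j k. z \<in> Z \<Longrightarrow> k < r \<Longrightarrow> (\<Sum>i<r. w z i * T j i k) = e z j * w z k"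
    and "\<And>k. k < r \<Longrightarrow> (\<Sum>z\<in>Z. w z k) = 0"
  shows "\<forall>z\<in>Z. \<forall>k<r. w z k = 0"
  using assms
proof (induction Z arbitrary: w rule: finite_induct)
  case empty
  then show ?case by simp
next
  case (insert z0 Z)
  have z0: "w z0 k = - (\<Sum>z\<in>Z. w z k)" if "k < r" for k
    using insert.prems(3)[OF that] insert.hyps by (simp add: eq_neg_iff_add_eq_0)
  have Z0: "\<forall>z\<in>Z. \<forall>k<r. (e z j - e z0 j) * w z k = 0" for j
  proof (rule insert.IH)
    show "inj_on e Z" using insert.prems(1) by auto
    show "(\<Sum>i<r. (e z j - e z0 j) * w z i * T j' i k) = e z j' * ((e z j - e z0 j) * w z k)"
      if "z \<in> Z" "k < r" for z j' k
    proof -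
      have "(\<Sum>i<r. (e z j - e z0 j) * w z i * T j' i k) = (e z j - e z0 j) * (\<Sum>i<r. w z i * T j' i k)"
        by (simp add: sum_distrib_left mult.assoc)
      then show ?thesis using insert.prems(2)[of z k j'] that by (simp add: mult.left_commute)
    qed
    show "(\<Sum>z\<in>Z. (e z j - e z0 j) * w z k) = 0" if "k < r" for k
    proof -
      have "(\<Sum>i<r. (\<Sum>z\<in>insert z0 Z. w z i) * T j i k) = 0"
        using insert.prems(3) by simp
      then have "(\<Sum>z\<in>insert z0 Z. \<Sum>i<r. w z i * T j i k) = 0"
        by (subst sum.swap) (simp add: sum_distrib_right)
      moreover have "(\<Sum>z\<in>insert z0 Z. \<Sum>i<r. w z i * T j i k) = (\<Sum>z\<in>insert z0 Z. e z j * w z k)"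
        using insert.prems(2) that by (intro sum.cong) auto
      ultimately have "e z0 j * w z0 k + (\<Sum>z\<in>Z. e z j * w z k) = 0"
        using insert.hyps by simp
      then show ?thesis
        using z0[OF that] by (simp add: left_diff_distrib sum_subtractf sum_distrib_left)
    qed
  qed
  have Z: "w z k = 0" if "z \<in> Z" "k < r" for z k
  proof -
    have "e z \<noteq> e z0" using insert.prems(1) insert.hyps that by (auto simp: inj_on_def)
    then obtain j where "e z j \<noteq> e z0 j" by blast
    then show ?thesis using Z0[of j] that by auto
  qed
  then show ?case using z0 by auto
qed

lemma additively_closed_sum:
  fixes f :: "'k \<Rightarrow> nat \<Rightarrow> 'a::comm_monoid_add"
  assumes add: "\<And>f g. f \<in> U \<Longrightarrow> g \<in> U \<Longrightarrow> (\<lambda>i. f i + g i) \<in> U"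
    and zero: "(\<lambda>_. 0) \<in> U" and "finite K" "\<And>k. k \<in> K \<Longrightarrow> f k \<in> U"
  shows "(\<lambda>i. \<Sum>k\<in>K. f k i) \<in> U"
  using assms(3,4)
proof (induction K rule: finite_induct)
  case empty
  then show ?case by (simp add: zero)
next
  case (insert k K)
  then have "(\<lambda>i. f k i + (\<Sum>k\<in>K. f k i)) \<in> U" by (intro add) auto
  then show ?case using insert.hyps by simp
qed

text \<open>The rows of \<open>Q\<close> are left eigenvectors, and \<open>P Q = 1\<close> expands
  any row vector \<open>g\<close> in them, with coefficients \<open>g P\<close>.\<close>

definition eigen_basis ::
    "nat \<Rightarrow> (nat \<Rightarrow> nat \<Rightarrow> 'a::field) \<Rightarrow> (nat \<Rightarrow> nat \<Rightarrow> 'a) \<Rightarrow> (nat \<Rightarrow> nat \<Rightarrow> 'a) \<Rightarrow> (nat \<Rightarrow> 'a) \<Rightarrow> bool" where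
  "eigen_basis r T P Q D \<longleftrightarrow>
     (\<forall>i<r. \<forall>k<r. (\<Sum>l<r. P i l * Q l k) = (if i = k then 1 else 0)) \<and>
     (\<forall>l<r. \<forall>k<r. (\<Sum>i<r. Q l i * T i k) = D l * Q l k)"

text \<open>
  Splitting a vector along the eigenspaces of one operator stays inside the eigenspaces of the
  operators commuting with it, because eigenvectors to distinct eigenvalues are independent.
\<close>

lemma joint_eigenvectors_generate:
  fixes T :: "'j \<Rightarrow> nat \<Rightarrow> nat \<Rightarrow> 'a::field"
  assumes "finite J"
    and diag: "\<And>j. \<exists>P Q D. eigen_basis r (T j) P Q D"
    and comm: "\<And>i j k l. k < r \<Longrightarrow> l < r \<Longrightarrow>
      (\<Sum>m<r. T i k m * T j m l) = (\<Sum>m<r. T j k m * T i m l)"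
    and add: "\<And>f g. f \<in> U \<Longrightarrow> g \<in> U \<Longrightarrow> (\<lambda>i. f i + g i) \<in> U"
    and zero: "(\<lambda>_. 0) \<in> U"
    and cong: "\<And>f g. f \<in> U \<Longrightarrow> (\<And>i. i < r \<Longrightarrow> f i = g i) \<Longrightarrow> g \<in> U"
    and eig: "\<And>f e. (\<And>j k. j \<in> J \<Longrightarrow> k < r \<Longrightarrow> (\<Sum>i<r. f i * T j i k) = e j * f k) \<Longrightarrow> f \<in> U"
  shows "f \<in> U"
  using \<open>finite J\<close> eig
proof (induction J arbitrary: f rule: finite_induct)
  case empty
  then show ?case by auto
next
  case (insert j0 J)
  show ?case
  \<comment> \<open>By induction only joint eigenvectors \<open>g\<close> of the operators in
    \<open>J\<close> have to be placed in \<open>U\<close>. The components of \<open>g\<close> in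
    the eigenspaces of \<open>T j0\<close> are joint eigenvectors for \<open>insert j0 J\<close>,
    and they sum to \<open>g\<close>.\<close>
  proof (rule insert.IH)
    fix g e
    assume g: "\<And>j k. j \<in> J \<Longrightarrow> k < r \<Longrightarrow> (\<Sum>i<r. g i * T j i k) = e j * g k"
    from diag obtain P Q D where "eigen_basis r (T j0) P Q D" by blast
    then have PQ: "\<And>i k. i < r \<Longrightarrow> k < r \<Longrightarrow> (\<Sum>l<r. P i l * Q l k) = (if i = k then 1 else 0)"
      and Q: "\<And>l k. l < r \<Longrightarrow> k < r \<Longrightarrow> (\<Sum>i<r. Q l i * T j0 i k) = D l * Q l k"
      unfolding eigen_basis_def by auto
    define c where "c l = (\<Sum>i<r. g i * P i l)" for l
    define h where "h \<mu> k = (\<Sum>l\<in>{l. l < r \<and> D l = \<mu>}. c l * Q l k)" for \<mu> k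
    let ?M = "D ` {..<r}"
    have sum_h: "(\<Sum>\<mu>\<in>?M. h \<mu> k) = g k" if "k < r" for k
    proof -
      have "(\<Sum>\<mu>\<in>?M. h \<mu> k) = (\<Sum>l<r. c l * Q l k)"
        unfolding h_def using sum.image_gen[of "{..<r}" "\<lambda>l. c l * Q l k" D] by simp
      also have "\<dots> = (\<Sum>l<r. \<Sum>i<r. g i * (P i l * Q l k))"
        by (simp add: c_def sum_distrib_right mult.assoc)
      also have "\<dots> = (\<Sum>i<r. g i * (\<Sum>l<r. P i l * Q l k))"
        by (subst sum.swap) (simp add: sum_distrib_left)
      also have "\<dots> = (\<Sum>i<r. if i = k then g i else 0)"
        using that by (intro sum.cong) (auto simp: PQ)
      finally show ?thesis using that by simp
    qed
    have h_eig: "(\<Sum>i<r. h \<mu> i * T j0 i k) = \<mu> * h \<mu> k" if "k < r" for \<mu> k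
    proof -
      have "(\<Sum>i<r. h \<mu> i * T j0 i k) = (\<Sum>l\<in>{l. l < r \<and> D l = \<mu>}. c l * (\<Sum>i<r. Q l i * T j0 i k))"
        unfolding h_def sum_distrib_right sum_distrib_left
        by (subst sum.swap) (simp add: mult.assoc)
      also have "\<dots> = \<mu> * h \<mu> k"
        unfolding h_def sum_distrib_left[of \<mu>] using that
        by (intro sum.cong) (auto simp: Q simp del: mult.assoc)
      finally show ?thesis .
    qed
    have hJ: "(\<Sum>i<r. h \<mu> i * T j i k) = e j * h \<mu> k" if j: "j \<in> J" and "k < r" "\<mu> \<in> ?M" for \<mu> j k
    proof -
      \<comment> \<open>The defect \<open>w \<mu>\<close> of the eigenvector equation for
        \<open>T j\<close> lies in the \<mu>-eigenspace of \<open>T j0\<close> because the operators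
        commute, and the defects sum to that of \<open>g\<close>, which is zero. Independence of
        eigenvectors makes each of them vanish.\<close>
      define w where "w \<mu> k = (\<Sum>i<r. h \<mu> i * T j i k) - e j * h \<mu> k" for \<mu> k
      have "\<forall>\<mu>\<in>?M. \<forall>k<r. w \<mu> k = 0"
      proof (rule joint_eigenvectors_independent[where T = "\<lambda>_::unit. T j0" and e = "\<lambda>\<mu> _. \<mu>"])
        show "finite ?M" by simp
        show "inj_on (\<lambda>\<mu> _. \<mu>) ?M" by (auto simp: inj_on_def fun_eq_iff)
        show "(\<Sum>\<mu>\<in>?M. w \<mu> k) = 0" if k: "k < r" for k
        proof -
          have "(\<Sum>\<mu>\<in>?M. w \<mu> k) = (\<Sum>i<r. (\<Sum>\<mu>\<in>?M. h \<mu> i) * T j i k) - e j * (\<Sum>\<mu>\<in>?M. h \<mu> k)"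
            unfolding w_def sum_subtractf sum_distrib_left sum_distrib_right
            by (subst sum.swap) simp
          also have "\<dots> = 0" using g[OF j k] k by (simp add: sum_h)
          finally show ?thesis .
        qed
        fix \<mu> k assume k: "k < r"
        have "(\<Sum>i<r. (\<Sum>m<r. h \<mu> m * T j m i) * T j0 i k)
            = (\<Sum>m<r. h \<mu> m * (\<Sum>i<r. T j m i * T j0 i k))"
          unfolding sum_distrib_left sum_distrib_right
          by (subst sum.swap) (simp add: mult.assoc)
        also have "\<dots> = (\<Sum>m<r. h \<mu> m * (\<Sum>i<r. T j0 m i * T j i k))"
          using k by (intro sum.cong refl) (simp add: comm)
        also have "\<dots> = (\<Sum>i<r. (\<Sum>m<r. h \<mu> m * T j0 m i) * T j i k)"
          unfolding sum_distrib_left sum_distrib_right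
          by (subst (2) sum.swap) (simp add: mult.assoc)
        also have "\<dots> = \<mu> * (\<Sum>i<r. h \<mu> i * T j i k)"
          unfolding sum_distrib_left by (intro sum.cong) (auto simp: h_eig mult.assoc)
        finally have "(\<Sum>i<r. (\<Sum>m<r. h \<mu> m * T j m i) * T j0 i k) = \<mu> * (\<Sum>i<r. h \<mu> i * T j i k)" .
        moreover have "(\<Sum>i<r. e j * h \<mu> i * T j0 i k) = e j * (\<mu> * h \<mu> k)"
          using h_eig[OF k] by (simp add: mult.assoc sum_distrib_left[symmetric])
        ultimately show "(\<Sum>i<r. w \<mu> i * T j0 i k) = \<mu> * w \<mu> k"
          by (simp add: w_def left_diff_distrib sum_subtractf algebra_simps)
      qed
      then show ?thesis using that by (auto simp: w_def)
    qed
    have "h \<mu> \<in> U" if "\<mu> \<in> ?M" for \<mu>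
      using that insert.hyps h_eig hJ
      by (intro insert.prems(1)[where e = "e(j0 := \<mu>)"]) auto
    then have "(\<lambda>i. \<Sum>\<mu>\<in>?M. h \<mu> i) \<in> U"
      by (intro additively_closed_sum add zero) auto
    then show "g \<in> U" by (rule cong) (rule sum_h)
  qed
qed

section \<open>Rank factorisations\<close>

context vec_space
begin

lemma maximal_lin_indpt_span:
  assumes S: "finite S" "S \<subseteq> carrier_vec n"
    and max: "maximal M (\<lambda>T. T \<subseteq> S \<and> lin_indpt T)"
  shows "span M = span S"
proof -
  have M: "M \<subseteq> S" "lin_indpt M" using max unfolding maximal_def by auto
  have "v \<in> span M" if "v \<in> S" for v
  proof (rule ccontr)
    assume v: "v \<notin> span M"
    then have "v \<notin> M" using M S in_own_span[of M] by auto
    have "lin_indpt (M \<union> {v})"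
      using lin_dep_iff_in_span[of M v] M S that v \<open>v \<notin> M\<close> by auto
    then have "M \<union> {v} = M"
      using max M that unfolding maximal_def by (metis Un_upper1 empty_subsetI insert_subset le_sup_iff)
    then show False using \<open>v \<notin> M\<close> by auto
  qed
  then have "span S \<subseteq> span M"
    using M S by (intro span_is_subset span_is_submodule) auto
  then show ?thesis using span_is_monotone[OF M(1)] by auto
qed

text \<open>Together with \<open>lin_dep_iff\<close> this turns span and dependence of vectors into
  scalar sums, the language of \<open>nontrivial_kernel\<close>.\<close>

lemma in_span_iff:
  assumes S: "finite S" "S \<subseteq> carrier_vec n" and v: "v \<in> carrier_vec n"
  shows "v \<in> span S \<longleftrightarrow> (\<exists>a. \<forall>i<n. vec_index v i = (\<Sum>u\<in>S. a u * vec_index u i))"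
proof -
  have "v = lincomb a S \<longleftrightarrow> (\<forall>i<n. vec_index v i = (\<Sum>u\<in>S. a u * vec_index u i))" for a
    using v lincomb_dim[OF S, of a] lincomb_index[OF _ S(2), of _ a] by (auto simp: Matrix.vec_eq_iff)
  then show ?thesis
    unfolding finite_span[OF S] by auto
qed

lemma lin_dep_iff:
  assumes S: "finite S" "S \<subseteq> carrier_vec n"
  shows "lin_dep S \<longleftrightarrow> (\<exists>a. (\<exists>u\<in>S. a u \<noteq> 0) \<and> (\<forall>i<n. (\<Sum>u\<in>S. a u * vec_index u i) = 0))"
proof -
  have z: "lincomb a S = 0\<^sub>v n \<longleftrightarrow> (\<forall>i<n. (\<Sum>u\<in>S. a u * vec_index u i) = 0)" for a
    using lincomb_dim[OF S, of a] lincomb_index[OF _ S(2), of _ a] by (auto simp: Matrix.vec_eq_iff)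
  show ?thesis
    using finite_lin_dep[OF S(1)] lin_dep_crit[OF S(1) subset_refl] S(2) unfolding z[symmetric] by blast
qed

end

text \<open>\<open>K\<close> is a maximal independent set among the columns, \<open>f i u\<close>
  the entry of the column \<open>u\<close> in row \<open>i\<close>, and \<open>g u j\<close> a
  coordinate of column \<open>j\<close>. With the converse bound below, the rank is the least length
  of such a factorisation, a form that compares matrices of different sizes.\<close>

lemma rank_factorization:
  fixes A :: "real mat"
  assumes A: "A \<in> carrier_mat m n"
  obtains K :: "real Matrix.vec set" and f g where "finite K" "card K = mat_rank A"
    "\<And>i j. i < m \<Longrightarrow> j < n \<Longrightarrow> A $$ (i, j) = (\<Sum>k\<in>K. f i k * g k j)"
proof -
  interpret vec_space "TYPE(real)" m .
  have S: "set (cols A) \<subseteq> carrier_vec m" using A cols_dim by blast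
  obtain M where M: "maximal M (\<lambda>T. T \<subseteq> set (cols A) \<and> lin_indpt T)" "finite M"
    using maximal_exists_superset[of "set (cols A)" "\<lambda>T. T \<subseteq> set (cols A) \<and> lin_indpt T" "{}"]
      finite_lin_indpt2[of "{}"] by auto
  have MS: "M \<subseteq> set (cols A)" using M unfolding maximal_def by auto
  have "\<exists>a. \<forall>i<m. A $$ (i, j) = (\<Sum>u\<in>M. a u * vec_index u i)" if "j < n" for j
  proof -
    have "col A j \<in> set (cols A)" using A that by (auto simp: cols_def)
    then have "col A j \<in> span M"
      using maximal_lin_indpt_span[OF _ S M(1)] in_own_span[OF S] by auto
    then have "\<exists>a. \<forall>i<m. vec_index (col A j) i = (\<Sum>u\<in>M. a u * vec_index u i)"
      using in_span_iff[of M "col A j"] M(2) MS S A col_dim[of A j] by auto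
    then show ?thesis using A that by simp
  qed
  then obtain a where "\<And>j i. j < n \<Longrightarrow> i < m \<Longrightarrow> A $$ (i, j) = (\<Sum>u\<in>M. a j u * vec_index u i)"
    by metis
  moreover have "card M = mat_rank A"
    using rank_card_indpt[OF A M(1)] A by (simp add: mat_rank_def)
  ultimately show ?thesis
    using M(2) by (intro that[of M "\<lambda>i u. vec_index u i" "\<lambda>u j. a j u"]) (auto simp: mult.commute)
qed

text \<open>Were there more than \<open>card K\<close> independent columns, their coefficient
  vectors over \<open>K\<close> would be dependent, and \<open>f\<close> would carry the dependence
  over to the columns.\<close>

lemma rank_le_factorization:
  fixes A :: "real mat"
  assumes A: "A \<in> carrier_mat m n" and K: "finite K"
    and fg: "\<And>i j. i < m \<Longrightarrow> j < n \<Longrightarrow> A $$ (i, j) = (\<Sum>k\<in>K. f i k * g k j)"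
  shows "mat_rank A \<le> card K"
proof (rule ccontr)
  interpret vec_space "TYPE(real)" m .
  assume "\<not> mat_rank A \<le> card K"
  have S: "set (cols A) \<subseteq> carrier_vec m" using A cols_dim by blast
  obtain M where M: "maximal M (\<lambda>T. T \<subseteq> set (cols A) \<and> lin_indpt T)" "finite M"
    using maximal_exists_superset[of "set (cols A)" "\<lambda>T. T \<subseteq> set (cols A) \<and> lin_indpt T" "{}"]
      finite_lin_indpt2[of "{}"] by auto
  have MS: "M \<subseteq> set (cols A)" "lin_indpt M" using M unfolding maximal_def by auto
  have "card M = mat_rank A"
    using rank_card_indpt[OF A M(1)] A by (simp add: mat_rank_def)
  then have "card K < card M" using \<open>\<not> mat_rank A \<le> card K\<close> by simp
  have "\<exists>j<n. u = col A j" if "u \<in> M" for u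
  proof -
    have "u \<in> set (cols A)" using MS(1) that by auto
    then show ?thesis using A by (auto simp: in_set_conv_nth)
  qed
  then obtain J where J: "\<And>u. u \<in> M \<Longrightarrow> J u < n \<and> u = col A (J u)" by metis
  from nontrivial_kernel[OF K M(2) \<open>card K < card M\<close>, of "\<lambda>k u. g k (J u)"] obtain x
    where x: "\<exists>u\<in>M. x u \<noteq> 0" "\<And>k. k \<in> K \<Longrightarrow> (\<Sum>u\<in>M. g k (J u) * x u) = 0" by blast
  have "(\<Sum>u\<in>M. x u * vec_index u i) = 0" if "i < m" for i
  proof -
    have "vec_index u i = (\<Sum>k\<in>K. f i k * g k (J u))" if "u \<in> M" for u
    proof -
      have "vec_index u i = vec_index (col A (J u)) i" 
        by (rule arg_cong[where f = "\<lambda>v. vec_index v i"]) (use J[OF that] in blast)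
      also have "\<dots> = A $$ (i, J u)" using J[OF that, THEN conjunct1] A \<open>i < m\<close> by simp
      finally show ?thesis using J[OF that] fg[OF \<open>i < m\<close>, of "J u"] by simp
    qed
    then have "(\<Sum>u\<in>M. x u * vec_index u i) = (\<Sum>u\<in>M. \<Sum>k\<in>K. f i k * (g k (J u) * x u))"
      by (simp add: sum_distrib_left mult_ac)
    also have "\<dots> = (\<Sum>k\<in>K. f i k * (\<Sum>u\<in>M. g k (J u) * x u))"
      by (subst sum.swap) (simp add: sum_distrib_left)
    also have "\<dots> = 0" by (simp add: x)
    finally show ?thesis .
  qed
  then have "lin_dep M"
    using x(1) lin_dep_iff[OF M(2)] MS S by blast
  then show False using MS by simp
qed

section \<open>Inertia of real symmetric matrices\<close>

lemma sum_squares_pos: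
  fixes x :: "nat \<Rightarrow> real"
  assumes "l < N" "x l \<noteq> 0"
  shows "0 < (\<Sum>l<N. x l * x l)"
proof (rule sum_pos2)
  show "0 < x l * x l" using assms(2) by (auto simp: zero_less_mult_iff linorder_neq_iff)
qed (use assms in auto)

text \<open>While \<open>k < N\<close>, the \<open>k\<close> orthogonality conditions on
  \<open>N\<close> unknowns have a nonzero solution, which after normalisation is the next
  vector.\<close>

lemma orthonormal_extend:
  fixes u :: "nat \<Rightarrow> nat \<Rightarrow> real"
  assumes "k \<le> N"
    and "\<And>i j. i < k \<Longrightarrow> j < k \<Longrightarrow> (\<Sum>l<N. u i l * u j l) = (if i = j then 1 else 0)"
  shows "\<exists>u'. (\<forall>i<k. u' i = u i) \<and>
    (\<forall>i<N. \<forall>j<N. (\<Sum>l<N. u' i l * u' j l) = (if i = j then 1 else 0))"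
  using assms
proof (induction "N - k" arbitrary: k u)
  case 0
  then show ?case by (intro exI[of _ u]) auto
next
  case (Suc d)
  have "card {..<k} < card {..<N}" using Suc by simp
  from nontrivial_kernel[OF _ _ this, of u] obtain x
    where x: "\<exists>l<N. x l \<noteq> 0" "\<And>i. i < k \<Longrightarrow> (\<Sum>l<N. u i l * x l) = 0" by auto
  define c where "c = (\<Sum>l<N. x l * x l)"
  have "c > 0" unfolding c_def using x(1) sum_squares_pos by blast
  define v where "v l = x l / sqrt c" for l
  have vv: "(\<Sum>l<N. v l * v l) = 1"
    using \<open>c > 0\<close> by (simp add: v_def sum_divide_distrib[symmetric] c_def[symmetric])
  have uv: "(\<Sum>l<N. u i l * v l) = 0" if "i < k" for i
    using x(2)[OF that] by (simp add: v_def sum_divide_distrib[symmetric])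
  have "\<exists>u'. (\<forall>i<Suc k. u' i = (u(k := v)) i) \<and>
    (\<forall>i<N. \<forall>j<N. (\<Sum>l<N. u' i l * u' j l) = (if i = j then 1 else 0))"
  proof (rule Suc.hyps)
    fix i j assume "i < Suc k" "j < Suc k"
    then show "(\<Sum>l<N. (u(k := v)) i l * (u(k := v)) j l) = (if i = j then 1 else 0)"
      using Suc.prems(2)[of i j] vv uv[of i] uv[of j] by (auto simp: less_Suc_eq mult.commute)
  qed (use Suc in auto)
  then obtain u' where u': "\<And>i. i < Suc k \<Longrightarrow> u' i = (u(k := v)) i"
    "\<forall>i<N. \<forall>j<N. (\<Sum>l<N. u' i l * u' j l) = (if i = j then 1 else 0)" by blast
  then show ?case by (intro exI[of _ u']) auto
qed

text \<open>A complex eigenvalue comes from the fundamental theorem of algebra. The Hermitian form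
  \<open>S\<close> of the eigenvector is the eigenvalue times a positive number and is its own
  conjugate, so the eigenvalue is real; then the real or the imaginary part of the eigenvector is a
  nonzero real eigenvector.\<close>

lemma symmetric_has_eigenvector:
  fixes a :: "nat \<Rightarrow> nat \<Rightarrow> real"
  assumes "0 < m" and sym: "\<And>i j. i < m \<Longrightarrow> j < m \<Longrightarrow> a i j = a j i"
  shows "\<exists>e y. (\<exists>i<m. y i \<noteq> 0) \<and> (\<forall>i<m. (\<Sum>j<m. a i j * y j) = e * y i)"
proof -
  define A where "A = Matrix.mat m m (\<lambda>(i, j). complex_of_real (a i j))"
  have A: "A \<in> carrier_mat m m" by (simp add: A_def)
  have "degree (char_poly A) \<noteq> 0" using degree_monic_char_poly[OF A] \<open>0 < m\<close> by simp
  then have "\<not> constant (poly (char_poly A))" by (simp add: constant_degree)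
  then obtain k where "poly (char_poly A) k = 0"
    using fundamental_theorem_of_algebra by blast
  then obtain v where v: "v \<in> carrier_vec m" "v \<noteq> 0\<^sub>v m" "A *\<^sub>v v = k \<cdot>\<^sub>v v"
    using eigenvalue_root_char_poly[OF A] A by (auto simp: eigenvalue_def eigenvector_def)
  define x where "x = vec_index v"
  have ev: "(\<Sum>j<m. of_real (a i j) * x j) = k * x i" if "i < m" for i
  proof -
    have "vec_index (A *\<^sub>v v) i = k * x i" using v that by (simp add: x_def)
    then show ?thesis
      using that v(1) by (simp add: A_def x_def scalar_prod_def mult_mat_vec_def lessThan_atLeast0)
  qed
  from v obtain i0 where i0: "i0 < m" "x i0 \<noteq> 0"
    by (metis x_def carrier_vecD eq_vecI index_zero_vec)
  define c where "c = (\<Sum>i<m. (cmod (x i))\<^sup>2)"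
  have "c > 0" unfolding c_def using i0 by (intro sum_pos2[of _ i0]) auto
  define S where "S = (\<Sum>i<m. \<Sum>j<m. cnj (x i) * of_real (a i j) * x j)"
  have "S = (\<Sum>i<m. cnj (x i) * (k * x i))"
    unfolding S_def by (intro sum.cong refl) (simp add: ev[symmetric] sum_distrib_left mult.assoc)
  also have "\<dots> = k * of_real c"
    unfolding c_def of_real_sum sum_distrib_left
    by (intro sum.cong refl) (simp add: complex_norm_square[symmetric] mult_ac)
  finally have S: "S = k * of_real c" .
  have "cnj S = S"
  proof -
    have "cnj S = (\<Sum>i<m. \<Sum>j<m. x i * of_real (a i j) * cnj (x j))"
      by (simp add: S_def)
    also have "\<dots> = (\<Sum>j<m. \<Sum>i<m. x i * of_real (a i j) * cnj (x j))" by (rule sum.swap)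
    also have "\<dots> = S" unfolding S_def by (intro sum.cong refl) (simp add: sym mult_ac)
    finally show ?thesis .
  qed
  then have "cnj k = k" using \<open>c > 0\<close> unfolding S by simp
  then obtain e where e: "k = of_real e" by (metis Reals_cnj_iff Reals_cases)
  have "(\<Sum>j<m. a i j * Re (x j)) = e * Re (x i)" "(\<Sum>j<m. a i j * Im (x j)) = e * Im (x i)"
    if "i < m" for i
    using arg_cong[OF ev[OF that], of Re] arg_cong[OF ev[OF that], of Im] by (simp_all add: e)
  note ev_Re_Im = this
  have "Re (x i0) \<noteq> 0 \<or> Im (x i0) \<noteq> 0" using i0 by (auto simp: complex_eq_iff)
  then show ?thesis
  proof
    assume "Re (x i0) \<noteq> 0"
    then show ?thesis using ev_Re_Im i0 by (intro exI[of _ e] exI[of _ "\<lambda>i. Re (x i)"]) auto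
  next
    assume "Im (x i0) \<noteq> 0"
    then show ?thesis using ev_Re_Im i0 by (intro exI[of _ e] exI[of _ "\<lambda>i. Im (x i)"]) auto
  qed
qed

text \<open>The orthogonal complement of eigenvectors of a symmetric operator is invariant, so the
  next eigenvector is found in the compression of \<open>a\<close> to that complement.\<close>

lemma symmetric_partial_eigenbasis:
  fixes a :: "nat \<Rightarrow> nat \<Rightarrow> real"
  assumes sym: "\<And>i j. i < N \<Longrightarrow> j < N \<Longrightarrow> a i j = a j i" and "k \<le> N"
  shows "\<exists>u e. (\<forall>i<k. \<forall>j<k. (\<Sum>l<N. u i l * u j l) = (if i = j then 1 else 0)) \<and>
    (\<forall>i<k. \<forall>l<N. (\<Sum>m<N. a l m * u i m) = e i * u i l)"
  using \<open>k \<le> N\<close>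
proof (induction k)
  case 0
  then show ?case by simp
next
  case (Suc k)
  have "k \<le> N" using Suc.prems by simp
  with Suc.IH obtain u e
    where "\<forall>i<k. \<forall>j<k. (\<Sum>l<N. u i l * u j l) = (if i = j then 1 else 0)"
      "\<forall>i<k. \<forall>l<N. (\<Sum>m<N. a l m * u i m) = e i * u i l" by blast
  then have u: "\<And>i j. i < k \<Longrightarrow> j < k \<Longrightarrow> (\<Sum>l<N. u i l * u j l) = (if i = j then 1 else 0)"
    "\<And>i l. i < k \<Longrightarrow> l < N \<Longrightarrow> (\<Sum>m<N. a l m * u i m) = e i * u i l" by blast+
  from orthonormal_extend[OF \<open>k \<le> N\<close> u(1)] obtain u'
    where "\<forall>i<k. u' i = u i"
      "\<forall>i<N. \<forall>j<N. (\<Sum>l<N. u' i l * u' j l) = (if i = j then 1 else 0)" by blast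
  then have u': "\<And>i. i < k \<Longrightarrow> u' i = u i"
    "\<And>i j. i < N \<Longrightarrow> j < N \<Longrightarrow> (\<Sum>l<N. u' i l * u' j l) = (if i = j then 1 else 0)" by blast+
  \<comment> \<open>A square matrix with orthonormal rows also has orthonormal columns; this is the
    completeness relation behind \<open>expand\<close>.\<close>
  have compl: "(\<Sum>i<N. u' i l * u' i m) = (if l = m then 1 else 0)" if "l < N" "m < N" for l m
  proof -
    define U where "U = Matrix.mat N N (\<lambda>(i, l). u' i l)"
    have U: "U \<in> carrier_mat N N" "U\<^sup>T \<in> carrier_mat N N" by (auto simp: U_def)
    have "U * U\<^sup>T = 1\<^sub>m N"
      by (rule eq_matI) (auto simp: U_def scalar_prod_def u'(2) lessThan_atLeast0[symmetric])
    from mat_mult_left_right_inverse[OF U this] have "U\<^sup>T * U = 1\<^sub>m N" .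
    then have "(U\<^sup>T * U) $$ (l, m) = (if l = m then 1 else 0)" using that by simp
    then show ?thesis
      using that by (simp add: U_def scalar_prod_def lessThan_atLeast0[symmetric])
  qed
  \<comment> \<open>\<open>b\<close> is the compression of \<open>a\<close> to the span of the
    vectors \<open>u' i\<close> with \<open>k \<le> i\<close>; an eigenvector \<open>y\<close> of it
    gives the coordinates of \<open>v\<close>.\<close>
  define b where "b i j = (\<Sum>l<N. \<Sum>m<N. u' (k + i) l * a l m * u' (k + j) m)" for i j
  have "b i j = b j i" for i j
    unfolding b_def by (subst sum.swap) (intro sum.cong refl, simp add: sym mult_ac)
  then obtain \<mu> y where y: "\<exists>i<N - k. y i \<noteq> 0" "\<And>i. i < N - k \<Longrightarrow> (\<Sum>j<N - k. b i j * y j) = \<mu> * y i"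
    using symmetric_has_eigenvector[of "N - k" b] Suc.prems by auto
  define v where "v l = (\<Sum>j<N - k. y j * u' (k + j) l)" for l
  have u'v: "(\<Sum>l<N. u' i l * v l) = (if k \<le> i then y (i - k) else 0)" if "i < N" for i
  proof -
    have "(\<Sum>l<N. u' i l * v l) = (\<Sum>j<N - k. y j * (\<Sum>l<N. u' i l * u' (k + j) l))"
      unfolding v_def sum_distrib_left by (subst sum.swap) (simp add: mult_ac)
    also have "\<dots> = (\<Sum>j<N - k. if j = i - k \<and> k \<le> i then y j else 0)"
      using that by (intro sum.cong refl) (auto simp: u'(2))
    also have "\<dots> = (if k \<le> i then y (i - k) else 0)" using that by auto
    finally show ?thesis .
  qed
  define w where "w l = (\<Sum>m<N. a l m * v m)" for l
  \<comment> \<open>Coefficients of \<open>a v\<close> in the orthonormal basis. From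
    \<open>k\<close> on they come from the eigenvector equation for \<open>b\<close>; the first
    \<open>k\<close> vanish because symmetry moves \<open>a\<close> onto the eigenvector
    \<open>u i\<close>, which is orthogonal to \<open>v\<close>.\<close>
  have wu: "(\<Sum>l<N. u' i l * w l) = \<mu> * (if k \<le> i then y (i - k) else 0)" if "i < N" for i
  proof (cases "k \<le> i")
    case True
    have "(\<Sum>l<N. u' i l * w l) = (\<Sum>l<N. \<Sum>m<N. \<Sum>j<N - k. u' i l * a l m * u' (k + j) m * y j)"
      by (simp add: w_def v_def sum_distrib_left mult_ac)
    also have "\<dots> = (\<Sum>l<N. \<Sum>j<N - k. \<Sum>m<N. u' i l * a l m * u' (k + j) m * y j)"
      by (intro sum.cong refl sum.swap)
    also have "\<dots> = (\<Sum>j<N - k. b (i - k) j * y j)"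
      using True by (subst sum.swap) (simp add: b_def sum_distrib_right)
    also have "\<dots> = \<mu> * y (i - k)" using True that by (intro y) auto
    finally show ?thesis using True by simp
  next
    case False
    have "(\<Sum>l<N. u' i l * w l) = (\<Sum>l<N. \<Sum>m<N. u' i l * a l m * v m)"
      by (simp add: w_def sum_distrib_left mult_ac)
    also have "\<dots> = (\<Sum>m<N. \<Sum>l<N. u' i l * a l m * v m)" by (rule sum.swap)
    also have "\<dots> = (\<Sum>m<N. (\<Sum>l<N. a m l * u i l) * v m)"
      using False u'(1)[of i] sym by (intro sum.cong refl) (simp add: sum_distrib_left mult_ac)
    also have "\<dots> = e i * (\<Sum>m<N. u' i m * v m)"
      using False u'(1)[of i] by (simp add: u sum_distrib_left mult_ac)
    also have "\<dots> = 0" using u'v[OF that] False by simp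
    finally show ?thesis using False by simp
  qed
  have expand: "x m = (\<Sum>i<N. (\<Sum>l<N. u' i l * x l) * u' i m)" if "m < N" for x :: "nat \<Rightarrow> real" and m
  proof -
    have "(\<Sum>i<N. (\<Sum>l<N. u' i l * x l) * u' i m) = (\<Sum>l<N. x l * (\<Sum>i<N. u' i l * u' i m))"
      unfolding sum_distrib_left sum_distrib_right by (subst sum.swap) (simp add: mult_ac)
    also have "\<dots> = (\<Sum>l<N. if l = m then x l else 0)"
      using that by (intro sum.cong refl) (auto simp: compl)
    finally show ?thesis using that by simp
  qed
  have eig: "w m = \<mu> * v m" if "m < N" for m
  proof -
    have "w m = (\<Sum>i<N. (\<Sum>l<N. u' i l * w l) * u' i m)" by (rule expand[OF that])
    also have "\<dots> = (\<Sum>i<N. \<mu> * ((\<Sum>l<N. u' i l * v l) * u' i m))"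
      by (intro sum.cong refl) (simp add: wu u'v)
    also have "\<dots> = \<mu> * v m"
      by (simp only: sum_distrib_left[symmetric] expand[OF that, of v, symmetric])
    finally show ?thesis .
  qed
  define c where "c = (\<Sum>l<N. v l * v l)"
  have "\<exists>l<N. v l \<noteq> 0"
  proof (rule ccontr)
    assume "\<not> ?thesis"
    then have "(\<Sum>l<N. u' i l * v l) = 0" for i by simp
    moreover obtain i where "i < N - k" "y i \<noteq> 0" using y(1) by blast
    moreover have "k + i < N" using \<open>i < N - k\<close> by simp
    ultimately show False using u'v[of "k + i"] by simp
  qed
  then have "c > 0" unfolding c_def using sum_squares_pos by blast
  define q where "q l = v l / sqrt c" for l
  have qq: "(\<Sum>l<N. q l * q l) = 1"
    using \<open>c > 0\<close> by (simp add: q_def sum_divide_distrib[symmetric] c_def[symmetric])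
  have uq: "(\<Sum>l<N. u i l * q l) = 0" if "i < k" for i
    using u'v[of i] u'(1)[OF that] that Suc.prems by (simp add: q_def sum_divide_distrib[symmetric])
  have aq: "(\<Sum>m<N. a l m * q m) = \<mu> * q l" if "l < N" for l
    using eig[OF that] by (simp add: q_def w_def sum_divide_distrib[symmetric])
  show ?case
  proof (intro exI[of _ "u(k := q)"] exI[of _ "e(k := \<mu>)"] conjI allI impI)
    have qu: "(\<Sum>l<N. q l * u i l) = 0" if "i < k" for i
      using uq[OF that] by (simp only: mult.commute)
    fix i j assume ij: "i < Suc k" "j < Suc k"
    show "(\<Sum>l<N. (u(k := q)) i l * (u(k := q)) j l) = (if i = j then 1 else 0)"
    proof (cases "i = k")
      case True
      then show ?thesis using ij qq qu[of j] by (cases "j = k") (simp_all only: fun_upd_apply if_True if_False, auto)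
    next
      case False
      then show ?thesis using ij u(1)[of i j] uq[of i] by (cases "j = k") (simp_all only: fun_upd_apply if_True if_False, auto)
    qed
  next
    fix i l assume il: "i < Suc k" "l < N"
    show "(\<Sum>m<N. a l m * (u(k := q)) i m) = (e(k := \<mu>)) i * (u(k := q)) i l"
    proof (cases "i = k")
      case True
      then show ?thesis using aq[OF il(2)] by (simp only: fun_upd_same)
    next
      case False
      then have "i < k" using il by simp
      from u(2)[OF this il(2)] show ?thesis using False by simp
    qed
  qed
qed

lemma order_prod_linear:
  fixes e :: "nat \<Rightarrow> 'a::idom"
  shows "Polynomial.order x (\<Prod>i<N. [:- e i, 1:]) = card {i. i < N \<and> e i = x}"
proof (induction N)
  case 0
  have "Polynomial.order x (1 :: 'a poly) = 0" by (rule order_0I) simp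
  then show ?case by simp
next
  case (Suc N)
  have "(\<Prod>i<N. [:- e i, 1:]) \<noteq> 0" 
    unfolding prod_zero_iff[OF finite_lessThan] by simp
  then have nz: "(\<Prod>i<N. [:- e i, 1:]) * [:- e N, 1:] \<noteq> 0" by (rule no_zero_divisors) simp
  have split: "{i. i < Suc N \<and> e i = x} = {i. i < N \<and> e i = x} \<union> (if e N = x then {N} else {})"
    by (auto simp: less_Suc_eq)
  have "card {i. i < Suc N \<and> e i = x} = card {i. i < N \<and> e i = x} + (if e N = x then 1 else 0)"
    unfolding split by (subst card_Un_disjoint) auto
  then show ?case
    unfolding prod.lessThan_Suc Polynomial.order_mult[OF nz] order_linear' Suc by simp
qed

text \<open>The entrywise spectral decomposition supplies quadratic forms and factorisations. The
  characteristic polynomial is recorded with the same numbers \<open>e\<close>, since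
  \<open>inertia_pos\<close> and \<open>inertia_neg\<close> count algebraic multiplicities.\<close>

lemma symmetric_eigenbasis:
  fixes A :: "real mat"
  assumes A: "A \<in> carrier_mat N N" and sym: "\<And>i j. i < N \<Longrightarrow> j < N \<Longrightarrow> A $$ (i, j) = A $$ (j, i)"
  obtains u e where
    "\<And>i j. i < N \<Longrightarrow> j < N \<Longrightarrow> (\<Sum>l<N. u i l * u j l) = (if i = j then 1 else 0)"
    "\<And>l m. l < N \<Longrightarrow> m < N \<Longrightarrow> A $$ (l, m) = (\<Sum>i<N. e i * u i l * u i m)"
    "char_poly A = (\<Prod>i<N. [:- e i, 1:])"
proof -
  from symmetric_partial_eigenbasis[of N "\<lambda>i j. A $$ (i, j)" N, OF sym] obtain u e
    where "\<forall>i<N. \<forall>j<N. (\<Sum>l<N. u i l * u j l) = (if i = j then 1 else 0)"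
      "\<forall>i<N. \<forall>l<N. (\<Sum>m<N. A $$ (l, m) * u i m) = e i * u i l" by blast
  then have u: "\<And>i j. i < N \<Longrightarrow> j < N \<Longrightarrow> (\<Sum>l<N. u i l * u j l) = (if i = j then 1 else 0)"
    and e: "\<And>i l. i < N \<Longrightarrow> l < N \<Longrightarrow> (\<Sum>m<N. A $$ (l, m) * u i m) = e i * u i l" by blast+
  define U where "U = Matrix.mat N N (\<lambda>(l, i). u i l)"
  have U: "U \<in> carrier_mat N N" "U\<^sup>T \<in> carrier_mat N N" by (auto simp: U_def)
  have UU: "U\<^sup>T * U = 1\<^sub>m N"
    by (rule eq_matI) (auto simp: U_def scalar_prod_def u lessThan_atLeast0[symmetric])
  from mat_mult_left_right_inverse[OF U(2) U(1) this] have UU': "U * U\<^sup>T = 1\<^sub>m N" .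
  have "A * U = U * mat_diag N e"
  proof (rule eq_matI)
    fix l i assume "l < dim_row (U * mat_diag N e)" "i < dim_col (U * mat_diag N e)"
    then have li: "l < N" "i < N" by (auto simp: U_def mat_diag_def)
    have "(A * U) $$ (l, i) = (\<Sum>m<N. A $$ (l, m) * u i m)"
      using A li by (simp add: U_def scalar_prod_def lessThan_atLeast0[symmetric])
    also have "\<dots> = u i l * e i" using e li by (simp add: mult.commute)
    also have "\<dots> = (U * mat_diag N e) $$ (l, i)"
      unfolding mat_diag_mult_right[OF U(1)] using li by (simp add: U_def)
    finally show "(A * U) $$ (l, i) = (U * mat_diag N e) $$ (l, i)" .
  qed (use A in \<open>auto simp: U_def mat_diag_def\<close>)
  then have "U * mat_diag N e * U\<^sup>T = A * U * U\<^sup>T" by simp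
  also have "\<dots> = A * (U * U\<^sup>T)" by (rule assoc_mult_mat[OF A U])
  also have "\<dots> = A" using UU' A by simp
  finally have AU: "A = U * mat_diag N e * U\<^sup>T" ..
  have D: "mat_diag N e \<in> carrier_mat N N" by simp
  have "similar_mat A (mat_diag N e)"
    unfolding similar_mat_def
    by (intro exI[of _ U] exI[of _ "U\<^sup>T"] similar_mat_witI[OF UU' UU AU A D U])
  then have "char_poly A = char_poly (mat_diag N e)" by (rule char_poly_similar)
  also have "\<dots> = (\<Prod>a\<leftarrow>diag_mat (mat_diag N e). [:- a, 1:])"
    by (rule char_poly_upper_triangular[OF D]) (auto simp: mat_diag_def upper_triangular_def)
  also have "diag_mat (mat_diag N e) = map e [0..<N]"
    by (auto simp: diag_mat_def mat_diag_def)
  also have "(\<Prod>a\<leftarrow>map e [0..<N]. [:- a, 1:]) = (\<Prod>i<N. [:- e i, 1:])"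
    by (simp add: prod.distinct_set_conv_list[symmetric] o_def lessThan_atLeast0)
  finally have char: "char_poly A = (\<Prod>i<N. [:- e i, 1:])" .
  have "A $$ (l, m) = (\<Sum>i<N. e i * u i l * u i m)" if "l < N" "m < N" for l m
  proof -
    have "A $$ (l, m) = (U * mat_diag N e * U\<^sup>T) $$ (l, m)" by (simp only: AU[symmetric])
    also have "\<dots> = (\<Sum>i<N. e i * u i l * u i m)"
      unfolding mat_diag_mult_right[OF U(1)] using that
      by (simp add: U_def scalar_prod_def lessThan_atLeast0[symmetric] mult_ac)
    finally show ?thesis .
  qed
  then show ?thesis using u char by (intro that[of u e])
qed

lemma inertia_eq_card:
  fixes A :: "real mat"
  assumes A: "A \<in> carrier_mat N N" and char: "char_poly A = (\<Prod>i<N. [:- e i, 1:])"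
  shows "inertia_pos A = card {i. i < N \<and> 0 < e i}"
    and "inertia_neg A = card {i. i < N \<and> e i < 0}"
proof -
  have ev: "eigenvalue A x \<longleftrightarrow> (\<exists>i<N. e i = x)" for x
    unfolding eigenvalue_root_char_poly[OF A] char poly_prod by (auto simp: prod_zero_iff)
  have count: "(\<Sum>x\<in>{x. eigenvalue A x \<and> P x}. Polynomial.order x (char_poly A))
      = card {i. i < N \<and> P (e i)}" for P
  proof -
    have "{x. eigenvalue A x \<and> P x} = e ` {i. i < N \<and> P (e i)}" by (auto simp: ev)
    then have "(\<Sum>x\<in>{x. eigenvalue A x \<and> P x}. Polynomial.order x (char_poly A))
        = (\<Sum>x\<in>e ` {i. i < N \<and> P (e i)}. \<Sum>i\<in>{i \<in> {i. i < N \<and> P (e i)}. e i = x}. 1)"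
      unfolding char order_prod_linear by (auto intro!: sum.cong arg_cong[where f = card])
    also have "\<dots> = (\<Sum>i\<in>{i. i < N \<and> P (e i)}. 1)"
      by (rule sum.image_gen[symmetric]) auto
    finally show ?thesis by simp
  qed
  show "inertia_pos A = card {i. i < N \<and> 0 < e i}"
    unfolding inertia_pos_def by (rule count)
  show "inertia_neg A = card {i. i < N \<and> e i < 0}"
    unfolding inertia_neg_def by (rule count)
qed

text \<open>Both sides count the nonzero \<open>e i\<close>. The spectral decomposition factors
  \<open>A\<close> through these indices, bounding the rank from above; a shorter factorisation
  would let \<open>A\<close> annihilate a nonzero combination \<open>w\<close> of eigenvectors with
  nonzero eigenvalues.\<close>

lemma inertia_sum_eq_rank:
  fixes A :: "real mat"
  assumes A: "A \<in> carrier_mat N N" and sym: "\<And>i j. i < N \<Longrightarrow> j < N \<Longrightarrow> A $$ (i, j) = A $$ (j, i)"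
  shows "inertia_pos A + inertia_neg A = mat_rank A"
proof -
  obtain u e where u: "\<And>i j. i < N \<Longrightarrow> j < N \<Longrightarrow> (\<Sum>l<N. u i l * u j l) = (if i = j then 1 else 0)"
    and Ae: "\<And>l m. l < N \<Longrightarrow> m < N \<Longrightarrow> A $$ (l, m) = (\<Sum>i<N. e i * u i l * u i m)"
    and char: "char_poly A = (\<Prod>i<N. [:- e i, 1:])"
    using symmetric_eigenbasis[OF A sym] by blast
  define K where "K = {i. i < N \<and> e i \<noteq> 0}"
  have K: "finite K" "K \<subseteq> {..<N}" by (auto simp: K_def)
  have "K = {i. i < N \<and> 0 < e i} \<union> {i. i < N \<and> e i < 0}" by (auto simp: K_def)
  then have "card K = card {i. i < N \<and> 0 < e i} + card {i. i < N \<and> e i < 0}"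
    by (simp only:) (rule card_Un_disjoint, auto)
  also have "\<dots> = inertia_pos A + inertia_neg A" by (simp add: inertia_eq_card[OF A char])
  finally have cardK: "inertia_pos A + inertia_neg A = card K" ..
  have AK: "A $$ (l, m) = (\<Sum>i\<in>K. (e i * u i l) * u i m)" if "l < N" "m < N" for l m
    unfolding Ae[OF that] by (rule sum.mono_neutral_right) (auto simp: K_def)
  have "mat_rank A \<le> card K"
    by (rule rank_le_factorization[OF A K(1) AK])
  moreover have "card K \<le> mat_rank A"
  proof (rule ccontr)
    assume less: "\<not> card K \<le> mat_rank A"
    from rank_factorization[OF A] obtain K' :: "real Matrix.vec set" and f g
      where K': "finite K'" "card K' = mat_rank A"
        "\<And>i j. i < N \<Longrightarrow> j < N \<Longrightarrow> A $$ (i, j) = (\<Sum>k\<in>K'. f i k * g k j)" by blast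
    have "card K' < card K" using K' less by simp
    from nontrivial_kernel[OF K'(1) K(1) this, of "\<lambda>k i. \<Sum>m<N. g k m * u i m"] obtain x
      where x: "\<exists>i\<in>K. x i \<noteq> 0" "\<And>k. k \<in> K' \<Longrightarrow> (\<Sum>i\<in>K. (\<Sum>m<N. g k m * u i m) * x i) = 0" by blast
    define w where "w m = (\<Sum>i\<in>K. x i * u i m)" for m
    have gw: "(\<Sum>m<N. g k m * w m) = 0" if "k \<in> K'" for k
    proof -
      have "(\<Sum>m<N. g k m * w m) = (\<Sum>i\<in>K. (\<Sum>m<N. g k m * u i m) * x i)"
        unfolding w_def sum_distrib_left sum_distrib_right by (subst sum.swap) (simp add: mult_ac)
      then show ?thesis using x(2)[OF that] by simp
    qed
    have Aw: "(\<Sum>m<N. A $$ (l, m) * w m) = 0" if "l < N" for l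
    proof -
      have "(\<Sum>m<N. A $$ (l, m) * w m) = (\<Sum>m<N. \<Sum>k\<in>K'. f l k * (g k m * w m))"
        using that by (intro sum.cong refl) (simp add: K'(3) sum_distrib_right mult.assoc)
      also have "\<dots> = (\<Sum>k\<in>K'. f l k * (\<Sum>m<N. g k m * w m))"
        by (subst sum.swap) (simp add: sum_distrib_left)
      finally show ?thesis by (simp add: gw)
    qed
    have uw: "(\<Sum>m<N. u i m * w m) = x i" if "i \<in> K" for i
    proof -
      have "(\<Sum>m<N. u i m * w m) = (\<Sum>j\<in>K. x j * (\<Sum>m<N. u i m * u j m))"
        unfolding w_def sum_distrib_left by (subst sum.swap) (simp add: mult_ac)
      also have "\<dots> = (\<Sum>j\<in>K. if i = j then x j else 0)"
        using that K(2) by (intro sum.cong refl) (auto simp: u subset_iff)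
      finally show ?thesis using that K by simp
    qed
    have "x j = 0" if "j \<in> K" for j
    proof -
      have jN: "j < N" and ej: "e j \<noteq> 0" using that by (auto simp: K_def)
      have Aw_expand: "(\<Sum>m<N. A $$ (l, m) * w m) = (\<Sum>i\<in>K. e i * u i l * x i)" if "l < N" for l
      proof -
        have "(\<Sum>m<N. A $$ (l, m) * w m) = (\<Sum>m<N. \<Sum>i\<in>K. e i * u i l * (u i m * w m))"
          using that by (intro sum.cong refl) (simp add: AK sum_distrib_right mult.assoc)
        also have "\<dots> = (\<Sum>i\<in>K. e i * u i l * (\<Sum>m<N. u i m * w m))"
          by (subst sum.swap) (simp add: sum_distrib_left)
        finally show ?thesis by (simp add: uw)
      qed
      have "0 = (\<Sum>l<N. u j l * (\<Sum>m<N. A $$ (l, m) * w m))" by (simp add: Aw)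
      also have "\<dots> = (\<Sum>l<N. u j l * (\<Sum>i\<in>K. e i * u i l * x i))" by (simp add: Aw_expand)
      also have "\<dots> = (\<Sum>i\<in>K. e i * x i * (\<Sum>l<N. u j l * u i l))"
        unfolding sum_distrib_left by (subst sum.swap) (simp add: mult_ac)
      also have "\<dots> = (\<Sum>i\<in>K. if j = i then e i * x i else 0)"
        using jN K(2) by (intro sum.cong refl) (auto simp: u subset_iff)
      also have "\<dots> = e j * x j" using that K by simp
      finally show ?thesis using ej by simp
    qed
    then show False using x(1) by blast
  qed
  ultimately show ?thesis using cardK by simp
qed

text \<open>Half of Sylvester's law, for both signs at once through \<sigma> (later 1 and -1). Too
  many \<open>e i\<close> of the given sign would leave a nonzero combination \<open>w\<close> of
  their eigenvectors orthogonal to all \<open>v k\<close> whose weight \<open>\<rho> k\<close> has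
  that sign. The quadratic form at \<open>w\<close>, times \<sigma>, would then be nonpositive by
  one expansion and positive by the other.\<close>

lemma card_definite_le:
  fixes A :: "real mat" and \<rho> :: "'k \<Rightarrow> real"
  assumes u: "\<And>i j. i < N \<Longrightarrow> j < N \<Longrightarrow> (\<Sum>l<N. u i l * u j l) = (if i = j then 1 else 0)"
    and Ae: "\<And>l m. l < N \<Longrightarrow> m < N \<Longrightarrow> A $$ (l, m) = (\<Sum>i<N. e i * u i l * u i m)"
    and K: "finite K"
    and A\<rho>: "\<And>l m. l < N \<Longrightarrow> m < N \<Longrightarrow> A $$ (l, m) = (\<Sum>k\<in>K. \<rho> k * v k l * v k m)"
  shows "card {i. i < N \<and> 0 < \<sigma> * e i} \<le> card {k \<in> K. 0 < \<sigma> * \<rho> k}"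
proof (rule ccontr)
  let ?P = "{k \<in> K. 0 < \<sigma> * \<rho> k}" and ?I = "{i. i < N \<and> 0 < \<sigma> * e i}"
  have fin: "finite ?P" "finite ?I" using K by auto
  assume "\<not> card ?I \<le> card ?P"
  then have "card ?P < card ?I" by simp
  from nontrivial_kernel[OF fin this, of "\<lambda>k i. \<Sum>m<N. v k m * u i m"] obtain x
    where x: "\<exists>i\<in>?I. x i \<noteq> 0" "\<And>k. k \<in> ?P \<Longrightarrow> (\<Sum>i\<in>?I. (\<Sum>m<N. v k m * u i m) * x i) = 0" by blast
  define w where "w m = (\<Sum>i\<in>?I. x i * u i m)" for m
  have vw: "(\<Sum>m<N. v k m * w m) = 0" if "k \<in> ?P" for k
  proof -
    have "(\<Sum>m<N. v k m * w m) = (\<Sum>i\<in>?I. (\<Sum>m<N. v k m * u i m) * x i)"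
      unfolding w_def sum_distrib_left sum_distrib_right by (subst sum.swap) (simp add: mult_ac)
    then show ?thesis using x(2)[OF that] by simp
  qed
  have uw: "(\<Sum>m<N. u i m * w m) = (if i \<in> ?I then x i else 0)" if "i < N" for i
  proof -
    have "(\<Sum>m<N. u i m * w m) = (\<Sum>j\<in>?I. x j * (\<Sum>m<N. u i m * u j m))"
      unfolding w_def sum_distrib_left by (subst sum.swap) (simp add: mult_ac)
    also have "\<dots> = (\<Sum>j\<in>?I. if i = j then x j else 0)"
      using that by (intro sum.cong refl) (auto simp: u)
    finally show ?thesis using fin by simp
  qed
  have form: "(\<Sum>l<N. \<Sum>m<N. (\<Sum>k\<in>L. c k * z k l * z k m) * w l * w m)
      = (\<Sum>k\<in>L. c k * (\<Sum>m<N. z k m * w m)\<^sup>2)" for L :: "'l set" and c z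
  proof -
    have "(\<Sum>l<N. \<Sum>m<N. (\<Sum>k\<in>L. c k * z k l * z k m) * w l * w m)
        = (\<Sum>l<N. \<Sum>m<N. \<Sum>k\<in>L. c k * ((z k l * w l) * (z k m * w m)))"
      by (simp add: sum_distrib_left sum_distrib_right mult_ac)
    also have "\<dots> = (\<Sum>l<N. \<Sum>k\<in>L. \<Sum>m<N. c k * ((z k l * w l) * (z k m * w m)))"
      by (intro sum.cong refl sum.swap)
    also have "\<dots> = (\<Sum>k\<in>L. \<Sum>l<N. \<Sum>m<N. c k * ((z k l * w l) * (z k m * w m)))"
      by (rule sum.swap)
    also have "\<dots> = (\<Sum>k\<in>L. c k * (\<Sum>m<N. z k m * w m)\<^sup>2)"
      by (simp add: power2_eq_square sum_distrib_left sum_distrib_right mult_ac)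
    finally show ?thesis .
  qed
  define S where "S = \<sigma> * (\<Sum>l<N. \<Sum>m<N. A $$ (l, m) * w l * w m)"
  have "S = \<sigma> * (\<Sum>k\<in>K. \<rho> k * (\<Sum>m<N. v k m * w m)\<^sup>2)"
    unfolding S_def form[symmetric] by (simp add: A\<rho>)
  also have "\<dots> = (\<Sum>k\<in>K. (\<sigma> * \<rho> k) * (\<Sum>m<N. v k m * w m)\<^sup>2)"
    by (simp add: sum_distrib_left mult.assoc)
  also have "\<dots> \<le> 0"
  proof (rule sum_nonpos)
    fix k assume k: "k \<in> K"
    show "(\<sigma> * \<rho> k) * (\<Sum>m<N. v k m * w m)\<^sup>2 \<le> 0"
    proof (cases "0 < \<sigma> * \<rho> k")
      case True
      then show ?thesis using vw[of k] k by simp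
    next
      case False
      then have "\<sigma> * \<rho> k \<le> 0" by simp
      from mult_nonpos_nonneg[OF this zero_le_power2] show ?thesis .
    qed
  qed
  finally have "S \<le> 0" .
  have "S = \<sigma> * (\<Sum>i<N. e i * (\<Sum>m<N. u i m * w m)\<^sup>2)"
    unfolding S_def form[symmetric] by (simp add: Ae)
  also have "\<dots> = (\<Sum>i<N. (\<sigma> * e i) * (if i \<in> ?I then x i else 0)\<^sup>2)"
    unfolding sum_distrib_left by (intro sum.cong refl) (simp add: uw)
  also have "\<dots> > 0"
  proof -
    obtain i where i: "i \<in> ?I" "x i \<noteq> 0" using x(1) by blast
    show ?thesis
    proof (rule sum_pos2[of _ i])
      show "0 < \<sigma> * e i * (if i \<in> ?I then x i else 0)\<^sup>2" using i by simp
    qed (use i in auto)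
  qed
  finally show False using \<open>S \<le> 0\<close> by simp
qed

text \<open>These are only inequalities, because the vectors \<open>v k\<close> may be dependent.
  When \<open>card K\<close> is the rank of \<open>A\<close>, comparing total counts turns them into
  equalities.\<close>

lemma inertia_le:
  fixes A :: "real mat" and \<rho> :: "'k \<Rightarrow> real"
  assumes A: "A \<in> carrier_mat N N" and K: "finite K"
    and A\<rho>: "\<And>l m. l < N \<Longrightarrow> m < N \<Longrightarrow> A $$ (l, m) = (\<Sum>k\<in>K. \<rho> k * v k l * v k m)"
  shows "inertia_pos A \<le> card {k \<in> K. 0 < \<rho> k}" and "inertia_neg A \<le> card {k \<in> K. \<rho> k < 0}"
proof -
  have sym: "A $$ (i, j) = A $$ (j, i)" if "i < N" "j < N" for i j
    using that by (simp add: A\<rho> mult_ac)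
  obtain u e where u: "\<And>i j. i < N \<Longrightarrow> j < N \<Longrightarrow> (\<Sum>l<N. u i l * u j l) = (if i = j then 1 else 0)"
    and Ae: "\<And>l m. l < N \<Longrightarrow> m < N \<Longrightarrow> A $$ (l, m) = (\<Sum>i<N. e i * u i l * u i m)"
    and char: "char_poly A = (\<Prod>i<N. [:- e i, 1:])"
    using symmetric_eigenbasis[OF A sym] by blast
  note le = card_definite_le[of N u A e K \<rho> v, OF u Ae K A\<rho>]
  show "inertia_pos A \<le> card {k \<in> K. 0 < \<rho> k}"
    using le[of 1] by (simp add: inertia_eq_card[OF A char])
  show "inertia_neg A \<le> card {k \<in> K. \<rho> k < 0}"
    using le[of "-1"] by (simp add: inertia_eq_card[OF A char])
qed

section \<open>Signed measures with finite support\<close>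

lemma continuous_mpow [continuous_intros]: "continuous_on S (\<lambda>x :: real ^ 'd::finite. mpow x \<gamma>)"
  unfolding mpow_def by (intro continuous_intros)

lemma borel_measurable_mpow [measurable]: "(\<lambda>x :: real ^ 'd::finite. mpow x \<gamma>) \<in> borel_measurable borel"
  by (intro borel_measurable_continuous_onI continuous_intros)

text \<open>\<open>signed_representing_measure\<close> and \<open>jordan_support_cards\<close> each
  quantify over their own Jordan decomposition; uniqueness lets moments and supports be read off the
  same pair.\<close>

lemma jordan_decomposition_unique:
  assumes "jordan_decomposition \<mu> p m" "jordan_decomposition \<mu> p' m'"
  shows "p = p'" "m = m'"
proof -
  \<comment> \<open>The positive part is minimal: with the Hahn set \<open>P\<close> of
    \<open>p\<close> and \<open>m\<close>, p(A) = \<mu>(A \<inter> P) \<le> p'(A \<inter> P) \<le>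
    p'(A), and dually for \<open>m\<close> on the complement. Exchanging the two decompositions
    gives equality.\<close>
  have pos: "emeasure p A \<le> emeasure p' A" "emeasure m A \<le> emeasure m' A"
    if jd: "jordan_decomposition \<mu> p m" "jordan_decomposition \<mu> p' m'" and A: "A \<in> sets borel" for p m p' m' A
  proof -
    interpret p: finite_measure p using jd(1) unfolding jordan_decomposition_def by blast
    interpret m: finite_measure m using jd(1) unfolding jordan_decomposition_def by blast
    interpret p': finite_measure p' using jd(2) unfolding jordan_decomposition_def by blast
    interpret m': finite_measure m' using jd(2) unfolding jordan_decomposition_def by blast
    from jd(1) obtain P where P: "P \<in> sets borel" "emeasure p (- P) = 0" "emeasure m P = 0"
      unfolding jordan_decomposition_def by blast
    have sets: "sets p = sets borel" "sets m = sets borel" "sets p' = sets borel" "sets m' = sets borel"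
      using jd unfolding jordan_decomposition_def by blast+
    have diff: "measure p B - measure m B = measure p' B - measure m' B" if "B \<in> sets borel" for B
      using jd that unfolding jordan_decomposition_def by metis
    have AP: "A \<inter> P \<in> sets borel" "A - P \<in> sets borel" using A P by auto
    have split: "measure M A = measure M (A \<inter> P) + measure M (A - P)"
      if "finite_measure M" "sets M = sets borel" for M
      using finite_measure.finite_measure_Union[OF that(1), of "A \<inter> P" "A - P"] AP that(2)
      by (auto simp: Un_Diff_Int Un_commute Int_Diff)
    have "measure p (A - P) \<le> measure p (- P)"
      by (rule p.finite_measure_mono) (use P sets in auto)
    moreover have "measure p (- P) = 0" using P by (simp add: measure_def)
    ultimately have "measure p (A - P) = 0" using measure_nonneg[of p "A - P"] by linarith
    have "measure m (A \<inter> P) \<le> measure m P"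
      by (rule m.finite_measure_mono) (use P sets in auto)
    moreover have "measure m P = 0" using P by (simp add: measure_def)
    ultimately have "measure m (A \<inter> P) = 0" using measure_nonneg[of m "A \<inter> P"] by linarith
    have "measure p A \<le> measure p' A"
      using diff[OF AP(1)] split[OF p.finite_measure_axioms sets(1)]
        split[OF p'.finite_measure_axioms sets(3)] \<open>measure p (A - P) = 0\<close> \<open>measure m (A \<inter> P) = 0\<close>
        measure_nonneg[of m' "A \<inter> P"] measure_nonneg[of p' "A - P"] by linarith
    then show "emeasure p A \<le> emeasure p' A"
      by (simp add: p.emeasure_eq_measure p'.emeasure_eq_measure)
    have "measure m A \<le> measure m' A"
      using diff[OF AP(2)] split[OF m.finite_measure_axioms sets(2)]
        split[OF m'.finite_measure_axioms sets(4)] \<open>measure p (A - P) = 0\<close> \<open>measure m (A \<inter> P) = 0\<close>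
        measure_nonneg[of p' "A - P"] measure_nonneg[of m' "A \<inter> P"] by linarith
    then show "emeasure m A \<le> emeasure m' A"
      by (simp add: m.emeasure_eq_measure m'.emeasure_eq_measure)
  qed
  have sets: "sets p = sets borel" "sets m = sets borel" "sets p' = sets borel" "sets m' = sets borel"
    using assms unfolding jordan_decomposition_def by blast+
  show "p = p'" using pos[OF assms] pos[OF assms(2,1)] sets
    by (intro measure_eqI antisym) auto
  show "m = m'" using pos[OF assms] pos[OF assms(2,1)] sets
    by (intro measure_eqI antisym) auto
qed

lemma jordan_decomposition_signed_borel_measure:
  assumes "jordan_decomposition \<mu> p m"
  shows "signed_borel_measure \<mu>"
proof -
  interpret p: finite_measure p using assms unfolding jordan_decomposition_def by blast
  interpret m: finite_measure m using assms unfolding jordan_decomposition_def by blast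
  have sets: "sets p = sets borel" "sets m = sets borel"
    and diff: "\<And>A. A \<in> sets borel \<Longrightarrow> \<mu> A = measure p A - measure m A"
    using assms unfolding jordan_decomposition_def by blast+
  have "\<mu> {} = 0" by (simp add: diff)
  moreover have "(\<lambda>i. \<mu> (A i)) sums \<mu> (\<Union>i. A i)"
    if A: "range A \<subseteq> sets borel" "disjoint_family A" for A :: "nat \<Rightarrow> _"
  proof -
    have "A i \<in> sets borel" for i using A by auto
    moreover from this have "(\<Union>i. A i) \<in> sets borel" by auto
    moreover have "(\<lambda>i. measure p (A i) - measure m (A i)) sums (measure p (\<Union>i. A i) - measure m (\<Union>i. A i))"
      using A sets by (intro sums_diff p.finite_measure_UNION m.finite_measure_UNION) auto
    ultimately show ?thesis by (simp add: diff)
  qed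
  ultimately show ?thesis unfolding signed_borel_measure_def by blast
qed

text \<open>The complement of the support is a union of open null sets, which the Lindelof property
  reduces to a countable union.\<close>

lemma emeasure_compl_msupport:
  fixes M :: "'a::second_countable_topology measure"
  assumes "sets M = sets borel"
  shows "emeasure M (- msupport M) = 0"
proof -
  define \<U> where "\<U> = {U. open U \<and> emeasure M U = 0}"
  obtain \<V> where \<V>: "\<V> \<subseteq> \<U>" "countable \<V>" "\<Union>\<V> = \<Union>\<U>"
    using Lindelof[of \<U>] unfolding \<U>_def by blast
  have "- msupport M = \<Union>\<V>"
    unfolding \<V>(3) by (auto simp: msupport_def \<U>_def)
  moreover have "U \<in> null_sets M" if "U \<in> \<V>" for U
    using \<V>(1) that assms by (auto simp: \<U>_def intro!: null_setsI)
  then have "\<Union>\<V> \<in> null_sets M" using null_sets_UN'[OF \<V>(2), of "\<lambda>U. U" M] by simp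
  ultimately show ?thesis by (simp add: null_setsD1)
qed

text \<open>Deleting the finitely many other support points leaves an open neighbourhood of
  \<open>z\<close>, which has positive mass; apart from \<open>z\<close> it lies in the null
  complement of the support.\<close>

lemma measure_singleton_pos:
  fixes M :: "'a::{second_countable_topology,t2_space} measure"
  assumes "sets M = sets borel" "finite_measure M" "finite (msupport M)" "z \<in> msupport M"
  shows "0 < measure M {z}"
proof -
  interpret finite_measure M by fact
  let ?U = "- (msupport M - {z})"
  have "open ?U" using assms(3) by (intro open_Compl finite_imp_closed) auto
  then have "emeasure M ?U \<noteq> 0" using assms(4) unfolding msupport_def by blast
  moreover have "emeasure M ?U \<le> emeasure M {z} + emeasure M (- msupport M)"
    using assms(1,3) \<open>open ?U\<close> finite_imp_closed[OF assms(3)]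
    by (intro order_trans[OF emeasure_mono emeasure_subadditive]) auto
  ultimately have "emeasure M {z} \<noteq> 0"
    using emeasure_compl_msupport[OF assms(1)] by auto
  then show ?thesis by (simp add: emeasure_eq_measure zero_less_measure_iff)
qed

lemma has_integral_finite_support:
  fixes M :: "'a::t2_space measure" and f :: "'a \<Rightarrow> real"
  assumes sets: "sets M = sets borel" and "finite_measure M" and F: "finite F" "emeasure M (- F) = 0"
    and f: "f \<in> borel_measurable borel"
  shows "integrable M f" and "(\<integral>x. f x \<partial>M) = (\<Sum>z\<in>F. measure M {z} * f z)"
proof -
  interpret finite_measure M by fact
  have [measurable]: "{z} \<in> sets M" for z by (simp add: sets)
  have fM: "f \<in> borel_measurable M" using f sets by (simp cong: measurable_cong_sets)
  let ?g = "\<lambda>x. \<Sum>z\<in>F. f z * indicator {z} x"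
  have g: "integrable M ?g"
    by (intro Bochner_Integration.integrable_sum integrable_mult_right integrable_real_indicator)
      (auto simp: emeasure_eq_measure)
  have closed: "closed F" using F by (intro finite_imp_closed)
  have AE_F: "AE x in M. x \<in> F"
    using F closed by (intro AE_I[of _ _ "- F"]) (auto simp: sets)
  have f_eq: "f x = ?g x" if "x \<in> F" for x
  proof -
    have "?g x = (\<Sum>z\<in>F. if z = x then f z else 0)" by (intro sum.cong) (auto simp: indicator_def)
    then show ?thesis using that F by simp
  qed
  from AE_F have AE: "AE x in M. f x = ?g x" by eventually_elim (rule f_eq)
  show "integrable M f" using integrable_cong_AE[OF fM _ AE] g by auto
  have "(\<integral>x. f x \<partial>M) = (\<integral>x. ?g x \<partial>M)" using fM g AE by (intro integral_cong_AE) auto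
  also have "\<dots> = (\<Sum>z\<in>F. \<integral>x. f z * indicator {z} x \<partial>M)"
    by (intro Bochner_Integration.integral_sum integrable_mult_right integrable_real_indicator)
      (auto simp: emeasure_eq_measure)
  also have "\<dots> = (\<Sum>z\<in>F. measure M {z} * f z)"
    using sets by (intro sum.cong refl) (simp add: sets_eq_imp_space_eq[OF sets])
  finally show "(\<integral>x. f x \<partial>M) = (\<Sum>z\<in>F. measure M {z} * f z)" .
qed

text \<open>\<open>point_measure\<close> takes all subsets of \<open>S\<close> as measurable sets;
  the image under the identity carries it to the Borel sets of the whole space. The weights are
  meant to be positive, as \<open>ennreal\<close> truncates negative ones to zero.\<close>

definition point_masses :: "'a set \<Rightarrow> ('a \<Rightarrow> real) \<Rightarrow> 'a::topological_space measure" where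
  "point_masses S w = distr (point_measure S (\<lambda>z. ennreal (w z))) borel (\<lambda>z. z)"

lemma sets_point_masses [simp]: "sets (point_masses S w) = sets borel"
  by (simp add: point_masses_def)

context
  fixes S :: "'a::t2_space set" and w :: "'a \<Rightarrow> real"
  assumes S: "finite S" and w: "\<And>z. z \<in> S \<Longrightarrow> 0 < w z"
begin

lemma emeasure_point_masses:
  assumes "A \<in> sets borel"
  shows "emeasure (point_masses S w) A = ennreal (\<Sum>z\<in>S \<inter> A. w z)"
proof -
  have "emeasure (point_masses S w) A = emeasure (point_measure S (\<lambda>z. ennreal (w z))) (S \<inter> A)"
    unfolding point_masses_def using assms
    by (subst emeasure_distr) (auto simp: space_point_measure Int_commute)
  also have "\<dots> = (\<Sum>z\<in>S \<inter> A. ennreal (w z))"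
    using S by (rule emeasure_point_measure_finite) auto
  also have "\<dots> = ennreal (\<Sum>z\<in>S \<inter> A. w z)"
    using w by (intro sum_ennreal) (auto intro: less_imp_le)
  finally show ?thesis .
qed

lemma measure_point_masses:
  assumes "A \<in> sets borel"
  shows "measure (point_masses S w) A = (\<Sum>z\<in>S \<inter> A. w z)"
proof -
  have "0 \<le> (\<Sum>z\<in>S \<inter> A. w z)" using w by (intro sum_nonneg) (auto intro: less_imp_le)
  then show ?thesis by (simp add: measure_def emeasure_point_masses[OF assms])
qed

lemma finite_measure_point_masses: "finite_measure (point_masses S w)"
  by (rule finite_measureI) (simp add: emeasure_point_masses sets_eq_imp_space_eq[OF sets_point_masses])

lemma msupport_point_masses: "msupport (point_masses S w) = S"
proof (intro equalityI subsetI)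
  fix x assume x: "x \<in> msupport (point_masses S w)"
  show "x \<in> S"
  proof (rule ccontr)
    assume "x \<notin> S"
    have "open (- S)" using S by (intro open_Compl finite_imp_closed)
    then have "emeasure (point_masses S w) (- S) \<noteq> 0"
      using x \<open>x \<notin> S\<close> unfolding msupport_def by blast
    then show False using \<open>open (- S)\<close> by (simp add: emeasure_point_masses)
  qed
next
  fix x assume x: "x \<in> S"
  have "emeasure (point_masses S w) U \<noteq> 0" if "open U" "x \<in> U" for U
  proof -
    have "0 < (\<Sum>z\<in>S \<inter> U. w z)"
      using S w x that by (intro sum_pos) auto
    then show ?thesis using that by (simp add: emeasure_point_masses)
  qed
  then show "x \<in> msupport (point_masses S w)" unfolding msupport_def by blast
qed

end

text \<open>The set of points of positive weight serves as Hahn set. Since \<open>zs\<close> is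
  distinct, the weights can be taken as a function \<open>u\<close> of the point; points of weight
  zero enter neither part.\<close>

lemma atomic_signed_measure_jordan:
  fixes zs :: "(real ^ 'd::finite) list"
  assumes "distinct zs" and w: "\<And>a. a < length zs \<Longrightarrow> vec_index w a = u (zs ! a)"
  shows "jordan_decomposition (atomic_signed_measure w zs)
    (point_masses {z \<in> set zs. 0 < u z} u) (point_masses {z \<in> set zs. u z < 0} (\<lambda>z. - u z))"
proof -
  let ?P = "{z \<in> set zs. 0 < u z}" and ?N = "{z \<in> set zs. u z < 0}"
  have fin: "finite ?P" "finite ?N" by auto
  note P = emeasure_point_masses[OF fin(1), of u] measure_point_masses[OF fin(1), of u]
    finite_measure_point_masses[OF fin(1), of u]
  note N = emeasure_point_masses[OF fin(2), of "\<lambda>z. - u z"] measure_point_masses[OF fin(2), of "\<lambda>z. - u z"]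
    finite_measure_point_masses[OF fin(2), of "\<lambda>z. - u z"]
  have Pb: "?P \<in> sets borel" using fin by (intro borel_closed finite_imp_closed)
  have "emeasure (point_masses ?P u) (- ?P) = 0"
    using Pb by (subst P) (auto simp: sum.neutral)
  moreover have "emeasure (point_masses ?N (\<lambda>z. - u z)) ?P = 0"
  proof -
    have "?N \<inter> ?P = {}" by auto
    then show ?thesis using Pb by (subst N) auto
  qed
  moreover have "atomic_signed_measure w zs A
      = measure (point_masses ?P u) A - measure (point_masses ?N (\<lambda>z. - u z)) A"
    if A: "A \<in> sets borel" for A
  proof -
    have "atomic_signed_measure w zs A = (\<Sum>a<length zs. u (zs ! a) * indicator A (zs ! a))"
      unfolding atomic_signed_measure_def using A by (intro sum.cong) (auto simp: w measure_return)
    also have "\<dots> = (\<Sum>z\<in>set zs. u z * indicator A z)"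
      by (rule sum.reindex_bij_betw[OF bij_betw_nth]) (use assms in auto)
    also have "\<dots> = (\<Sum>z\<in>?P \<union> ?N. u z * indicator A z)"
      by (rule sum.mono_neutral_right) auto
    also have "\<dots> = (\<Sum>z\<in>?P. u z * indicator A z) + (\<Sum>z\<in>?N. u z * indicator A z)"
      by (rule sum.union_disjoint) auto
    also have "\<dots> = (\<Sum>z\<in>?P \<inter> A. u z) + (\<Sum>z\<in>?N \<inter> A. u z)"
      using fin by (simp add: sum.inter_restrict indicator_def if_distrib cong: if_cong)
    also have "(\<Sum>z\<in>?P \<inter> A. u z) = measure (point_masses ?P u) A"
      by (rule P(2)[symmetric]) (use A in auto)
    also have "(\<Sum>z\<in>?N \<inter> A. u z) = - measure (point_masses ?N (\<lambda>z. - u z)) A"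
      by (subst N(2)) (use A in \<open>auto simp: sum_negf\<close>)
    finally show ?thesis by simp
  qed
  ultimately show ?thesis
    unfolding jordan_decomposition_def using P(3) N(3) Pb by auto
qed

lemma atomic_signed_measure_represents:
  fixes zs :: "(real ^ 'd::finite) list"
  assumes zs: "distinct zs" and w: "\<And>a. a < length zs \<Longrightarrow> vec_index w a = u (zs ! a)"
    and s: "\<And>\<gamma>. mdeg \<gamma> \<le> 2 * n \<Longrightarrow> s \<gamma> = (\<Sum>z\<in>set zs. u z * mpow z \<gamma>)"
  shows "signed_representing_measure n s (atomic_signed_measure w zs)"
    and "jordan_support_cards (atomic_signed_measure w zs)
      (card {z \<in> set zs. 0 < u z}) (card {z \<in> set zs. u z < 0})"
proof -
  let ?P = "{z \<in> set zs. 0 < u z}" and ?N = "{z \<in> set zs. u z < 0}"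
  have J: "jordan_decomposition (atomic_signed_measure w zs)
      (point_masses ?P u) (point_masses ?N (\<lambda>z. - u z))"
    using zs w by (rule atomic_signed_measure_jordan)
  have integral: "integrable (point_masses S v) (\<lambda>x. mpow x \<gamma>)"
    "(\<integral>x. mpow x \<gamma> \<partial>point_masses S v) = (\<Sum>z\<in>S. v z * mpow z \<gamma>)"
    if S: "finite S" and v: "\<And>z. z \<in> S \<Longrightarrow> 0 < v z"
    for S :: "(real ^ 'd) set" and v \<gamma>
  proof -
    have null: "emeasure (point_masses S v) (- S) = 0"
      using S by (subst emeasure_point_masses[OF S v])
        (auto intro!: borel_open open_Compl finite_imp_closed)
    note fs = has_integral_finite_support[OF sets_point_masses finite_measure_point_masses[OF S v] S null
        borel_measurable_mpow]
    have "(\<Sum>z\<in>S. measure (point_masses S v) {z} * mpow z \<gamma>) = (\<Sum>z\<in>S. v z * mpow z \<gamma>)"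
      by (intro sum.cong refl) (simp add: measure_point_masses[OF S v])
    with fs show "integrable (point_masses S v) (\<lambda>x. mpow x \<gamma>)"
      "(\<integral>x. mpow x \<gamma> \<partial>point_masses S v) = (\<Sum>z\<in>S. v z * mpow z \<gamma>)" by simp_all
  qed
  have s_split: "s \<gamma> = (\<Sum>z\<in>?P. u z * mpow z \<gamma>) - (\<Sum>z\<in>?N. - u z * mpow z \<gamma>)" if "mdeg \<gamma> \<le> 2 * n" for \<gamma>
  proof -
    have "s \<gamma> = (\<Sum>z\<in>?P \<union> ?N. u z * mpow z \<gamma>)"
      unfolding s[OF that] by (rule sum.mono_neutral_right) auto
    also have "\<dots> = (\<Sum>z\<in>?P. u z * mpow z \<gamma>) + (\<Sum>z\<in>?N. u z * mpow z \<gamma>)"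
      by (rule sum.union_disjoint) auto
    finally show ?thesis by (simp add: sum_negf)
  qed
  let ?p = "point_masses ?P u" and ?m = "point_masses ?N (\<lambda>z. - u z)"
  have P: "finite ?P" "\<And>z. z \<in> ?P \<Longrightarrow> 0 < u z" and N: "finite ?N" "\<And>z. z \<in> ?N \<Longrightarrow> 0 < - u z"
    by simp_all
  show "signed_representing_measure n s (atomic_signed_measure w zs)"
    unfolding signed_representing_measure_def
  proof (rule conjI[OF jordan_decomposition_signed_borel_measure[OF J]],
      rule exI[of _ ?p], rule exI[of _ ?m], intro conjI allI impI)
    show "jordan_decomposition (atomic_signed_measure w zs) ?p ?m" by (rule J)
    fix \<gamma> :: "'d multi_index" assume \<gamma>: "mdeg \<gamma> \<le> 2 * n"
    have "(\<integral>x. mpow x \<gamma> \<partial>?p) = (\<Sum>z\<in>?P. u z * mpow z \<gamma>)"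
      by (rule integral(2)) simp_all
    moreover have "(\<integral>x. mpow x \<gamma> \<partial>?m) = (\<Sum>z\<in>?N. - u z * mpow z \<gamma>)"
      by (rule integral(2)) simp_all
    ultimately show "s \<gamma> = (\<integral>x. mpow x \<gamma> \<partial>?p) - (\<integral>x. mpow x \<gamma> \<partial>?m)"
      using s_split[OF \<gamma>] by (simp only:)
    show "integrable ?p (\<lambda>x. mpow x \<gamma>)" by (rule integral(1)[of ?P u, OF P])
    show "integrable ?m (\<lambda>x. mpow x \<gamma>)" by (rule integral(1)[of ?N "\<lambda>z. - u z", OF N])
  qed
  show "jordan_support_cards (atomic_signed_measure w zs) (card ?P) (card ?N)"
    unfolding jordan_support_cards_def
  proof (rule exI[of _ ?p], rule exI[of _ ?m], intro conjI)
    show "jordan_decomposition (atomic_signed_measure w zs) ?p ?m" by (rule J)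
  qed (simp_all only: msupport_point_masses[of ?P u, OF P] msupport_point_masses[of ?N "\<lambda>z. - u z", OF N] P(1) N(1))
qed

text \<open>Each part of the measure is concentrated on its support, so a finite support turns both
  integrals into finite sums weighted by the masses of the points.\<close>

lemma represented_by_point_masses:
  fixes s :: "'d::finite multi_index \<Rightarrow> real"
  assumes "signed_representing_measure n s \<mu>" "jordan_support_cards \<mu> kp km"
  obtains Z w where "finite Z" "card Z = kp + km"
    "\<And>\<gamma>. mdeg \<gamma> \<le> 2 * n \<Longrightarrow> s \<gamma> = (\<Sum>z\<in>Z. w z * mpow z \<gamma>)"
proof -
  from assms(2) obtain p m where J: "jordan_decomposition \<mu> p m"
    and supp: "finite (msupport p)" "card (msupport p) = kp" "finite (msupport m)" "card (msupport m) = km"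
    unfolding jordan_support_cards_def by blast
  from assms(1) obtain p' m' where "jordan_decomposition \<mu> p' m'"
    and s': "\<And>\<gamma>. mdeg \<gamma> \<le> 2 * n \<Longrightarrow> s \<gamma> = (\<integral>x. mpow x \<gamma> \<partial>p') - (\<integral>x. mpow x \<gamma> \<partial>m')"
    unfolding signed_representing_measure_def by blast
  with jordan_decomposition_unique[OF J] have s: "\<And>\<gamma>. mdeg \<gamma> \<le> 2 * n \<Longrightarrow> s \<gamma> = (\<integral>x. mpow x \<gamma> \<partial>p) - (\<integral>x. mpow x \<gamma> \<partial>m)"
    by metis
  have pm: "sets p = sets borel" "finite_measure p" "sets m = sets borel" "finite_measure m"
    using J unfolding jordan_decomposition_def by blast+
  obtain P where P: "P \<in> sets borel" "emeasure p (- P) = 0" "emeasure m P = 0"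
    using J unfolding jordan_decomposition_def by blast
  \<comment> \<open>Mutually singular measures can share support points in general. Here finiteness
    makes each support point an atom, and an atom of both parts would contradict the Hahn set
    \<open>P\<close>. Disjointness yields the count \<open>kp + km\<close>.\<close>
  have disj: "msupport p \<inter> msupport m = {}"
  proof (rule ccontr)
    assume "\<not> ?thesis"
    then obtain z where z: "z \<in> msupport p" "z \<in> msupport m" by blast
    have pos: "0 < measure p {z}" "0 < measure m {z}"
      using measure_singleton_pos[OF pm(1,2) supp(1) z(1)] measure_singleton_pos[OF pm(3,4) supp(3) z(2)] .
    show False
    proof (cases "z \<in> P")
      case True
      then have "emeasure m {z} \<le> emeasure m P" using P pm by (intro emeasure_mono) auto
      then show False using P pos by (simp add: measure_def)
    next
      case False
      then have "emeasure p {z} \<le> emeasure p (- P)" using P pm by (intro emeasure_mono) auto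
      then show False using P pos by (simp add: measure_def)
    qed
  qed
  define w where "w z = (if z \<in> msupport p then measure p {z} else - measure m {z})" for z
  show ?thesis
  proof
    show "finite (msupport p \<union> msupport m)" using supp by simp
    show "card (msupport p \<union> msupport m) = kp + km" using supp disj by (simp add: card_Un_disjoint)
    fix \<gamma> :: "'d multi_index" assume \<gamma>: "mdeg \<gamma> \<le> 2 * n"
    have "(\<Sum>z\<in>msupport p \<union> msupport m. w z * mpow z \<gamma>)
        = (\<Sum>z\<in>msupport p. w z * mpow z \<gamma>) + (\<Sum>z\<in>msupport m. w z * mpow z \<gamma>)"
      using supp disj by (intro sum.union_disjoint)
    also have "(\<Sum>z\<in>msupport p. w z * mpow z \<gamma>) = (\<integral>x. mpow x \<gamma> \<partial>p)"
      by (subst has_integral_finite_support(2)[OF pm(1,2) supp(1) emeasure_compl_msupport[OF pm(1)]])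
        (auto simp: w_def)
    also have "(\<Sum>z\<in>msupport m. w z * mpow z \<gamma>) = (\<Sum>z\<in>msupport m. - (measure m {z} * mpow z \<gamma>))"
      using disj by (intro sum.cong refl) (auto simp: w_def)
    also have "\<dots> = - (\<integral>x. mpow x \<gamma> \<partial>m)"
      by (subst has_integral_finite_support(2)[OF pm(3,4) supp(3) emeasure_compl_msupport[OF pm(3)]])
        (auto simp: sum_negf)
    finally show "s \<gamma> = (\<Sum>z\<in>msupport p \<union> msupport m. w z * mpow z \<gamma>)" using s[OF \<gamma>] by simp
  qed
qed

section \<open>Hankel matrices and monomial bases\<close>

lemma mdeg_add: "mdeg (\<eta> + \<xi>) = mdeg \<eta> + mdeg \<xi>"
  by (simp add: mdeg_def sum.distrib)

lemma mdeg_axis: "mdeg (axis j k) = k"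
  by (simp add: mdeg_def axis_def)

lemma mdeg_zero: "mdeg 0 = 0"
  by (simp add: mdeg_def)

lemma mpow_add: "mpow z (\<eta> + \<xi>) = mpow z \<eta> * mpow z \<xi>"
  by (simp add: mpow_def power_add prod.distrib)

lemma mpow_axis: "mpow z (axis j 1) = z $ j"
proof -
  have "mpow z (axis j 1) = (\<Prod>i\<in>UNIV. if i = j then z $ j else 1)"
    unfolding mpow_def by (intro prod.cong) (auto simp: axis_def)
  then show ?thesis by simp
qed

lemma mpow_zero: "mpow z 0 = 1"
  by (simp add: mpow_def)

lemma mdeg_Suc_decompose:
  assumes "mdeg \<gamma> = Suc m"
  obtains \<gamma>' j where "\<gamma> = \<gamma>' + axis j 1" "mdeg \<gamma>' = m"
proof -
  have "\<exists>j. \<gamma> $ j \<noteq> 0"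
  proof (rule ccontr)
    assume "\<not> ?thesis"
    then have "mdeg \<gamma> = 0" by (simp add: mdeg_def)
    then show False using assms by simp
  qed
  then obtain j where j: "\<gamma> $ j \<noteq> 0" by blast
  define \<gamma>' where "\<gamma>' = (\<chi> i. if i = j then \<gamma> $ j - 1 else \<gamma> $ i)"
  have "\<gamma> = \<gamma>' + axis j 1"
    using j by (auto simp: \<gamma>'_def axis_def Finite_Cartesian_Product.vec_eq_iff)
  moreover from this have "mdeg \<gamma>' = m"
    using assms by (simp add: mdeg_add mdeg_axis)
  ultimately show ?thesis by (rule that)
qed

text \<open>The step is demanded only below the bound \<open>m\<close>, because the identities it is
  applied to hold in truncated degrees only.\<close>

lemma mdeg_induct [consumes 1, case_names zero step]:
  assumes "mdeg \<gamma> \<le> m" and "P 0"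
    and step: "\<And>\<gamma> j. mdeg \<gamma> < m \<Longrightarrow> P \<gamma> \<Longrightarrow> P (\<gamma> + axis j 1)"
  shows "P \<gamma>"
  using assms(1)
proof (induction "mdeg \<gamma>" arbitrary: \<gamma>)
  case 0
  then have "\<gamma> = 0" by (simp add: mdeg_def Finite_Cartesian_Product.vec_eq_iff)
  then show ?case using assms(2) by simp
next
  case (Suc k)
  from mdeg_Suc_decompose[OF Suc.hyps(2)[symmetric]] obtain \<gamma>' j
    where \<gamma>': "\<gamma> = \<gamma>' + axis j 1" "mdeg \<gamma>' = k" by blast
  have "P \<gamma>'" using Suc.hyps(1)[of \<gamma>'] \<gamma>' Suc by simp
  then show ?case unfolding \<gamma>'(1) using \<gamma>'(2) Suc by (intro step) auto
qed

text \<open>Ensures that every moment of degree up to \<open>2 * m\<close> occurs as an entry of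
  M(m), so that representing the entries represents the whole sequence.\<close>

lemma mdeg_split:
  assumes "mdeg \<gamma> \<le> 2 * m"
  obtains \<eta> \<xi> where "\<gamma> = \<eta> + \<xi>" "mdeg \<eta> \<le> m" "mdeg \<xi> \<le> m"
proof -
  have "\<exists>\<eta> \<xi>. \<gamma> = \<eta> + \<xi> \<and> mdeg \<eta> \<le> m \<and> mdeg \<xi> \<le> m"
    using assms
  proof (induction rule: mdeg_induct)
    case zero
    show ?case by (intro exI[of _ 0]) (simp add: mdeg_zero)
  next
    case (step \<gamma> j)
    then obtain \<eta> \<xi> where *: "\<gamma> = \<eta> + \<xi>" "mdeg \<eta> \<le> m" "mdeg \<xi> \<le> m" by blast
    show ?case
    proof (cases "mdeg \<eta> < m")
      case True
      then show ?thesis using *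
        by (intro exI[of _ "\<eta> + axis j 1"] exI[of _ \<xi>]) (auto simp: mdeg_add mdeg_axis add_ac)
    next
      case False
      then have "mdeg \<xi> < m" using * step by (auto simp: mdeg_add)
      then show ?thesis using *
        by (intro exI[of _ "\<eta>"] exI[of _ "\<xi> + axis j 1"]) (auto simp: mdeg_add mdeg_axis add_ac)
    qed
  qed
  then show ?thesis using that by blast
qed

section \<open>Hankel matrices addressed by multi-indices\<close>

lemma hankel_carrier:
  "hankel m s \<in> carrier_mat (length (monomials m :: 'd multi_index list)) (length (monomials m :: 'd multi_index list))"
  for s :: "'d::{finite,linorder} multi_index \<Rightarrow> real"
  by (simp add: hankel_def Let_def)

lemma hankel_index:
  fixes s :: "'d::{finite,linorder} multi_index \<Rightarrow> real"
  assumes "i < length (monomials m :: 'd multi_index list)" "j < length (monomials m :: 'd multi_index list)"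
  shows "hankel m s $$ (i, j) = s (monomials m ! i + monomials m ! j)"
  using assms by (simp add: hankel_def Let_def)

lemma ex_monomials_index:
  fixes l :: "'d::{finite,linorder} multi_index"
  assumes "mdeg l \<le> m"
  obtains i where "i < length (monomials m :: 'd multi_index list)" "monomials m ! i = l"
  using assms set_monomials[of m, where 'd = 'd] by (metis in_set_conv_nth mem_Collect_eq)

lemma mdeg_monomials_nth:
  "i < length (monomials m :: 'd::{finite,linorder} multi_index list) \<Longrightarrow> mdeg (monomials m ! i :: 'd multi_index) \<le> m"
  using set_monomials[of m, where 'd = 'd] nth_mem by blast

lemma sum_monomials:
  "(\<Sum>i<length (monomials m :: 'd::{finite,linorder} multi_index list). f (monomials m ! i :: 'd multi_index))
    = (\<Sum>l | mdeg l \<le> m. f l)"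
  by (rule sum.reindex_bij_betw[OF bij_betw_nth])
    (use distinct_monomials[of m, where 'd = 'd] set_monomials[of m, where 'd = 'd] in auto)

lemma hankel_rank_factorization:
  fixes s :: "'d::{finite,linorder} multi_index \<Rightarrow> real"
  obtains K :: "real Matrix.vec set" and f g where "finite K" "card K = mat_rank (hankel m s)"
    "\<And>\<eta> \<xi>. mdeg \<eta> \<le> m \<Longrightarrow> mdeg \<xi> \<le> m \<Longrightarrow> s (\<eta> + \<xi>) = (\<Sum>k\<in>K. f \<eta> k * g k \<xi>)"
proof -
  let ?L = "monomials m :: 'd multi_index list"
  obtain K :: "real Matrix.vec set" and f g
    where K: "finite K" "card K = mat_rank (hankel m s)"
      and fg: "\<And>i j. i < length ?L \<Longrightarrow> j < length ?L \<Longrightarrow> hankel m s $$ (i, j) = (\<Sum>k\<in>K. f i k * g k j)"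
    using rank_factorization[OF hankel_carrier[of m s]] by blast
  have "\<forall>l :: 'd multi_index. \<exists>i. mdeg l \<le> m \<longrightarrow> i < length ?L \<and> ?L ! i = l"
    using ex_monomials_index[where 'd = 'd and m = m] by blast
  then obtain ix where ix: "\<And>l :: 'd multi_index. mdeg l \<le> m \<Longrightarrow> ix l < length ?L \<and> ?L ! ix l = l" by metis
  have "s (\<eta> + \<xi>) = (\<Sum>k\<in>K. f (ix \<eta>) k * g k (ix \<xi>))" if "mdeg \<eta> \<le> m" "mdeg \<xi> \<le> m" for \<eta> \<xi>
    using fg[of "ix \<eta>" "ix \<xi>"] ix[OF that(1)] ix[OF that(2)] by (simp add: hankel_index)
  then show ?thesis
    using K by (intro that[of K "\<lambda>l. f (ix l)" "\<lambda>k l. g k (ix l)"]) auto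
qed

lemma hankel_rank_le:
  fixes s :: "'d::{finite,linorder} multi_index \<Rightarrow> real"
  assumes "finite K"
    and "\<And>\<eta> \<xi>. mdeg \<eta> \<le> m \<Longrightarrow> mdeg \<xi> \<le> m \<Longrightarrow> s (\<eta> + \<xi>) = (\<Sum>k\<in>K. f \<eta> k * g k \<xi>)"
  shows "mat_rank (hankel m s) \<le> card K"
  by (rule rank_le_factorization[OF hankel_carrier assms(1),
        where f = "\<lambda>i. f (monomials m ! i)" and g = "\<lambda>k j. g k (monomials m ! j)"])
    (simp add: hankel_index assms(2) mdeg_monomials_nth)

lemma hankel_inertia_sum: "inertia_pos (hankel m s) + inertia_neg (hankel m s) = mat_rank (hankel m s)"
  for s :: "'d::{finite,linorder} multi_index \<Rightarrow> real"
  by (rule inertia_sum_eq_rank[OF hankel_carrier]) (simp add: hankel_index add.commute)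

lemma hankel_inertia_le:
  fixes s :: "'d::{finite,linorder} multi_index \<Rightarrow> real"
  assumes "finite K"
    and s: "\<And>\<eta> \<xi>. mdeg \<eta> \<le> m \<Longrightarrow> mdeg \<xi> \<le> m \<Longrightarrow> s (\<eta> + \<xi>) = (\<Sum>k\<in>K. \<rho> k * v k \<eta> * v k \<xi>)"
  shows "inertia_pos (hankel m s) \<le> card {k \<in> K. 0 < \<rho> k}"
    and "inertia_neg (hankel m s) \<le> card {k \<in> K. \<rho> k < 0}"
proof -
  have eq: "hankel m s $$ (i, j)
      = (\<Sum>k\<in>K. \<rho> k * v k (monomials m ! i) * v k (monomials m ! j))"
    if "i < length (monomials m :: 'd multi_index list)" "j < length (monomials m :: 'd multi_index list)" for i j
    using that by (simp add: hankel_index s mdeg_monomials_nth)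
  show "inertia_pos (hankel m s) \<le> card {k \<in> K. 0 < \<rho> k}"
    by (rule inertia_le(1)[OF hankel_carrier assms(1), where v = "\<lambda>k i. v k (monomials m ! i)"]) (rule eq)
  show "inertia_neg (hankel m s) \<le> card {k \<in> K. \<rho> k < 0}"
    by (rule inertia_le(2)[OF hankel_carrier assms(1), where v = "\<lambda>k i. v k (monomials m ! i)"]) (rule eq)
qed

lemma poly_col_eq_zero_iff:
  fixes s :: "'d::{finite,linorder} multi_index \<Rightarrow> real"
  shows "poly_col m s p = 0\<^sub>v (dim_row (hankel m s)) \<longleftrightarrow>
    (\<forall>l. mdeg l \<le> m \<longrightarrow> (\<Sum>\<xi> | mdeg \<xi> \<le> m. s (l + \<xi>) * p \<xi>) = 0)"
proof -
  let ?L = "monomials m :: 'd multi_index list"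
  have "vec_index (poly_col m s p) i = (\<Sum>\<xi> | mdeg \<xi> \<le> m. s (?L ! i + \<xi>) * p \<xi>)" if "i < length ?L" for i
  proof -
    have "vec_index (poly_col m s p) i = (\<Sum>j<length ?L. s (?L ! i + ?L ! j) * p (?L ! j))"
      using that hankel_carrier[of m s]
      by (auto simp: poly_col_def scalar_prod_def hankel_index lessThan_atLeast0[symmetric]
          vec_of_list_index intro!: sum.cong)
    also have "\<dots> = (\<Sum>\<xi> | mdeg \<xi> \<le> m. s (?L ! i + \<xi>) * p \<xi>)" by (rule sum_monomials)
    finally show ?thesis .
  qed
  then have "poly_col m s p = 0\<^sub>v (dim_row (hankel m s)) \<longleftrightarrow>
      (\<forall>i<length ?L. (\<Sum>\<xi> | mdeg \<xi> \<le> m. s (?L ! i + \<xi>) * p \<xi>) = 0)"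
    using hankel_carrier[of m s] by (auto simp: Matrix.vec_eq_iff poly_col_def)
  also have "\<dots> \<longleftrightarrow> (\<forall>l\<in>set ?L. (\<Sum>\<xi> | mdeg \<xi> \<le> m. s (l + \<xi>) * p \<xi>) = 0)"
    by (rule all_set_conv_all_nth[symmetric])
  finally show ?thesis by (simp add: set_monomials)
qed

section \<open>Monomial bases of the column space and coordinates in an extension\<close>

context
  fixes s :: "'d::{finite,linorder} multi_index \<Rightarrow> real" and n :: nat
begin

lemma dim_hankel_col: "dim_vec (hankel_col n s l) = dim_row (hankel n s)"
  using hankel_carrier[of n s] by (simp add: hankel_col_def)

lemma hankel_col_index:
  "i < length (monomials n :: 'd multi_index list) \<Longrightarrow>
    vec_index (hankel_col n s l) i = s (monomials n ! i + l)"
  by (simp add: hankel_col_def vec_of_list_index)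

lemma set_cols_hankel: "set (cols (hankel n s)) = hankel_col n s ` {l. mdeg l \<le> n}"
proof -
  let ?L = "monomials n :: 'd multi_index list"
  have "cols (hankel n s) = map (hankel_col n s) ?L"
    using hankel_carrier[of n s]
    by (auto simp: cols_def hankel_col_eq_col intro!: nth_equalityI)
  then show ?thesis by (simp add: set_monomials)
qed

lemma monomial_basisD:
  assumes B: "monomial_basis n s bs"
  shows "l \<in> set bs \<Longrightarrow> mdeg l \<le> n"
    and "(\<And>\<xi>. mdeg \<xi> \<le> n \<Longrightarrow> (\<Sum>a<length bs. x a * s (\<xi> + bs ! a)) = 0) \<Longrightarrow> \<forall>a<length bs. x a = 0"
    and "mdeg l \<le> n \<Longrightarrow> \<exists>y. \<forall>\<xi>. mdeg \<xi> \<le> n \<longrightarrow> s (\<xi> + l) = (\<Sum>a<length bs. y a * s (\<xi> + bs ! a))"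
proof -
  define N where "N = dim_row (hankel n s)"
  let ?L = "monomials n :: 'd multi_index list"
  let ?cs = "map (hankel_col n s) bs"
  have N: "N = length ?L" using hankel_carrier[of n s] by (simp add: N_def)
  interpret vec_space "TYPE(real)" N .
  have deg: "\<And>l. l \<in> set bs \<Longrightarrow> mdeg l \<le> n" and dist: "distinct ?cs"
    and indep: "lin_indpt (set ?cs)" and span: "span (set ?cs) = col_space (hankel n s)"
    using B unfolding monomial_basis_def Let_def N_def[symmetric] by auto
  have C: "set ?cs \<subseteq> carrier_vec N"
    by (auto simp: N_def dim_hankel_col intro!: carrier_vecI)
  have sum_cs: "(\<Sum>u\<in>set ?cs. h u) = (\<Sum>a<length bs. h (hankel_col n s (bs ! a)))" for h :: "_ \<Rightarrow> real"
  proof -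
    have "(\<Sum>a<length ?cs. h (?cs ! a)) = (\<Sum>u\<in>set ?cs. h u)"
      by (rule sum.reindex_bij_betw[OF bij_betw_nth]) (use dist in auto)
    then show ?thesis by simp
  qed
  show "l \<in> set bs \<Longrightarrow> mdeg l \<le> n" by (rule deg)
  show "\<forall>a<length bs. x a = 0"
    if x: "\<And>\<xi>. mdeg \<xi> \<le> n \<Longrightarrow> (\<Sum>a<length bs. x a * s (\<xi> + bs ! a)) = 0"
  proof (rule ccontr)
    assume "\<not> ?thesis"
    then obtain a0 where a0: "a0 < length bs" "x a0 \<noteq> 0" by blast
    \<comment> \<open>Linear dependence takes coefficients on vectors, so those on positions are
      transported along the enumeration of the columns, which is injective as the columns are
      distinct.\<close>
    define y where "y u = x (inv_into {..<length bs} (nth ?cs) u)" for u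
    have y: "y (hankel_col n s (bs ! a)) = x a" if "a < length bs" for a
    proof -
      have "inj_on (nth ?cs) {..<length bs}" using dist by (auto intro!: inj_on_nth)
      from inv_into_f_f[OF this, of a] that show ?thesis by (simp add: y_def)
    qed
    have "(\<Sum>u\<in>set ?cs. y u * vec_index u i) = 0" if "i < N" for i
      using that x[of "?L ! i"] unfolding sum_cs by (simp add: y N hankel_col_index mdeg_monomials_nth)
    moreover have "hankel_col n s (bs ! a0) \<in> set ?cs" "y (hankel_col n s (bs ! a0)) \<noteq> 0"
      using a0 y by auto
    ultimately have "lin_dep (set ?cs)"
      unfolding lin_dep_iff[OF finite_set C] by blast
    then show False using indep by simp
  qed
  show "\<exists>y. \<forall>\<xi>. mdeg \<xi> \<le> n \<longrightarrow> s (\<xi> + l) = (\<Sum>a<length bs. y a * s (\<xi> + bs ! a))"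
    if l: "mdeg l \<le> n"
  proof -
    have H: "set (cols (hankel n s)) \<subseteq> carrier_vec N"
      unfolding set_cols_hankel by (auto simp: N_def dim_hankel_col intro!: carrier_vecI)
    have "hankel_col n s l \<in> set (cols (hankel n s))" using l by (simp add: set_cols_hankel)
    then have "hankel_col n s l \<in> span (set ?cs)"
      unfolding span col_space_def using in_own_span[OF H] by blast
    moreover have "hankel_col n s l \<in> carrier_vec N" using H \<open>hankel_col n s l \<in> set (cols _)\<close> by blast
    ultimately obtain y where y: "\<forall>i<N. vec_index (hankel_col n s l) i = (\<Sum>u\<in>set ?cs. y u * vec_index u i)"
      using in_span_iff[OF finite_set C] by blast
    have "s (\<xi> + l) = (\<Sum>a<length bs. y (hankel_col n s (bs ! a)) * s (\<xi> + bs ! a))"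
      if deg_\<xi>: "mdeg \<xi> \<le> n" for \<xi>
    proof -
      obtain i where i: "i < length ?L" "?L ! i = \<xi>" by (rule ex_monomials_index[OF deg_\<xi>])
      have "vec_index (hankel_col n s l) i = (\<Sum>u\<in>set ?cs. y u * vec_index u i)" using y i(1) N by blast
      then show ?thesis unfolding sum_cs using i by (simp add: hankel_col_index)
    qed
    then show ?thesis by (intro exI[of _ "\<lambda>a. y (hankel_col n s (bs ! a))"]) simp
  qed
qed

text \<open>A nonzero moment of degree at most \<open>n\<close> is an entry of the column indexed by
  1. That column alone is then independent and extends to a maximal independent set of
  columns.\<close>

lemma monomial_basis_containing_zero:
  assumes "mdeg \<xi> \<le> n" "s \<xi> \<noteq> 0"
  shows "\<exists>bs. monomial_basis n s bs \<and> bs ! 0 = 0"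
proof -
  define N where "N = dim_row (hankel n s)"
  have N: "N = length (monomials n :: 'd multi_index list)" using hankel_carrier[of n s] by (simp add: N_def)
  interpret vec_space "TYPE(real)" N .
  let ?S = "set (cols (hankel n s))" and ?c0 = "hankel_col n s 0"
  have S: "?S \<subseteq> carrier_vec N"
    unfolding set_cols_hankel by (auto simp: N_def dim_hankel_col intro!: carrier_vecI)
  have c0: "?c0 \<in> ?S" unfolding set_cols_hankel by (auto simp: mdeg_zero)
  obtain i where i: "i < length (monomials n :: 'd multi_index list)" "monomials n ! i = \<xi>"
    by (rule ex_monomials_index[OF assms(1)])
  have "lin_indpt {?c0}"
  proof
    assume "lin_dep {?c0}"
    then obtain a where "a ?c0 \<noteq> 0" "\<forall>i<N. a ?c0 * vec_index ?c0 i = 0"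
      using lin_dep_iff[of "{?c0}"] S c0 by auto
    then show False using i assms(2) N by (auto simp: hankel_col_index)
  qed
  then obtain M where M: "finite M" "maximal M (\<lambda>T. T \<subseteq> ?S \<and> lin_indpt T)" "{?c0} \<subseteq> M"
    using maximal_exists_superset[of ?S "\<lambda>T. T \<subseteq> ?S \<and> lin_indpt T" "{?c0}"] c0 by auto
  have M': "M \<subseteq> ?S" "lin_indpt M" using M(2) unfolding maximal_def by auto
  obtain xs where xs: "set xs = M - {?c0}" "distinct xs"
    using finite_distinct_list[of "M - {?c0}"] M(1) by auto
  have "\<forall>u\<in>?S. \<exists>l. mdeg l \<le> n \<and> hankel_col n s l = u" unfolding set_cols_hankel by auto
  then obtain l where l: "\<And>u. u \<in> ?S \<Longrightarrow> mdeg (l u) \<le> n \<and> hankel_col n s (l u) = u" by metis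
  define bs where "bs = 0 # map l xs"
  have xsS: "u \<in> ?S" if "u \<in> set xs" for u using that xs M' by auto
  have "map (hankel_col n s) (map l xs) = xs"
    using l xsS by (auto intro!: map_idI)
  then have cs: "map (hankel_col n s) bs = ?c0 # xs" by (simp add: bs_def)
  have setcs: "set (map (hankel_col n s) bs) = M" unfolding cs using xs M(3) by auto
  have "monomial_basis n s bs"
    unfolding monomial_basis_def Let_def N_def[symmetric] setcs
  proof (intro conjI)
    show "\<forall>l\<in>set bs. mdeg l \<le> n" using l xsS by (auto simp: bs_def mdeg_zero)
    show "distinct (map (hankel_col n s) bs)" unfolding cs using xs by auto
    show "lin_indpt M" by (rule M')
    show "span M = col_space (hankel n s)"
      unfolding col_space_def by (rule maximal_lin_indpt_span[OF _ S M(2)]) simp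
  qed
  then show ?thesis by (intro exI[of _ bs]) (simp add: bs_def)
qed

lemma length_monomial_basis:
  assumes B: "monomial_basis n s bs"
  shows "length bs = mat_rank (hankel n s)"
proof (rule antisym)
  note D = monomial_basisD[OF B]
  show "length bs \<le> mat_rank (hankel n s)"
  proof (rule ccontr)
    assume "\<not> ?thesis"
    obtain K :: "real Matrix.vec set" and f g where K: "finite K" "card K = mat_rank (hankel n s)"
      and fg: "\<And>\<eta> \<xi>. mdeg \<eta> \<le> n \<Longrightarrow> mdeg \<xi> \<le> n \<Longrightarrow> s (\<eta> + \<xi>) = (\<Sum>k\<in>K. f \<eta> k * g k \<xi>)"
      using hankel_rank_factorization[of n s] by blast
    have "card K < card {..<length bs}" using K \<open>\<not> length bs \<le> _\<close> by simp
    from nontrivial_kernel[OF K(1) finite_lessThan this, of "\<lambda>k a. g k (bs ! a)"] obtain x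
      where x: "\<exists>a<length bs. x a \<noteq> 0" "\<And>k. k \<in> K \<Longrightarrow> (\<Sum>a<length bs. g k (bs ! a) * x a) = 0" by auto
    have "(\<Sum>a<length bs. x a * s (\<xi> + bs ! a)) = 0" if "mdeg \<xi> \<le> n" for \<xi>
    proof -
      have "(\<Sum>a<length bs. x a * s (\<xi> + bs ! a)) = (\<Sum>a<length bs. \<Sum>k\<in>K. f \<xi> k * (g k (bs ! a) * x a))"
        using that D(1) by (intro sum.cong refl) (simp add: fg sum_distrib_left mult_ac)
      also have "\<dots> = (\<Sum>k\<in>K. f \<xi> k * (\<Sum>a<length bs. g k (bs ! a) * x a))"
        by (subst sum.swap) (simp add: sum_distrib_left)
      finally show ?thesis by (simp add: x)
    qed
    then show False using D(2)[of x] x(1) by blast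
  qed
  have "\<forall>l\<in>{l. mdeg l \<le> n}. \<exists>y. \<forall>\<xi>. mdeg \<xi> \<le> n \<longrightarrow> s (\<xi> + l) = (\<Sum>a<length bs. y a * s (\<xi> + bs ! a))"
    using D(3) by simp
  from bchoice[OF this] obtain y where y: "\<And>l \<xi>. mdeg l \<le> n \<Longrightarrow> mdeg \<xi> \<le> n \<Longrightarrow>
      s (\<xi> + l) = (\<Sum>a<length bs. y l a * s (\<xi> + bs ! a))" by auto
  have "mat_rank (hankel n s) \<le> card {..<length bs}"
  proof (rule hankel_rank_le)
    show "s (\<eta> + \<xi>) = (\<Sum>a<length bs. s (\<eta> + bs ! a) * y \<xi> a)" if "mdeg \<eta> \<le> n" "mdeg \<xi> \<le> n" for \<eta> \<xi>
      using y[OF that(2,1)] by (simp add: mult.commute)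
  qed simp
  then show "mat_rank (hankel n s) \<le> length bs" by simp
qed

text \<open>The columns \<open>bs\<close> of M(n) are independent, hence so are the vectors
  \<open>g k (bs ! a)\<close> in a minimal factorisation of M(n + 1). Rank preservation makes their
  number equal to \<open>card K\<close>, so every \<open>g k \<xi>\<close> can be expanded in them,
  and the columns of M(n + 1) inherit these coordinates, also in degree n + 1.\<close>

lemma extension_coefficients:
  assumes B: "monomial_basis n s bs" and ext: "rank_preserving_extension n s t"
  obtains c where "\<And>\<eta> \<xi>. mdeg \<eta> \<le> n + 1 \<Longrightarrow> mdeg \<xi> \<le> n + 1 \<Longrightarrow>
    t (\<eta> + \<xi>) = (\<Sum>a<length bs. c a \<xi> * t (\<eta> + bs ! a))"
proof -
  note D = monomial_basisD[OF B]
  have ts: "\<And>\<gamma>. mdeg \<gamma> \<le> 2 * n \<Longrightarrow> t \<gamma> = s \<gamma>"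
    and rank: "mat_rank (hankel (n + 1) t) = length bs"
    using ext length_monomial_basis[OF B] unfolding rank_preserving_extension_def by auto
  obtain K :: "real Matrix.vec set" and f g where "finite K" "card K = mat_rank (hankel (n + 1) t)"
    and fg: "\<And>\<eta> \<xi>. mdeg \<eta> \<le> n + 1 \<Longrightarrow> mdeg \<xi> \<le> n + 1 \<Longrightarrow> t (\<eta> + \<xi>) = (\<Sum>k\<in>K. f \<eta> k * g k \<xi>)"
    using hankel_rank_factorization[of "n + 1" t] by blast
  with rank have K: "finite K" "card K = length bs" by simp_all
  have deg: "mdeg (bs ! a) \<le> n" if "a < length bs" for a using D(1) that by simp
  have inj: "\<forall>a\<in>{..<length bs}. x a = 0"
    if x: "\<And>k. k \<in> K \<Longrightarrow> (\<Sum>a<length bs. g k (bs ! a) * x a) = 0" for x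
  proof -
    have "(\<Sum>a<length bs. x a * s (\<xi> + bs ! a)) = 0" if "mdeg \<xi> \<le> n" for \<xi>
    proof -
      have "(\<Sum>a<length bs. x a * s (\<xi> + bs ! a)) = (\<Sum>a<length bs. \<Sum>k\<in>K. f \<xi> k * (g k (bs ! a) * x a))"
      proof (intro sum.cong refl)
        fix a assume "a \<in> {..<length bs}"
        then have a: "mdeg (bs ! a) \<le> n" using deg by simp
        then have "s (\<xi> + bs ! a) = (\<Sum>k\<in>K. f \<xi> k * g k (bs ! a))"
          using that by (subst ts[symmetric], simp add: mdeg_add, intro fg) auto
        then show "x a * s (\<xi> + bs ! a) = (\<Sum>k\<in>K. f \<xi> k * (g k (bs ! a) * x a))"
          by (simp add: sum_distrib_left mult_ac)
      qed
      also have "\<dots> = (\<Sum>k\<in>K. f \<xi> k * (\<Sum>a<length bs. g k (bs ! a) * x a))"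
        by (subst sum.swap) (simp add: sum_distrib_left)
      finally show ?thesis by (simp add: x)
    qed
    from D(2)[OF this] show ?thesis by auto
  qed
  have card: "card K = card {..<length bs}" using K(2) by simp
  have "\<forall>\<xi>. \<exists>y. \<forall>k\<in>K. (\<Sum>a<length bs. g k (bs ! a) * y a) = g k \<xi>"
    by (intro allI square_system_solvable[OF K(1) finite_lessThan card]) (rule inj)
  from choice[OF this] obtain y
    where y: "\<And>\<xi> k. k \<in> K \<Longrightarrow> (\<Sum>a<length bs. g k (bs ! a) * y \<xi> a) = g k \<xi>" by auto
  show ?thesis
  proof (rule that[of "\<lambda>a \<xi>. y \<xi> a"])
    fix \<eta> \<xi> :: "'d multi_index" assume *: "mdeg \<eta> \<le> n + 1" "mdeg \<xi> \<le> n + 1"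
    have "t (\<eta> + \<xi>) = (\<Sum>k\<in>K. f \<eta> k * (\<Sum>a<length bs. g k (bs ! a) * y \<xi> a))"
      by (simp add: fg[OF *] y)
    also have "\<dots> = (\<Sum>a<length bs. y \<xi> a * (\<Sum>k\<in>K. f \<eta> k * g k (bs ! a)))"
      unfolding sum_distrib_left by (subst sum.swap) (simp add: mult_ac)
    also have "\<dots> = (\<Sum>a<length bs. y \<xi> a * t (\<eta> + bs ! a))"
      using *(1) deg by (intro sum.cong refl) (simp add: fg le_SucI)
    finally show "t (\<eta> + \<xi>) = (\<Sum>a<length bs. y \<xi> a * t (\<eta> + bs ! a))" .
  qed
qed

end

section \<open>Flat extensions\<close>

declare One_nat_def [simp del]  \<comment> \<open>keeps \<open>n + 1\<close> and \<open>axis j 1\<close> in this form\<close>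

section \<open>Invertible and diagonalisable matrices\<close>

lemma mat_inv_inverse:
  fixes A :: "'a::field mat"
  assumes A: "A \<in> carrier_mat n n" and "det A \<noteq> 0"
  shows "mat_inv A \<in> carrier_mat n n" "mat_inv A * A = 1\<^sub>m n" "A * mat_inv A = 1\<^sub>m n"
proof -
  have "A \<in> Units (ring_mat TYPE('a) n n)" by (rule det_non_zero_imp_unit[OF assms])
  then obtain B where "mat_inverse A = Some B"
    using mat_inverse(1)[OF A, of n] by fastforce
  then show "mat_inv A \<in> carrier_mat n n" "mat_inv A * A = 1\<^sub>m n" "A * mat_inv A = 1\<^sub>m n"
    using mat_inverse(2)[OF A, of B] by (simp_all add: mat_inv_def)
qed

lemma det_nonzero_if_injective:
  fixes f :: "nat \<Rightarrow> nat \<Rightarrow> 'a::field"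
  assumes "\<And>x. (\<And>i. i < n \<Longrightarrow> (\<Sum>j<n. f i j * x j) = 0) \<Longrightarrow> \<forall>j<n. x j = 0"
  shows "det (Matrix.mat n n (\<lambda>(i, j). f i j)) \<noteq> 0"
proof
  let ?A = "Matrix.mat n n (\<lambda>(i, j). f i j)"
  assume "det ?A = 0"
  then obtain v where v: "v \<in> carrier_vec n" "v \<noteq> 0\<^sub>v n" "?A *\<^sub>v v = 0\<^sub>v n"
    using det_0_iff_vec_prod_zero[of ?A n] by auto
  have "(\<Sum>j<n. f i j * vec_index v j) = 0" if "i < n" for i
  proof -
    have "vec_index (?A *\<^sub>v v) i = 0" using v(3) that by simp
    then show ?thesis using that v(1) by (simp add: scalar_prod_def lessThan_atLeast0)
  qed
  then have "\<forall>j<n. vec_index v j = 0" by (rule assms)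
  then have "v = 0\<^sub>v n" using v(1) by (intro eq_vecI) auto
  then show False using v(2) by simp
qed

text \<open>From T = P D Q with Q inverse to P follows Q T = D Q, so the rows of Q are left
  eigenvectors.\<close>

lemma eigen_basis_if_diagonalisable:
  assumes "diagonalisable_over_C (Matrix.mat r r (\<lambda>(i, j). f i j))"
  shows "\<exists>P Q D. eigen_basis r (\<lambda>i j. complex_of_real (f i j)) P Q D"
proof -
  let ?T = "map_mat complex_of_real (Matrix.mat r r (\<lambda>(i, j). f i j))"
  from assms obtain D where D: "diagonal_mat D" "similar_mat ?T D"
    unfolding diagonalisable_over_C_def by blast
  from similar_matD[OF D(2)] obtain n P Q where carr: "{?T, D, P, Q} \<subseteq> carrier_mat n n"
    and PQ: "P * Q = 1\<^sub>m n" "Q * P = 1\<^sub>m n" and T: "?T = P * D * Q" by blast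
  from carr have n: "n = r" and C: "D \<in> carrier_mat r r" "P \<in> carrier_mat r r" "Q \<in> carrier_mat r r"
    by auto
  have QT: "Q * ?T = D * Q"
  proof -
    have "Q * ?T = Q * (P * (D * Q))" unfolding T using C by (simp add: assoc_mult_mat[of _ r r _ r _ r])
    also have "\<dots> = (Q * P) * (D * Q)" using C by (intro assoc_mult_mat[symmetric, of _ r r _ r _ r]) auto
    also have "\<dots> = D * Q" using PQ C n by simp
    finally show ?thesis .
  qed
  have "eigen_basis r (\<lambda>i j. complex_of_real (f i j)) (\<lambda>i j. P $$ (i, j)) (\<lambda>i j. Q $$ (i, j)) (\<lambda>i. D $$ (i, i))"
    unfolding eigen_basis_def
  proof (intro conjI allI impI)
    fix i k assume ik: "i < r" "k < r"
    have "(\<Sum>l<r. P $$ (i, l) * Q $$ (l, k)) = (P * Q) $$ (i, k)"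
      using ik C by (simp add: scalar_prod_def lessThan_atLeast0)
    then show "(\<Sum>l<r. P $$ (i, l) * Q $$ (l, k)) = (if i = k then 1 else 0)"
      using PQ ik n by simp
  next
    fix l k assume lk: "l < r" "k < r"
    have "(\<Sum>i<r. Q $$ (l, i) * complex_of_real (f i k)) = (Q * ?T) $$ (l, k)"
      using lk C by (simp add: scalar_prod_def lessThan_atLeast0)
    also have "\<dots> = (\<Sum>m<r. D $$ (l, m) * Q $$ (m, k))"
      unfolding QT using lk C by (simp add: scalar_prod_def lessThan_atLeast0)
    also have "\<dots> = (\<Sum>m<r. if m = l then D $$ (l, l) * Q $$ (l, k) else 0)"
      using D(1) lk C by (intro sum.cong refl) (auto simp: diagonal_mat_def)
    finally show "(\<Sum>i<r. Q $$ (l, i) * complex_of_real (f i k)) = D $$ (l, l) * Q $$ (l, k)"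
      using lk by simp
  qed
  then show ?thesis by (intro exI)
qed

text \<open>Meant for a Vandermonde matrix \<open>V\<close> at real points: \<open>VT\<close> then
  says that evaluations are left eigenvectors with point coordinates as eigenvalues. The
  diagonalisation is real and only afterwards read over the complex numbers.\<close>

lemma diagonalisable_if_intertwined:
  fixes T V :: "real mat"
  assumes T: "T \<in> carrier_mat r r" and V: "V \<in> carrier_mat r r" "det V \<noteq> 0"
    and VT: "V * T = mat_diag r d * V"
  shows "diagonalisable_over_C T"
proof -
  note inv = mat_inv_inverse[OF V]
  have D: "mat_diag r d \<in> carrier_mat r r" by simp
  have "T = (mat_inv V * V) * T" using inv T by simp
  also have "\<dots> = mat_inv V * (V * T)" by (rule assoc_mult_mat[OF inv(1) V(1) T])
  also have "\<dots> = mat_inv V * mat_diag r d * V"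
    unfolding VT by (rule assoc_mult_mat[OF inv(1) D V(1), symmetric])
  finally have T_eq: "T = mat_inv V * mat_diag r d * V" .
  let ?h = "map_mat complex_of_real"
  have DV: "mat_inv V * mat_diag r d \<in> carrier_mat r r" using inv by simp
  have hT: "?h T = ?h (mat_inv V) * ?h (mat_diag r d) * ?h V"
    by (subst T_eq) (simp only: of_real_hom.mat_hom_mult[OF DV V(1)] of_real_hom.mat_hom_mult[OF inv(1) D])
  have "similar_mat_wit (?h T) (?h (mat_diag r d)) (?h (mat_inv V)) (?h V)"
  proof (rule similar_mat_witI[OF _ _ hT])
    show "?h (mat_inv V) * ?h V = 1\<^sub>m r"
      unfolding of_real_hom.mat_hom_mult[OF inv(1) V(1), symmetric] inv(2) by (rule of_real_hom.mat_hom_one)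
    show "?h V * ?h (mat_inv V) = 1\<^sub>m r"
      unfolding of_real_hom.mat_hom_mult[OF V(1) inv(1), symmetric] inv(3) by (rule of_real_hom.mat_hom_one)
  qed (use T V inv D in \<open>auto intro: map_carrier_mat\<close>)
  then have "similar_mat (?h T) (?h (mat_diag r d))" unfolding similar_mat_def by blast
  moreover have "diagonal_mat (?h (mat_diag r d))" by (simp add: diagonal_mat_def mat_diag_def)
  ultimately show ?thesis unfolding diagonalisable_over_C_def by blast
qed

lemma mpow_complexify: "mpow (complexify x) \<gamma> = complex_of_real (mpow x \<gamma>)"
  by (simp add: mpow_def complexify_def)

lemma inj_complexify: "inj complexify"
  by (auto simp: inj_def complexify_def Finite_Cartesian_Product.vec_eq_iff)

text \<open>
  The columns of the moment matrix indexed by \<open>bs\<close> form a basis of its column space, and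
  \<open>c a \<xi>\<close> are the coordinates of the column \<open>X\<^sup>\<xi>\<close>; the space of polynomials of degree at most
  \<open>n + 1\<close> modulo the kernel of the moment matrix is thus represented by coordinate vectors.
\<close>

locale flat_extension =
  fixes t :: "'d::{finite,linorder} multi_index \<Rightarrow> real" and n :: nat
    and bs :: "'d multi_index list" and c :: "nat \<Rightarrow> 'd multi_index \<Rightarrow> real"
  assumes deg: "a < length bs \<Longrightarrow> mdeg (bs ! a) \<le> n"
    and columns_independent:
      "(\<And>\<xi>. mdeg \<xi> \<le> n \<Longrightarrow> (\<Sum>a<length bs. x a * t (\<xi> + bs ! a)) = 0) \<Longrightarrow> \<forall>a<length bs. x a = 0"
    and coeff: "mdeg \<eta> \<le> n + 1 \<Longrightarrow> mdeg \<xi> \<le> n + 1 \<Longrightarrow>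
      t (\<eta> + \<xi>) = (\<Sum>a<length bs. c a \<xi> * t (\<eta> + bs ! a))"
begin

section \<open>Coordinates and multiplication operators\<close>

abbreviation "r \<equiv> length bs"
abbreviation "mult_coeff j a b \<equiv> c a (bs ! b + axis j 1)"

lemma deg_Suc: "a < r \<Longrightarrow> mdeg (bs ! a) \<le> n + 1"
  using deg[of a] by simp

lemma deg_axis: "mdeg \<xi> \<le> n \<Longrightarrow> mdeg (\<xi> + axis j 1) \<le> n + 1"
  by (simp add: mdeg_add mdeg_axis)

text \<open>By symmetry of \<open>t (\<eta> + \<xi>)\<close>, \<open>coeff\<close> also expands rows
  in the rows indexed by \<open>bs\<close>. A relation tested on these rows therefore holds on all
  rows of degree at most \<open>n\<close>, where the columns are independent.\<close>

lemma gram_injective: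
  assumes x: "\<And>b. b < r \<Longrightarrow> (\<Sum>a<r. x a * t (bs ! b + bs ! a)) = 0"
  shows "\<forall>a<r. x a = 0"
proof (rule columns_independent)
  fix \<xi> :: "'d multi_index" assume \<xi>: "mdeg \<xi> \<le> n"
  have "(\<Sum>a<r. x a * t (\<xi> + bs ! a)) = (\<Sum>a<r. \<Sum>b<r. c b \<xi> * (x a * t (bs ! b + bs ! a)))"
  proof (intro sum.cong refl)
    fix a assume "a \<in> {..<r}"
    then have "t (bs ! a + \<xi>) = (\<Sum>b<r. c b \<xi> * t (bs ! a + bs ! b))"
      using \<xi> by (intro coeff) (auto simp: deg_Suc)
    then show "x a * t (\<xi> + bs ! a) = (\<Sum>b<r. c b \<xi> * (x a * t (bs ! b + bs ! a)))"
      by (simp add: sum_distrib_left mult_ac add.commute)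
  qed
  also have "\<dots> = (\<Sum>b<r. c b \<xi> * (\<Sum>a<r. x a * t (bs ! b + bs ! a)))"
    by (subst sum.swap) (simp add: sum_distrib_left)
  finally show "(\<Sum>a<r. x a * t (\<xi> + bs ! a)) = 0" by (simp add: x)
qed

text \<open>Coordinates are determined by pairing with \<open>bs\<close>; the identities between
  them below are proved by this rule, that is, by comparing moments.\<close>

lemma gram_eqI:
  assumes "\<And>b. b < r \<Longrightarrow> (\<Sum>a<r. x a * t (bs ! b + bs ! a)) = (\<Sum>a<r. y a * t (bs ! b + bs ! a))"
    and "a < r"
  shows "x a = y a"
  using gram_injective[of "\<lambda>a. x a - y a"] assms by (simp add: left_diff_distrib sum_subtractf)

lemma gram_coeff:
  "b < r \<Longrightarrow> mdeg \<xi> \<le> n + 1 \<Longrightarrow> (\<Sum>a<r. c a \<xi> * t (bs ! b + bs ! a)) = t (bs ! b + \<xi>)"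
  by (rule coeff[symmetric]) (auto simp: deg_Suc)

text \<open>Self-adjointness: x_j is moved from \<xi> to the basis monomial \<open>bs ! b\<close>.
  For \<xi> of degree n + 1 the shifted monomial has no column in M(n + 1), whereas
  \<open>bs ! b\<close> shifted by e_j still has one; this handles products of two
  operators.\<close>

lemma gram_mult_coeff:
  assumes "b < r" "mdeg \<xi> \<le> n + 1"
  shows "(\<Sum>a<r. (\<Sum>m<r. mult_coeff j a m * c m \<xi>) * t (bs ! b + bs ! a)) = t (bs ! b + axis j 1 + \<xi>)"
proof -
  have "(\<Sum>a<r. (\<Sum>m<r. mult_coeff j a m * c m \<xi>) * t (bs ! b + bs ! a))
      = (\<Sum>m<r. c m \<xi> * (\<Sum>a<r. mult_coeff j a m * t (bs ! b + bs ! a)))"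
    unfolding sum_distrib_left sum_distrib_right by (subst sum.swap) (simp add: mult_ac)
  also have "\<dots> = (\<Sum>m<r. c m \<xi> * t (bs ! b + axis j 1 + bs ! m))"
  proof (intro sum.cong refl arg_cong2[where f = "(*)"])
    fix m assume "m \<in> {..<r}"
    then have "(\<Sum>a<r. mult_coeff j a m * t (bs ! b + bs ! a)) = t (bs ! b + (bs ! m + axis j 1))"
      using assms by (intro gram_coeff deg_axis deg) auto
    then show "(\<Sum>a<r. mult_coeff j a m * t (bs ! b + bs ! a)) = t (bs ! b + axis j 1 + bs ! m)"
      by (simp only: add_ac)
  qed
  also have "\<dots> = t (bs ! b + axis j 1 + \<xi>)"
    using assms deg by (intro coeff[symmetric]) (auto intro: deg_axis)
  finally show ?thesis .
qed

lemma coeff_basis: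
  assumes "a < r" "b < r"
  shows "c a (bs ! b) = (if a = b then 1 else 0)"
  using assms(1)
proof (rule gram_eqI[rotated])
  fix b' assume "b' < r"
  moreover have "(\<Sum>a<r. (if a = b then 1 else 0) * t (bs ! b' + bs ! a)) = t (bs ! b' + bs ! b)"
    using assms(2) by (simp add: if_distrib[of "\<lambda>x. x * _"] cong: if_cong)
  ultimately show "(\<Sum>a<r. c a (bs ! b) * t (bs ! b' + bs ! a))
      = (\<Sum>a<r. (if a = b then 1 else 0) * t (bs ! b' + bs ! a))"
    using assms(2) by (simp add: gram_coeff deg_Suc)
qed

lemma coeff_step:
  assumes "mdeg \<xi> \<le> n" "a < r"
  shows "c a (\<xi> + axis j 1) = (\<Sum>m<r. mult_coeff j a m * c m \<xi>)"
  using assms(2)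
proof (rule gram_eqI[rotated])
  fix b assume b: "b < r"
  have "(\<Sum>a<r. c a (\<xi> + axis j 1) * t (bs ! b + bs ! a)) = t (bs ! b + (\<xi> + axis j 1))"
    using b assms by (intro gram_coeff deg_axis)
  also have "\<dots> = t (bs ! b + axis j 1 + \<xi>)" by (simp add: add_ac)
  also have "\<dots> = (\<Sum>a<r. (\<Sum>m<r. mult_coeff j a m * c m \<xi>) * t (bs ! b + bs ! a))"
    using b assms by (intro gram_mult_coeff[symmetric]) auto
  finally show "(\<Sum>a<r. c a (\<xi> + axis j 1) * t (bs ! b + bs ! a))
      = (\<Sum>a<r. (\<Sum>m<r. mult_coeff j a m * c m \<xi>) * t (bs ! b + bs ! a))" .
qed

text \<open>Paired with \<open>bs ! b\<close>, either order gives the moment at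
  \<open>bs ! b + bs ! l\<close> + e_i + e_j. Its degree can reach 2n + 2, so commutation rests on
  the top moments of the extension.\<close>

lemma mult_coeff_commute:
  assumes "k < r" "l < r"
  shows "(\<Sum>m<r. mult_coeff i k m * mult_coeff j m l) = (\<Sum>m<r. mult_coeff j k m * mult_coeff i m l)"
  using assms(1)
proof (rule gram_eqI[rotated])
  fix b assume b: "b < r"
  have l: "mdeg (bs ! l + axis i 1) \<le> n + 1" for i using assms(2) by (intro deg_axis deg)
  show "(\<Sum>k<r. (\<Sum>m<r. mult_coeff i k m * mult_coeff j m l) * t (bs ! b + bs ! k))
      = (\<Sum>k<r. (\<Sum>m<r. mult_coeff j k m * mult_coeff i m l) * t (bs ! b + bs ! k))"
    unfolding gram_mult_coeff[OF b l] by (simp add: add_ac)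
qed

section \<open>The variety as the set of evaluations\<close>

text \<open>The kernel of M(n + 1) is spanned by the differences between a monomial and its
  expansion in \<open>bs\<close>, so a point lies in the variety exactly when evaluation there
  respects all these expansions.\<close>

lemma variety_iff:
  "z \<in> variety (n + 1) t \<longleftrightarrow>
    (\<forall>\<xi>. mdeg \<xi> \<le> n + 1 \<longrightarrow> mpow z \<xi> = (\<Sum>a<r. of_real (c a \<xi>) * mpow z (bs ! a)))"
proof
  assume z: "z \<in> variety (n + 1) t"
  show "\<forall>\<xi>. mdeg \<xi> \<le> n + 1 \<longrightarrow> mpow z \<xi> = (\<Sum>a<r. of_real (c a \<xi>) * mpow z (bs ! a))"
  proof (intro allI impI)
    fix \<xi> :: "'d multi_index" assume \<xi>: "mdeg \<xi> \<le> n + 1"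
    \<comment> \<open>\<open>p\<close> is the kernel polynomial belonging to \<xi>. Sums against it
      are computed for a general algebra, to serve both the real moments and the complex
      evaluation.\<close>
    define p :: "'d multi_index \<Rightarrow> real"
      where "p l = (if l = \<xi> then 1 else 0) - (\<Sum>a<r. if l = bs ! a then c a \<xi> else 0)" for l
    have p: "(\<Sum>l | mdeg l \<le> n + 1. of_real (p l) * h l) = h \<xi> - (\<Sum>a<r. of_real (c a \<xi>) * h (bs ! a))"
      for h :: "_ \<Rightarrow> 'b::{real_algebra_1, comm_ring_1}"
    proof -
      have fin: "finite {l :: 'd multi_index. mdeg l \<le> n + 1}" by (rule finite_mdeg_le)
      have "(\<Sum>l | mdeg l \<le> n + 1. of_real (p l) * h l)
          = (\<Sum>l | mdeg l \<le> n + 1. if l = \<xi> then h l else 0)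
            - (\<Sum>l | mdeg l \<le> n + 1. \<Sum>a<r. if l = bs ! a then of_real (c a \<xi>) * h l else 0)"
        unfolding sum_subtractf[symmetric]
        by (intro sum.cong refl)
          (simp add: p_def left_diff_distrib sum_distrib_right if_distrib[of of_real] if_distrib[of "\<lambda>x. x * _"]
            cong: if_cong)
      also have "(\<Sum>l | mdeg l \<le> n + 1. if l = \<xi> then h l else 0) = h \<xi>"
        using fin \<xi> by simp
      also have "(\<Sum>l | mdeg l \<le> n + 1. \<Sum>a<r. if l = bs ! a then of_real (c a \<xi>) * h l else 0)
          = (\<Sum>a<r. \<Sum>l | mdeg l \<le> n + 1. if l = bs ! a then of_real (c a \<xi>) * h l else 0)"
        by (rule sum.swap)
      also have "\<dots> = (\<Sum>a<r. of_real (c a \<xi>) * h (bs ! a))"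
        using fin deg_Suc by (intro sum.cong refl) simp
      finally show ?thesis .
    qed
    have "(\<Sum>l' | mdeg l' \<le> n + 1. t (l + l') * p l') = 0" if "mdeg l \<le> n + 1" for l
      using p[of "\<lambda>l'. t (l + l')"] coeff[OF that \<xi>] by (simp add: mult.commute)
    then have "poly_col (n + 1) t p = 0\<^sub>v (dim_row (hankel (n + 1) t))"
      unfolding poly_col_eq_zero_iff by blast
    then have "(\<Sum>l | mdeg l \<le> n + 1. of_real (p l) * mpow z l) = 0"
      using z unfolding variety_def by blast
    then show "mpow z \<xi> = (\<Sum>a<r. of_real (c a \<xi>) * mpow z (bs ! a))"
      unfolding p by simp
  qed
next
  assume z: "\<forall>\<xi>. mdeg \<xi> \<le> n + 1 \<longrightarrow> mpow z \<xi> = (\<Sum>a<r. of_real (c a \<xi>) * mpow z (bs ! a))"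
  have "(\<Sum>l | mdeg l \<le> n + 1. of_real (p l) * mpow z l) = 0"
    if "poly_col (n + 1) t p = 0\<^sub>v (dim_row (hankel (n + 1) t))" for p
  proof -
    from that have p: "\<And>l. mdeg l \<le> n + 1 \<Longrightarrow> (\<Sum>\<xi> | mdeg \<xi> \<le> n + 1. t (l + \<xi>) * p \<xi>) = 0"
      unfolding poly_col_eq_zero_iff by blast
    \<comment> \<open>A kernel polynomial has zero coordinates in the basis, because the form is
      nondegenerate.\<close>
    have pc: "\<forall>a<r. (\<Sum>\<xi> | mdeg \<xi> \<le> n + 1. p \<xi> * c a \<xi>) = 0"
    proof (rule gram_injective)
      fix b assume b: "b < r"
      have "(\<Sum>a<r. (\<Sum>\<xi> | mdeg \<xi> \<le> n + 1. p \<xi> * c a \<xi>) * t (bs ! b + bs ! a))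
          = (\<Sum>\<xi> | mdeg \<xi> \<le> n + 1. p \<xi> * (\<Sum>a<r. c a \<xi> * t (bs ! b + bs ! a)))"
        unfolding sum_distrib_left sum_distrib_right by (subst sum.swap) (simp add: mult_ac)
      also have "\<dots> = (\<Sum>\<xi> | mdeg \<xi> \<le> n + 1. t (bs ! b + \<xi>) * p \<xi>)"
        using b by (intro sum.cong refl) (simp add: gram_coeff)
      also have "\<dots> = 0" using b by (intro p deg_Suc)
      finally show "(\<Sum>a<r. (\<Sum>\<xi> | mdeg \<xi> \<le> n + 1. p \<xi> * c a \<xi>) * t (bs ! b + bs ! a)) = 0" .
    qed
    have "(\<Sum>l | mdeg l \<le> n + 1. of_real (p l) * mpow z l)
        = (\<Sum>l | mdeg l \<le> n + 1. of_real (p l) * (\<Sum>a<r. of_real (c a l) * mpow z (bs ! a)))"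
      using z by (intro sum.cong refl) simp
    also have "\<dots> = (\<Sum>a<r. of_real (\<Sum>l | mdeg l \<le> n + 1. p l * c a l) * mpow z (bs ! a))"
      unfolding of_real_sum sum_distrib_left sum_distrib_right by (subst sum.swap) (simp add: mult_ac)
    also have "\<dots> = 0" using pc by simp
    finally show ?thesis .
  qed
  then show "z \<in> variety (n + 1) t" unfolding variety_def by blast
qed

lemma variety_evaluation_eigenvector:
  assumes "z \<in> variety (n + 1) t" "k < r"
  shows "(\<Sum>i<r. mpow z (bs ! i) * of_real (mult_coeff j i k)) = z $ j * mpow z (bs ! k)"
proof -
  have "mpow z (bs ! k + axis j 1) = (\<Sum>i<r. of_real (mult_coeff j i k) * mpow z (bs ! i))"
    using assms deg_axis[OF deg] variety_iff by blast
  then show ?thesis by (simp add: mpow_add mpow_axis mult.commute)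
qed

text \<open>On the variety the monomial 1 is a combination of \<open>bs\<close>, so it would vanish
  wherever all of \<open>bs\<close> does.\<close>

lemma variety_evaluation_nonzero:
  assumes "z \<in> variety (n + 1) t"
  shows "\<exists>b<r. mpow z (bs ! b) \<noteq> 0"
proof (rule ccontr)
  assume "\<not> ?thesis"
  moreover have "mpow z 0 = (\<Sum>a<r. of_real (c a 0) * mpow z (bs ! a))"
    using assms unfolding variety_iff by (simp add: mdeg_zero)
  ultimately show False by (simp add: mpow_zero)
qed

lemma evaluations_independent:
  assumes "finite Z" "Z \<subseteq> variety (n + 1) t"
    and "\<And>b. b < r \<Longrightarrow> (\<Sum>z\<in>Z. \<alpha> z * mpow z (bs ! b)) = 0"
    and "z \<in> Z"
  shows "\<alpha> z = 0"
proof -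
  have "\<forall>z\<in>Z. \<forall>k<r. \<alpha> z * mpow z (bs ! k) = 0"
  proof (rule joint_eigenvectors_independent[where e = vec_nth])
    show "inj_on vec_nth Z" by (auto simp: inj_on_def Finite_Cartesian_Product.vec_eq_iff)
    fix z j k assume "z \<in> Z" "k < r"
    then have "(\<Sum>i<r. mpow z (bs ! i) * of_real (mult_coeff j i k)) = z $ j * mpow z (bs ! k)"
      using assms(2) by (intro variety_evaluation_eigenvector) auto
    then show "(\<Sum>i<r. \<alpha> z * mpow z (bs ! i) * of_real (mult_coeff j i k)) = z $ j * (\<alpha> z * mpow z (bs ! k))"
      by (simp add: mult.assoc sum_distrib_left[symmetric] mult.left_commute)
  qed (use assms in auto)
  moreover obtain b where "b < r" "mpow z (bs ! b) \<noteq> 0"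
    using variety_evaluation_nonzero[of z] assms by blast
  ultimately show ?thesis using assms(4) by auto
qed

text \<open>Finiteness is not known beforehand, so the bound is proved for finite subsets: more than
  \<open>r\<close> points would have dependent evaluations.\<close>

lemma finite_variety: "finite (variety (n + 1) t)" and card_variety_le: "card (variety (n + 1) t) \<le> r"
proof -
  have "card G \<le> r" if G: "finite G" "G \<subseteq> variety (n + 1) t" for G
  proof (rule ccontr)
    assume "\<not> card G \<le> r"
    then have "card {..<r} < card G" by simp
    from nontrivial_kernel[OF finite_lessThan G(1) this, of "\<lambda>b z. mpow z (bs ! b)"] obtain x
      where x: "\<exists>z\<in>G. x z \<noteq> 0" "\<And>b. b < r \<Longrightarrow> (\<Sum>z\<in>G. mpow z (bs ! b) * x z) = 0" by auto
    have "x z = 0" if "z \<in> G" for z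
      using evaluations_independent[OF G, of x z] x(2) that by (simp add: mult.commute)
    then show False using x(1) by blast
  qed
  then have "finite (variety (n + 1) t) \<and> card (variety (n + 1) t) \<le> r"
    by (intro finite_if_finite_subsets_card_bdd) auto
  then show "finite (variety (n + 1) t)" "card (variety (n + 1) t) \<le> r" by auto
qed

text \<open>Extend \<open>f\<close> through the coordinates to a functional \<open>L\<close> on
  monomials. Each step from \<xi> to \<xi> + e_j multiplies \<open>L\<close> by z_j, so
  \<open>L\<close> is \<open>L 0\<close> times evaluation at \<open>z\<close>, and \<alpha> is
  \<open>L 0\<close>. If it is nonzero, cancelling it shows that evaluation at \<open>z\<close>
  respects the expansions in \<open>bs\<close>.\<close>

lemma joint_eigenvector_evaluation:
  fixes f :: "nat \<Rightarrow> complex"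
  assumes f: "\<And>j k. k < r \<Longrightarrow> (\<Sum>i<r. f i * of_real (mult_coeff j i k)) = z $ j * f k"
  obtains \<alpha> where "\<And>b. b < r \<Longrightarrow> f b = \<alpha> * mpow z (bs ! b)" "\<alpha> = 0 \<or> z \<in> variety (n + 1) t"
proof -
  define L where "L \<xi> = (\<Sum>a<r. f a * of_real (c a \<xi>))" for \<xi>
  have L_basis: "L (bs ! b) = f b" if "b < r" for b
  proof -
    have "L (bs ! b) = (\<Sum>a<r. if a = b then f a else 0)"
      unfolding L_def using that by (intro sum.cong refl) (simp add: coeff_basis)
    then show ?thesis using that by simp
  qed
  have L: "L \<xi> = mpow z \<xi> * L 0" if "mdeg \<xi> \<le> n + 1" for \<xi>
    using that
  proof (induction rule: mdeg_induct)
    case zero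
    show ?case by (simp add: mpow_zero)
  next
    case (step \<gamma> j)
    have "L (\<gamma> + axis j 1) = (\<Sum>a<r. f a * of_real (\<Sum>m<r. mult_coeff j a m * c m \<gamma>))"
      unfolding L_def using step by (intro sum.cong refl) (simp add: coeff_step)
    also have "\<dots> = (\<Sum>m<r. of_real (c m \<gamma>) * (\<Sum>a<r. f a * of_real (mult_coeff j a m)))"
      unfolding of_real_sum sum_distrib_left by (subst sum.swap) (simp add: mult_ac)
    also have "\<dots> = (\<Sum>m<r. of_real (c m \<gamma>) * (z $ j * f m))" by (simp add: f)
    also have "\<dots> = z $ j * L \<gamma>" by (simp add: L_def sum_distrib_left mult_ac)
    also have "\<dots> = mpow z (\<gamma> + axis j 1) * L 0"
      unfolding step by (simp add: mpow_add mpow_axis mult_ac)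
    finally show ?case .
  qed
  show ?thesis
  proof (rule that)
    show "f b = L 0 * mpow z (bs ! b)" if "b < r" for b
      using L[OF deg_Suc[OF that]] L_basis[OF that] by simp
    show "L 0 = 0 \<or> z \<in> variety (n + 1) t"
    proof (rule disjCI)
      assume "z \<notin> variety (n + 1) t"
      then obtain \<xi> where \<xi>: "mdeg \<xi> \<le> n + 1" "mpow z \<xi> \<noteq> (\<Sum>a<r. of_real (c a \<xi>) * mpow z (bs ! a))"
        unfolding variety_iff by blast
      have "mpow z \<xi> * L 0 = (\<Sum>a<r. f a * of_real (c a \<xi>))"
        using L[OF \<xi>(1)] by (simp add: L_def)
      also have "\<dots> = (\<Sum>a<r. mpow z (bs ! a) * L 0 * of_real (c a \<xi>))"
        using L L_basis deg_Suc by (intro sum.cong refl) (metis lessThan_iff)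
      also have "\<dots> = (\<Sum>a<r. of_real (c a \<xi>) * mpow z (bs ! a)) * L 0"
        unfolding sum_distrib_right by (intro sum.cong refl) (simp add: mult_ac)
      finally show "L 0 = 0" using \<xi>(2) by simp
    qed
  qed
qed

lemma card_variety:
  assumes diag: "\<And>j. diagonalisable_over_C (Matrix.mat r r (\<lambda>(a, b). mult_coeff j a b))"
  shows "card (variety (n + 1) t) = r"
proof (rule antisym[OF card_variety_le])
  let ?V = "variety (n + 1) t"
  \<comment> \<open>\<open>U\<close> is the span of the evaluations, viewed on positions below
    \<open>r\<close>. It contains all joint eigenvectors, and these generate everything.\<close>
  define U where "U = {f. \<exists>\<alpha>. \<forall>b<r. f b = (\<Sum>z\<in>?V. \<alpha> z * mpow z (bs ! b))}"
  have U: "f \<in> U" for f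
  proof (rule joint_eigenvectors_generate[where J = UNIV and r = r
        and T = "\<lambda>j a b. complex_of_real (mult_coeff j a b)"])
    show "finite (UNIV :: 'd set)" by simp
    show "\<exists>P Q D. eigen_basis r (\<lambda>a b. complex_of_real (mult_coeff j a b)) P Q D" for j
      by (rule eigen_basis_if_diagonalisable[OF diag])
    show "(\<Sum>m<r. complex_of_real (mult_coeff i k m) * complex_of_real (mult_coeff j m l))
        = (\<Sum>m<r. complex_of_real (mult_coeff j k m) * complex_of_real (mult_coeff i m l))"
      if "k < r" "l < r" for i j k l
      using arg_cong[OF mult_coeff_commute[OF that], of complex_of_real] by simp
    show "(\<lambda>i. f i + g i) \<in> U" if "f \<in> U" "g \<in> U" for f g
    proof -
      from that obtain \<alpha> \<beta> where "\<forall>b<r. f b = (\<Sum>z\<in>?V. \<alpha> z * mpow z (bs ! b))"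
        "\<forall>b<r. g b = (\<Sum>z\<in>?V. \<beta> z * mpow z (bs ! b))" unfolding U_def by auto
      then show ?thesis unfolding U_def
        by (intro CollectI exI[of _ "\<lambda>z. \<alpha> z + \<beta> z"]) (simp add: distrib_right sum.distrib)
    qed
    show "(\<lambda>_. 0) \<in> U" unfolding U_def by (intro CollectI exI[of _ "\<lambda>_. 0"]) simp
    show "g \<in> U" if "f \<in> U" "\<And>i. i < r \<Longrightarrow> f i = g i" for f g
      using that unfolding U_def by simp
    fix f e
    assume "\<And>j k. j \<in> UNIV \<Longrightarrow> k < r \<Longrightarrow>
      (\<Sum>i<r. f i * complex_of_real (mult_coeff j i k)) = e j * f k"
    then have e: "\<And>j k. k < r \<Longrightarrow>
        (\<Sum>i<r. f i * complex_of_real (mult_coeff j i k)) = (\<chi> j. e j) $ j * f k" by simp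
    obtain \<alpha> where \<alpha>: "\<And>b. b < r \<Longrightarrow> f b = \<alpha> * mpow (\<chi> j. e j) (bs ! b)"
      "\<alpha> = 0 \<or> (\<chi> j. e j) \<in> ?V"
      using joint_eigenvector_evaluation[OF e] by blast
    \<comment> \<open>For \<alpha> = 0 the point may lie outside the variety; the sum is then zero,
      as is \<open>f b\<close>.\<close>
    have "f b = (\<Sum>z\<in>?V. (if z = (\<chi> j. e j) then \<alpha> else 0) * mpow z (bs ! b))" if "b < r" for b
    proof -
      have "(\<Sum>z\<in>?V. (if z = (\<chi> j. e j) then \<alpha> else 0) * mpow z (bs ! b))
          = (\<Sum>z\<in>?V. if z = (\<chi> j. e j) then \<alpha> * mpow z (bs ! b) else 0)"
        by (intro sum.cong) auto
      also have "\<dots> = \<alpha> * mpow (\<chi> j. e j) (bs ! b)"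
        using \<alpha>(2) finite_variety by auto
      finally show ?thesis using \<alpha>(1)[OF that] by simp
    qed
    then show "f \<in> U" unfolding U_def
      by (intro CollectI exI[of _ "\<lambda>z. if z = (\<chi> j. e j) then \<alpha> else 0"]) simp
  qed
  show "r \<le> card ?V"
  \<comment> \<open>Fewer than \<open>r\<close> points would leave a nonzero vector \<open>x\<close>
    annihilated by all evaluations, although each unit vector is a combination of them.\<close>
  proof (rule ccontr)
    assume "\<not> r \<le> card ?V"
    then have "card ?V < card {..<r}" by simp
    from nontrivial_kernel[OF finite_variety finite_lessThan this, of "\<lambda>z b. mpow z (bs ! b)"] obtain x
      where x: "\<exists>b<r. x b \<noteq> 0" "\<And>z. z \<in> ?V \<Longrightarrow> (\<Sum>b<r. mpow z (bs ! b) * x b) = 0" by auto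
    have "x k = 0" if "k < r" for k
    proof -
      have "(\<lambda>b. if b = k then 1 else 0) \<in> U" by (rule U)
      then obtain \<alpha> where \<alpha>: "\<And>b. b < r \<Longrightarrow> (if b = k then 1 else 0) = (\<Sum>z\<in>?V. \<alpha> z * mpow z (bs ! b))"
        unfolding U_def by auto
      have "x k = (\<Sum>b<r. if b = k then x b else 0)" using that by simp
      also have "\<dots> = (\<Sum>b<r. (if b = k then 1 else 0) * x b)" by (intro sum.cong) auto
      also have "\<dots> = (\<Sum>b<r. (\<Sum>z\<in>?V. \<alpha> z * mpow z (bs ! b)) * x b)"
        by (intro sum.cong refl) (simp only: \<alpha> lessThan_iff)
      also have "\<dots> = (\<Sum>z\<in>?V. \<alpha> z * (\<Sum>b<r. mpow z (bs ! b) * x b))"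
        unfolding sum_distrib_left sum_distrib_right by (subst sum.swap) (simp add: mult_ac)
      also have "\<dots> = 0" by (simp add: x)
      finally show ?thesis .
    qed
    then show False using x(1) by blast
  qed
qed

section \<open>Real points of the variety and point masses\<close>

lemma real_evaluations_independent:
  assumes "finite Z" "complexify ` Z \<subseteq> variety (n + 1) t"
    and \<alpha>: "\<And>b. b < r \<Longrightarrow> (\<Sum>z\<in>Z. \<alpha> z * mpow z (bs ! b)) = 0"
    and "z \<in> Z"
  shows "\<alpha> z = 0"
proof -
  define \<beta> where "\<beta> w = complex_of_real (\<alpha> (inv_into UNIV complexify w))" for w
  have \<beta>: "\<beta> (complexify z) = complex_of_real (\<alpha> z)" for z
    by (simp add: \<beta>_def inv_f_f[OF inj_complexify])
  have "\<beta> (complexify z) = 0"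
  proof (rule evaluations_independent[of "complexify ` Z"])
    fix b assume b: "b < r"
    have "(\<Sum>w\<in>complexify ` Z. \<beta> w * mpow w (bs ! b)) = (\<Sum>z\<in>Z. of_real (\<alpha> z * mpow z (bs ! b)))"
      by (subst sum.reindex[OF inj_on_subset[OF inj_complexify subset_UNIV]])
        (simp add: \<beta> mpow_complexify)
    also have "\<dots> = 0" using \<alpha>[OF b] by (simp only: of_real_sum[symmetric] of_real_0)
    finally show "(\<Sum>w\<in>complexify ` Z. \<beta> w * mpow w (bs ! b)) = 0" .
  qed (use assms in auto)
  then show ?thesis by (simp add: \<beta>)
qed

lemma real_variety_coeff:
  assumes "complexify z \<in> variety (n + 1) t" "mdeg \<xi> \<le> n + 1"
  shows "mpow z \<xi> = (\<Sum>a<r. c a \<xi> * mpow z (bs ! a))"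
proof -
  have "complex_of_real (mpow z \<xi>) = of_real (\<Sum>a<r. c a \<xi> * mpow z (bs ! a))"
    using assms unfolding variety_iff mpow_complexify by simp
  then show ?thesis by (simp only: of_real_eq_iff)
qed

text \<open>
  For fixed \<open>\<eta>\<close> the functional \<open>\<xi> \<mapsto> t (\<eta> + \<xi>)\<close> is a combination of the evaluations with
  coefficients \<open>R \<eta>\<close>; comparing \<open>t ((\<eta> + e\<^sub>j) + \<xi>)\<close> and \<open>t (\<eta> + (\<xi> + e\<^sub>j))\<close> shows that
  \<open>R (\<eta> + e\<^sub>j)\<close> arises from \<open>R \<eta>\<close> by multiplication with the coordinates \<open>z\<^sub>j\<close>.
\<close>

lemma moments_as_point_masses:
  assumes Z: "finite Z" "card Z = r" "complexify ` Z \<subseteq> variety (n + 1) t"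
  obtains \<rho> where "\<And>\<eta> \<xi>. mdeg \<eta> \<le> n + 1 \<Longrightarrow> mdeg \<xi> \<le> n + 1 \<Longrightarrow>
    t (\<eta> + \<xi>) = (\<Sum>z\<in>Z. \<rho> z * mpow z \<eta> * mpow z \<xi>)"
proof -
  have card: "card {..<r} = card Z" using Z by simp
  have inj: "\<forall>z\<in>Z. x z = 0"
    if inj_hyp: "\<And>b. b \<in> {..<r} \<Longrightarrow> (\<Sum>z\<in>Z. mpow z (bs ! b) * x z) = 0" for x
  proof
    fix z assume "z \<in> Z"
    show "x z = 0"
    proof (rule real_evaluations_independent[OF Z(1,3) _ \<open>z \<in> Z\<close>])
      show "(\<Sum>z\<in>Z. x z * mpow z (bs ! b)) = 0" if "b < r" for b
        using inj_hyp[of b] that by (simp only: mult.commute lessThan_iff)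
    qed
  qed
  \<comment> \<open>Independent evaluations at exactly \<open>r\<close> points make this system
    square and injective, so the values on \<open>bs\<close> determine \<open>R \<eta>\<close> on
    \<open>Z\<close>.\<close>
  have "\<forall>\<eta>. \<exists>R. \<forall>b\<in>{..<r}. (\<Sum>z\<in>Z. mpow z (bs ! b) * R z) = t (\<eta> + bs ! b)"
    by (intro allI square_system_solvable[OF finite_lessThan Z(1) card]) (rule inj)
  from choice[OF this] obtain R
    where R: "\<And>\<eta> b. b < r \<Longrightarrow> (\<Sum>z\<in>Z. mpow z (bs ! b) * R \<eta> z) = t (\<eta> + bs ! b)" by auto
  have tR: "t (\<eta> + \<xi>) = (\<Sum>z\<in>Z. R \<eta> z * mpow z \<xi>)" if "mdeg \<eta> \<le> n + 1" "mdeg \<xi> \<le> n + 1" for \<eta> \<xi>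
  proof -
    have "t (\<eta> + \<xi>) = (\<Sum>a<r. c a \<xi> * (\<Sum>z\<in>Z. mpow z (bs ! a) * R \<eta> z))"
      using coeff[OF that] by (simp add: R)
    also have "\<dots> = (\<Sum>z\<in>Z. R \<eta> z * (\<Sum>a<r. c a \<xi> * mpow z (bs ! a)))"
      unfolding sum_distrib_left by (subst sum.swap) (simp add: mult_ac)
    also have "\<dots> = (\<Sum>z\<in>Z. R \<eta> z * mpow z \<xi>)"
      using Z(3) that(2) by (intro sum.cong refl arg_cong2[where f = "(*)"] real_variety_coeff[symmetric]) auto
    finally show ?thesis .
  qed
  have R_step: "R (\<eta> + axis j 1) z = z $ j * R \<eta> z" if \<eta>: "mdeg \<eta> \<le> n" and z: "z \<in> Z" for \<eta> j z
  proof -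
    have "R (\<eta> + axis j 1) z - z $ j * R \<eta> z = 0"
    proof (rule real_evaluations_independent[OF Z(1,3) _ z])
      fix b assume b: "b < r"
      have "(\<Sum>z\<in>Z. R (\<eta> + axis j 1) z * mpow z (bs ! b)) = t ((\<eta> + axis j 1) + bs ! b)"
        using \<eta> b by (intro tR[symmetric] deg_axis deg_Suc)
      also have "\<dots> = t (\<eta> + (bs ! b + axis j 1))" by (simp add: add_ac)
      also have "\<dots> = (\<Sum>z\<in>Z. R \<eta> z * mpow z (bs ! b + axis j 1))"
        using \<eta> b by (intro tR deg_axis deg) auto
      finally have "0 = (\<Sum>z\<in>Z. R (\<eta> + axis j 1) z * mpow z (bs ! b))
          - (\<Sum>z\<in>Z. R \<eta> z * mpow z (bs ! b + axis j 1))" by simp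
      also have "\<dots> = (\<Sum>z\<in>Z. (R (\<eta> + axis j 1) z - z $ j * R \<eta> z) * mpow z (bs ! b))"
        unfolding sum_subtractf[symmetric]
        by (intro sum.cong refl) (simp add: mpow_add mpow_axis algebra_simps)
      finally show "(\<Sum>z\<in>Z. (R (\<eta> + axis j 1) z - z $ j * R \<eta> z) * mpow z (bs ! b)) = 0" ..
    qed
    then show ?thesis by simp
  qed
  have "R \<eta> z = mpow z \<eta> * R 0 z" if "mdeg \<eta> \<le> n + 1" and z: "z \<in> Z" for \<eta> z
    using that(1)
  proof (induction rule: mdeg_induct)
    case zero
    show ?case by (simp add: mpow_zero)
  next
    case (step \<gamma> j)
    then show ?case using R_step[of \<gamma> z j] z by (simp add: mpow_add mpow_axis mult_ac)
  qed
  then have "t (\<eta> + \<xi>) = (\<Sum>z\<in>Z. R 0 z * mpow z \<eta> * mpow z \<xi>)"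
    if "mdeg \<eta> \<le> n + 1" "mdeg \<xi> \<le> n + 1" for \<eta> \<xi>
    unfolding tR[OF that] using that(1) by (intro sum.cong refl) (simp add: mult_ac)
  then show ?thesis by (rule that)
qed

lemma det_gram: "det (basis_mat t bs 0) \<noteq> 0"
proof -
  have "basis_mat t bs 0 = Matrix.mat r r (\<lambda>(a, b). t (bs ! a + bs ! b))"
    by (simp add: basis_mat_def)
  moreover have "det (Matrix.mat r r (\<lambda>(a, b). t (bs ! a + bs ! b))) \<noteq> 0"
    by (rule det_nonzero_if_injective, rule gram_injective) (simp add: mult.commute)
  ultimately show ?thesis by simp
qed

text \<open>The coordinates of the shifted basis monomials solve the linear system of the Gram
  matrix; multiplying by its inverse recovers them and identifies the matrix T_j of condition (a)
  with the multiplication operator.\<close>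

lemma mult_mat_eq: "mult_mat t t bs j = Matrix.mat r r (\<lambda>(a, b). mult_coeff j a b)"
proof -
  let ?G = "basis_mat t bs 0" and ?T = "Matrix.mat r r (\<lambda>(a, b). mult_coeff j a b)"
  have G: "?G \<in> carrier_mat r r" by (simp add: basis_mat_def)
  note inv = mat_inv_inverse[OF G det_gram]
  have "basis_mat t bs (axis j 1) = ?G * ?T"
  proof (rule eq_matI)
    fix a b assume "a < dim_row (?G * ?T)" "b < dim_col (?G * ?T)"
    then have ab: "a < r" "b < r" by (simp_all add: basis_mat_def)
    have "(?G * ?T) $$ (a, b) = (\<Sum>m<r. mult_coeff j m b * t (bs ! a + bs ! m))"
      using ab by (simp add: basis_mat_def scalar_prod_def lessThan_atLeast0 mult.commute)
    also have "\<dots> = t (bs ! a + (bs ! b + axis j 1))"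
      using ab by (intro gram_coeff deg_axis deg)
    finally show "basis_mat t bs (axis j 1) $$ (a, b) = (?G * ?T) $$ (a, b)"
      using ab by (simp add: basis_mat_def add_ac)
  qed (simp_all add: basis_mat_def)
  then have "mult_mat t t bs j = mat_inv ?G * (?G * ?T)" by (simp add: mult_mat_def)
  also have "\<dots> = (mat_inv ?G * ?G) * ?T"
    using inv G by (intro assoc_mult_mat[symmetric, of _ r r _ r _ r]) auto
  also have "\<dots> = ?T" using inv by simp
  finally show ?thesis .
qed

end

section \<open>Representing measures\<close>

lemma ex_fun_on_distinct_list:
  assumes "distinct zs"
  obtains \<alpha> where "\<And>a. a < length zs \<Longrightarrow> \<alpha> (zs ! a) = x a"
proof
  fix a assume "a < length zs"
  moreover have "inj_on (nth zs) {..<length zs}" using assms by (auto intro!: inj_on_nth)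
  ultimately show "x (inv_into {..<length zs} (nth zs) (zs ! a)) = x a"
    by (simp add: inv_into_f_f)
qed

lemma sum_distinct_list:
  "distinct zs \<Longrightarrow> (\<Sum>a<length zs. f (zs ! a)) = (\<Sum>z\<in>set zs. f z)"
  by (rule sum.reindex_bij_betw[OF bij_betw_nth]) auto

lemma flat_extension_of_basis:
  assumes B: "monomial_basis n s bs" and ext: "rank_preserving_extension n s t"
  obtains c where "flat_extension t n bs c"
proof -
  obtain c where c: "\<And>\<eta> \<xi>. mdeg \<eta> \<le> n + 1 \<Longrightarrow> mdeg \<xi> \<le> n + 1 \<Longrightarrow>
      t (\<eta> + \<xi>) = (\<Sum>a<length bs. c a \<xi> * t (\<eta> + bs ! a))"
    using extension_coefficients[OF B ext] by blast
  have ts: "t \<gamma> = s \<gamma>" if "mdeg \<gamma> \<le> 2 * n" for \<gamma>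
    using ext that unfolding rank_preserving_extension_def by blast
  have deg: "mdeg (bs ! a) \<le> n" if "a < length bs" for a
    using monomial_basisD(1)[OF B] that by simp
  have "flat_extension t n bs c"
  proof
    fix x assume x: "\<And>\<xi>. mdeg \<xi> \<le> n \<Longrightarrow> (\<Sum>a<length bs. x a * t (\<xi> + bs ! a)) = 0"
    show "\<forall>a<length bs. x a = 0"
    proof (rule monomial_basisD(2)[OF B])
      fix \<xi> :: "'a multi_index" assume \<xi>: "mdeg \<xi> \<le> n"
      have "(\<Sum>a<length bs. x a * s (\<xi> + bs ! a)) = (\<Sum>a<length bs. x a * t (\<xi> + bs ! a))"
      proof (intro sum.cong refl)
        fix a assume "a \<in> {..<length bs}"
        then have "mdeg (\<xi> + bs ! a) \<le> 2 * n" using \<xi> deg[of a] by (simp add: mdeg_add)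
        then show "x a * s (\<xi> + bs ! a) = x a * t (\<xi> + bs ! a)" by (simp add: ts)
      qed
      then show "(\<Sum>a<length bs. x a * s (\<xi> + bs ! a)) = 0" using x[OF \<xi>] by simp
    qed
  qed (use deg c in auto)
  then show ?thesis by (rule that)
qed

lemma mult_mat_of_extension:
  assumes B: "monomial_basis n s bs" and ext: "rank_preserving_extension n s t"
  shows "mult_mat s t bs j = mult_mat t t bs j"
proof -
  have ts: "t \<gamma> = s \<gamma>" if "mdeg \<gamma> \<le> 2 * n" for \<gamma>
    using ext that unfolding rank_preserving_extension_def by blast
  have "basis_mat s bs 0 = basis_mat t bs 0"
  proof (rule eq_matI)
    fix a b assume "a < dim_row (basis_mat t bs 0)" "b < dim_col (basis_mat t bs 0)"
    then have ab: "a < length bs" "b < length bs" by (simp_all add: basis_mat_def)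
    then have "mdeg (bs ! a + bs ! b) \<le> 2 * n"
      using monomial_basisD(1)[OF B, of "bs ! a"] monomial_basisD(1)[OF B, of "bs ! b"]
      by (simp add: mdeg_add)
    then show "basis_mat s bs 0 $$ (a, b) = basis_mat t bs 0 $$ (a, b)"
      using ab by (simp add: basis_mat_def ts)
  qed (simp_all add: basis_mat_def)
  then show ?thesis by (simp add: mult_mat_def)
qed

text \<open>A relation between the columns of the transpose is a relation between evaluations at
  distinct points of the variety.\<close>

lemma (in flat_extension) det_vandermonde:
  assumes zs: "distinct zs" "length zs = r" and var: "complexify ` set zs \<subseteq> variety (n + 1) t"
  shows "det (transpose_mat (vandermonde zs bs)) \<noteq> 0"
proof -
  have "transpose_mat (vandermonde zs bs) = Matrix.mat r r (\<lambda>(b, a). mpow (zs ! a) (bs ! b))"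
    using zs(2) by (auto simp: vandermonde_def)
  moreover have "det (Matrix.mat r r (\<lambda>(b, a). mpow (zs ! a) (bs ! b))) \<noteq> 0"
  proof (rule det_nonzero_if_injective)
    fix x assume x: "\<And>b. b < r \<Longrightarrow> (\<Sum>a<r. mpow (zs ! a) (bs ! b) * x a) = 0"
    obtain \<alpha> where \<alpha>: "\<And>a. a < length zs \<Longrightarrow> \<alpha> (zs ! a) = x a"
      using ex_fun_on_distinct_list[OF zs(1)] by blast
    have "\<alpha> z = 0" if z: "z \<in> set zs" for z
    proof (rule real_evaluations_independent[OF finite_set var _ z])
      fix b assume b: "b < r"
      have "(\<Sum>z\<in>set zs. \<alpha> z * mpow z (bs ! b)) = (\<Sum>a<length zs. \<alpha> (zs ! a) * mpow (zs ! a) (bs ! b))"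
        by (rule sum_distinct_list[OF zs(1), symmetric])
      also have "\<dots> = (\<Sum>a<r. mpow (zs ! a) (bs ! b) * x a)"
        using zs(2) by (intro sum.cong) (simp_all add: \<alpha> mult.commute)
      finally show "(\<Sum>z\<in>set zs. \<alpha> z * mpow z (bs ! b)) = 0" using x[OF b] by simp
    qed
    then show "\<forall>a<r. x a = 0" using \<alpha> zs(2) nth_mem by metis
  qed
  ultimately show ?thesis by simp
qed

text \<open>The moments of the masses in higher degrees define the extension. Its Hankel matrix
  factors through \<open>Z\<close>, which bounds the rank from above; it contains M(n) as a block,
  which bounds it from below.\<close>

lemma rank_preserving_extension_of_point_masses:
  fixes s :: "'d::{finite,linorder} multi_index \<Rightarrow> real"
  assumes Z: "finite Z" "card Z = mat_rank (hankel n s)"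
    and s: "\<And>\<gamma>. mdeg \<gamma> \<le> 2 * n \<Longrightarrow> s \<gamma> = (\<Sum>z\<in>Z. w z * mpow z \<gamma>)"
  shows "rank_preserving_extension n s (\<lambda>\<gamma>. \<Sum>z\<in>Z. w z * mpow z \<gamma>)"
proof -
  define t where "t = (\<lambda>\<gamma> :: 'd multi_index. \<Sum>z\<in>Z. w z * mpow z \<gamma>)"
  have "mat_rank (hankel (n + 1) t) \<le> card Z"
    by (rule hankel_rank_le[OF Z(1), where f = "\<lambda>\<eta> z. w z * mpow z \<eta>" and g = mpow])
      (simp add: t_def mpow_add mult.assoc)
  moreover have "mat_rank (hankel n s) \<le> mat_rank (hankel (n + 1) t)"
  proof -
    obtain K :: "real Matrix.vec set" and f g where K: "finite K" "card K = mat_rank (hankel (n + 1) t)"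
      and fg: "\<And>\<eta> \<xi>. mdeg \<eta> \<le> n + 1 \<Longrightarrow> mdeg \<xi> \<le> n + 1 \<Longrightarrow> t (\<eta> + \<xi>) = (\<Sum>k\<in>K. f \<eta> k * g k \<xi>)"
      using hankel_rank_factorization[of "n + 1" t] by blast
    have "mat_rank (hankel n s) \<le> card K"
    proof (rule hankel_rank_le[OF K(1)])
      fix \<eta> \<xi> :: "'d multi_index" assume *: "mdeg \<eta> \<le> n" "mdeg \<xi> \<le> n"
      then have "s (\<eta> + \<xi>) = t (\<eta> + \<xi>)" unfolding t_def by (intro s) (simp add: mdeg_add)
      also have "\<dots> = (\<Sum>k\<in>K. f \<eta> k * g k \<xi>)" using * by (intro fg) simp_all
      finally show "s (\<eta> + \<xi>) = (\<Sum>k\<in>K. f \<eta> k * g k \<xi>)" .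
    qed
    then show ?thesis using K(2) by simp
  qed
  ultimately show ?thesis
    unfolding rank_preserving_extension_def t_def[symmetric] using s Z(2) by (simp add: t_def)
qed

text \<open>With V the evaluations of \<open>bs\<close> at \<open>Z\<close> and W the diagonal
  matrix of \<open>w\<close>, the Gram matrix is V^T W V. It is nondegenerate and V is square, so V
  is invertible and diagonalises every T_j. \<open>Z\<close> exhausts the variety, which has at most
  \<open>r\<close> points.\<close>

lemma point_masses_imp_extension_conditions:
  fixes s :: "'d::{finite,linorder} multi_index \<Rightarrow> real"
  assumes B: "monomial_basis n s bs" and Z: "finite Z" "card Z = mat_rank (hankel n s)"
    and s: "\<And>\<gamma>. mdeg \<gamma> \<le> 2 * n \<Longrightarrow> s \<gamma> = (\<Sum>z\<in>Z. w z * mpow z \<gamma>)"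
  shows "\<exists>t. rank_preserving_extension n s t \<and> (\<forall>j. diagonalisable_over_C (mult_mat s t bs j)) \<and>
    variety (n + 1) t \<subseteq> range complexify"
proof -
  define t where "t = (\<lambda>\<gamma> :: 'd multi_index. \<Sum>z\<in>Z. w z * mpow z \<gamma>)"
  have ext: "rank_preserving_extension n s t"
    unfolding t_def using Z s by (rule rank_preserving_extension_of_point_masses)
  obtain c where "flat_extension t n bs c" using flat_extension_of_basis[OF B ext] by blast
  then interpret flat_extension t n bs c .
  have card: "card Z = card {..<r}" using Z length_monomial_basis[OF B] by simp
  have t_gram: "(\<Sum>a<r. x a * t (bs ! b + bs ! a))
      = (\<Sum>z\<in>Z. w z * mpow z (bs ! b) * (\<Sum>a<r. mpow z (bs ! a) * x a))" for x b
    unfolding t_def mpow_add sum_distrib_left by (subst sum.swap) (simp add: mult_ac)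
  have inj: "\<forall>a\<in>{..<r}. x a = 0" if x: "\<And>z. z \<in> Z \<Longrightarrow> (\<Sum>a<r. mpow z (bs ! a) * x a) = 0" for x
  proof -
    have "\<forall>a<r. x a = 0" by (rule gram_injective) (simp add: t_gram x)
    then show ?thesis by simp
  qed
  have "complexify z \<in> variety (n + 1) t" if z: "z \<in> Z" for z
    unfolding variety_iff
  proof (intro allI impI)
    fix \<xi> :: "'d multi_index" assume \<xi>: "mdeg \<xi> \<le> n + 1"
    \<comment> \<open>Values on \<open>Z\<close> of the kernel polynomial belonging to \<xi>. Some
      combination \<open>x\<close> of \<open>bs\<close> takes the same values; \<open>wy\<close>
      puts \<open>x\<close> into the kernel of the Gram matrix, so \<open>x\<close> and all these
      values are zero.\<close>
    define y where "y z = mpow z \<xi> - (\<Sum>a<r. c a \<xi> * mpow z (bs ! a))" for z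
    have wy: "(\<Sum>z\<in>Z. w z * mpow z (bs ! b) * y z) = 0" if b: "b < r" for b
    proof -
      have "(\<Sum>z\<in>Z. w z * mpow z (bs ! b) * y z)
          = t (bs ! b + \<xi>) - (\<Sum>z\<in>Z. w z * mpow z (bs ! b) * (\<Sum>a<r. mpow z (bs ! a) * c a \<xi>))"
        unfolding t_def sum_subtractf[symmetric]
        by (intro sum.cong refl) (simp add: y_def mpow_add right_diff_distrib mult_ac)
      also have "\<dots> = 0"
        unfolding t_gram[symmetric] using gram_coeff[OF b \<xi>] by simp
      finally show ?thesis .
    qed
    have "\<exists>x. \<forall>z\<in>Z. (\<Sum>a<r. mpow z (bs ! a) * x a) = y z"
      by (intro square_system_solvable[OF Z(1) finite_lessThan card]) (rule inj)
    then obtain x where x: "\<And>z. z \<in> Z \<Longrightarrow> (\<Sum>a<r. mpow z (bs ! a) * x a) = y z" by blast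
    have "\<forall>a<r. x a = 0"
      by (rule gram_injective) (simp add: t_gram x wy)
    then have "y z = 0" using x[OF z] by simp
    then have "mpow z \<xi> = (\<Sum>a<r. c a \<xi> * mpow z (bs ! a))" by (simp add: y_def)
    then show "mpow (complexify z) \<xi> = (\<Sum>a<r. of_real (c a \<xi>) * mpow (complexify z) (bs ! a))"
      unfolding mpow_complexify by simp
  qed
  then have sub: "complexify ` Z \<subseteq> variety (n + 1) t" by blast
  have "card (complexify ` Z) = r"
    using card by (simp add: card_image[OF inj_on_subset[OF inj_complexify subset_UNIV]])
  then have "complexify ` Z = variety (n + 1) t"
    using card_seteq[OF finite_variety sub] card_variety_le by simp
  then have "variety (n + 1) t \<subseteq> range complexify" by blast
  moreover have "diagonalisable_over_C (mult_mat s t bs j)" for j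
  proof -
    obtain zs where zs: "set zs = Z" "distinct zs" using finite_distinct_list[OF Z(1)] by blast
    have len: "length zs = r" using zs card distinct_card[of zs] by simp
    let ?V = "vandermonde zs bs" and ?T = "mult_mat t t bs j"
    have V: "?V \<in> carrier_mat r r" using len by (simp add: vandermonde_def)
    have det: "det ?V \<noteq> 0"
      using det_vandermonde[OF zs(2) len] sub zs(1) det_transpose[OF V] by simp
    have "diagonalisable_over_C ?T"
    proof (rule diagonalisable_if_intertwined[OF _ V det])
      show "?T \<in> carrier_mat r r" by (simp add: mult_mat_eq)
      let ?D = "mat_diag r (\<lambda>a. zs ! a $ j)"
      have D: "?D \<in> carrier_mat r r" by simp
      show "?V * ?T = ?D * ?V"
      proof (rule eq_matI)
        fix a b assume "a < dim_row (?D * ?V)" "b < dim_col (?D * ?V)"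
        then have ab: "a < r" "b < r" using V D by simp_all
        have "zs ! a \<in> Z" using nth_mem[of a zs] ab len zs(1) by simp
        then have "complexify (zs ! a) \<in> variety (n + 1) t" using sub by blast
        then have "mpow (zs ! a) (bs ! b + axis j 1)
            = (\<Sum>m<r. mult_coeff j m b * mpow (zs ! a) (bs ! m))"
          using ab by (intro real_variety_coeff deg_axis deg)
        then show "(?V * ?T) $$ (a, b) = (?D * ?V) $$ (a, b)"
          unfolding mat_diag_mult_left[OF V] using ab len
          by (simp add: mult_mat_eq vandermonde_def scalar_prod_def lessThan_atLeast0 mpow_add mpow_axis mult.commute)
      qed (use V in \<open>simp_all add: mult_mat_eq mat_diag_def\<close>)
    qed
    then show ?thesis by (simp add: mult_mat_of_extension[OF B ext])
  qed
  ultimately show ?thesis using ext by blast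
qed

text \<open>The weights \<rho> come from \<open>moments_as_point_masses\<close>. The convention
  \<open>bs ! 0 = 0\<close> serves to express them: the first column of the Gram matrix then lists
  the moments of \<open>bs\<close>, and the transposed Vandermonde system with this right-hand side
  has the solution \<rho>.\<close>

lemma flat_extension_representing_measure:
  fixes s :: "'d::{finite,linorder} multi_index \<Rightarrow> real"
  assumes B: "monomial_basis n s bs" and zero: "0 < mat_rank (hankel n s) \<longrightarrow> bs ! 0 = 0"
    and ext: "rank_preserving_extension n s t"
    and zs: "distinct zs" "length zs = mat_rank (hankel n s)" and var: "complexify ` set zs = variety (n + 1) t"
  shows "invertible_mat (vandermonde zs bs)"
    and "signed_representing_measure n s (atomic_signed_measure (weights s bs zs) zs)"
    and "jordan_support_cards (atomic_signed_measure (weights s bs zs) zs)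
      (inertia_pos (hankel n s)) (inertia_neg (hankel n s))"
proof -
  obtain c where "flat_extension t n bs c" using flat_extension_of_basis[OF B ext] by blast
  then interpret flat_extension t n bs c .
  have r: "mat_rank (hankel n s) = r" using length_monomial_basis[OF B] by simp
  have len: "length zs = r" using zs r by simp
  let ?V = "vandermonde zs bs"
  have V: "?V \<in> carrier_mat r r" using len by (simp add: vandermonde_def)
  have VT: "transpose_mat ?V \<in> carrier_mat r r" using V by simp
  have detT: "det (transpose_mat ?V) \<noteq> 0" using det_vandermonde[OF zs(1) len] var by simp
  then have det: "det ?V \<noteq> 0" using det_transpose[OF V] by simp
  show "invertible_mat ?V"
    unfolding invertible_mat_def inverts_mat_def
    using mat_inv_inverse[OF V det] V by (intro conjI exI[of _ "mat_inv ?V"]) auto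
  have ts: "t \<gamma> = s \<gamma>" if "mdeg \<gamma> \<le> 2 * n" for \<gamma>
    using ext that unfolding rank_preserving_extension_def by blast
  have cardZ: "card (set zs) = r" using distinct_card[OF zs(1)] len by simp
  obtain \<rho> where \<rho>: "\<And>\<eta> \<xi>. mdeg \<eta> \<le> n + 1 \<Longrightarrow> mdeg \<xi> \<le> n + 1 \<Longrightarrow>
      t (\<eta> + \<xi>) = (\<Sum>z\<in>set zs. \<rho> z * mpow z \<eta> * mpow z \<xi>)"
    using moments_as_point_masses[OF finite_set cardZ] var by blast
  have s_sum: "s (\<eta> + \<xi>) = (\<Sum>z\<in>set zs. \<rho> z * mpow z \<eta> * mpow z \<xi>)"
    if "mdeg \<eta> \<le> n" "mdeg \<xi> \<le> n" for \<eta> \<xi>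
    using \<rho>[of \<eta> \<xi>] that by (simp add: ts mdeg_add)
  have s_eq: "s \<gamma> = (\<Sum>z\<in>set zs. \<rho> z * mpow z \<gamma>)" if \<gamma>: "mdeg \<gamma> \<le> 2 * n" for \<gamma>
  proof -
    obtain \<eta> \<xi> where *: "\<gamma> = \<eta> + \<xi>" "mdeg \<eta> \<le> n" "mdeg \<xi> \<le> n" by (rule mdeg_split[OF \<gamma>])
    show ?thesis unfolding *(1) s_sum[OF *(2,3)] by (simp add: mpow_add mult.assoc)
  qed
  have weights: "vec_index (weights s bs zs) a = \<rho> (zs ! a)" if a: "a < length zs" for a
  proof -
    define w where "w = Matrix.vec r (\<lambda>a. \<rho> (zs ! a))"
    have w: "w \<in> carrier_vec r" by (simp add: w_def)
    \<comment> \<open>The existence of an index \<open>a\<close> makes the rank positive, so the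
      convention on the leading monomial is in force.\<close>
    have "0 < r" using a len by linarith
    then have zero: "bs ! 0 = 0" using zero r by simp
    have "basis_mat s bs 0 *\<^sub>v unit_vec r 0 = transpose_mat ?V *\<^sub>v w"
    proof (rule eq_vecI)
      fix b assume "b < dim_vec (transpose_mat ?V *\<^sub>v w)"
      then have b: "b < r" using V by simp
      have "vec_index (basis_mat s bs 0 *\<^sub>v unit_vec r 0) b = s (bs ! b)"
        using b \<open>0 < r\<close> zero by (simp add: basis_mat_def)
      also have "\<dots> = (\<Sum>z\<in>set zs. \<rho> z * mpow z (bs ! b))"
        using deg[OF b] by (intro s_eq) simp
      also have "\<dots> = (\<Sum>a<length zs. \<rho> (zs ! a) * mpow (zs ! a) (bs ! b))"
        by (rule sum_distinct_list[OF zs(1), symmetric])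
      also have "\<dots> = vec_index (transpose_mat ?V *\<^sub>v w) b"
        using b len by (simp add: vandermonde_def w_def scalar_prod_def lessThan_atLeast0 mult.commute)
      finally show "vec_index (basis_mat s bs 0 *\<^sub>v unit_vec r 0) b
          = vec_index (transpose_mat ?V *\<^sub>v w) b" .
    qed (use V in \<open>simp_all add: basis_mat_def\<close>)
    then have "weights s bs zs = mat_inv (transpose_mat ?V) *\<^sub>v (transpose_mat ?V *\<^sub>v w)"
      by (simp add: weights_def)
    also have "\<dots> = (mat_inv (transpose_mat ?V) * transpose_mat ?V) *\<^sub>v w"
      by (rule assoc_mult_mat_vec[OF mat_inv_inverse(1)[OF VT detT] VT w, symmetric])
    also have "\<dots> = w" unfolding mat_inv_inverse(2)[OF VT detT] using w by simp
    finally show ?thesis using a len by (simp add: w_def)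
  qed
  show "signed_representing_measure n s (atomic_signed_measure (weights s bs zs) zs)"
    using zs(1) weights s_eq by (rule atomic_signed_measure_represents(1))
  have "jordan_support_cards (atomic_signed_measure (weights s bs zs) zs)
      (card {z \<in> set zs. 0 < \<rho> z}) (card {z \<in> set zs. \<rho> z < 0})"
    using zs(1) weights s_eq by (rule atomic_signed_measure_represents(2))
  moreover have "inertia_pos (hankel n s) = card {z \<in> set zs. 0 < \<rho> z}"
    "inertia_neg (hankel n s) = card {z \<in> set zs. \<rho> z < 0}"
  proof -
    have le: "inertia_pos (hankel n s) \<le> card {z \<in> set zs. 0 < \<rho> z}"
      "inertia_neg (hankel n s) \<le> card {z \<in> set zs. \<rho> z < 0}"
      by (rule hankel_inertia_le[OF finite_set, where v = mpow], erule (1) s_sum)+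
    \<comment> \<open>At most \<open>r\<close> weights are nonzero, while the two inertia indices
      add up to \<open>r\<close>; hence both inequalities are equalities.\<close>
    have "card {z \<in> set zs. 0 < \<rho> z} + card {z \<in> set zs. \<rho> z < 0}
        = card ({z \<in> set zs. 0 < \<rho> z} \<union> {z \<in> set zs. \<rho> z < 0})"
      by (rule card_Un_disjoint[symmetric]) auto
    also have "\<dots> \<le> card (set zs)" by (rule card_mono) auto
    also have "\<dots> = inertia_pos (hankel n s) + inertia_neg (hankel n s)"
      using hankel_inertia_sum[of n s] r cardZ by simp
    finally show "inertia_pos (hankel n s) = card {z \<in> set zs. 0 < \<rho> z}"
      "inertia_neg (hankel n s) = card {z \<in> set zs. \<rho> z < 0}" using le by linarith+
  qed
  ultimately show "jordan_support_cards (atomic_signed_measure (weights s bs zs) zs)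
      (inertia_pos (hankel n s)) (inertia_neg (hankel n s))" by simp
qed

text \<open>A nonzero moment of degree at most \<open>n\<close> makes column 1 nonzero. Otherwise
  the extension forces rank 0: the coordinates of 1 vanish, and multiplication propagates this to
  all monomials. For a sequence that has no extension the conclusion can fail: d = n = 1 with
  moments 0, 0, 1 has rank 1 and a zero column 1.\<close>

lemma monomial_basis_with_leading_one:
  fixes s :: "'d::{finite,linorder} multi_index \<Rightarrow> real"
  assumes B: "monomial_basis n s bs" and ext: "rank_preserving_extension n s t"
  shows "\<exists>bs'. monomial_basis n s bs' \<and> (0 < mat_rank (hankel n s) \<longrightarrow> bs' ! 0 = 0)"
proof (cases "\<exists>\<xi>. mdeg \<xi> \<le> n \<and> s \<xi> \<noteq> 0")
  case True
  then show ?thesis using monomial_basis_containing_zero by blast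
next
  case False
  obtain c where "flat_extension t n bs c" using flat_extension_of_basis[OF B ext] by blast
  then interpret flat_extension t n bs c .
  have ts: "t \<gamma> = s \<gamma>" if "mdeg \<gamma> \<le> 2 * n" for \<gamma>
    using ext that unfolding rank_preserving_extension_def by blast
  have "c a \<xi> = 0" if "a < r" "mdeg \<xi> \<le> n + 1" for a \<xi>
    using that(2,1)
  proof (induction arbitrary: a rule: mdeg_induct)
    case zero
    have "c a 0 = (\<lambda>_. 0) a"
    proof (rule gram_eqI[OF _ zero])
      fix b assume b: "b < r"
      have "(\<Sum>a<r. c a 0 * t (bs ! b + bs ! a)) = t (bs ! b + 0)"
        using b by (intro gram_coeff) (simp_all add: mdeg_zero)
      also have "\<dots> = s (bs ! b)" using ts[of "bs ! b"] deg[OF b] by simp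
      also have "\<dots> = 0" using False deg[OF b] by blast
      finally show "(\<Sum>a<r. c a 0 * t (bs ! b + bs ! a)) = (\<Sum>a<r. 0 * t (bs ! b + bs ! a))" by simp
    qed
    then show ?case by simp
  next
    case (step \<gamma> j)
    then show ?case by (simp add: coeff_step)
  qed
  then have "r = 0"
    using coeff_basis[of 0 0] deg_Suc[of 0] by (cases "r = 0") auto
  then show ?thesis using B length_monomial_basis[OF B] by auto
qed

text \<open>Condition (a) refers to the given basis \<open>bs\<close>, the weights to a basis
  \<open>bs'\<close> with leading monomial 1. The two meet only in the rank and the variety, which
  are independent of the basis. For \<open>r = 0\<close> the basis is empty, whence the guard on
  \<open>bs' ! 0\<close>.\<close>

theorem corollary7p5:
  fixes s :: "'d::{finite,linorder} multi_index \<Rightarrow> real"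
    and n r kp km :: nat
    and bs :: "'d multi_index list"
  assumes "kp = inertia_pos (hankel n s)"
    and "km = inertia_neg (hankel n s)"
    and "r = mat_rank (hankel n s)"
    and "monomial_basis n s bs"
  shows
    "((\<exists>\<mu>. signed_representing_measure n s \<mu> \<and> jordan_support_cards \<mu> kp km) \<longleftrightarrow>
      (\<exists>t. rank_preserving_extension n s t \<and>
           (\<forall>j. diagonalisable_over_C (mult_mat s t bs j)) \<and>
           variety (n + 1) t \<subseteq> range complexify))
     \<and>
     (\<forall>t. rank_preserving_extension n s t \<and>
          (\<forall>j. diagonalisable_over_C (mult_mat s t bs j)) \<and>
          variety (n + 1) t \<subseteq> range complexify \<longrightarrow>
        finite (variety (n + 1) t) \<and> card (variety (n + 1) t) = r \<and>
        (\<exists>bs'. monomial_basis n s bs' \<and> (r > 0 \<longrightarrow> bs' ! 0 = 0)) \<and>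
        (\<forall>bs' zs. monomial_basis n s bs' \<and> (r > 0 \<longrightarrow> bs' ! 0 = 0) \<and>
            distinct zs \<and> complexify ` set zs = variety (n + 1) t \<longrightarrow>
          invertible_mat (vandermonde zs bs') \<and>
          signed_representing_measure n s (atomic_signed_measure (weights s bs' zs) zs) \<and>
          jordan_support_cards (atomic_signed_measure (weights s bs' zs) zs) kp km))"
    (is "(?measure \<longleftrightarrow> (\<exists>t. ?cond t)) \<and> (\<forall>t. ?cond t \<longrightarrow> ?fin t \<and> ?card t \<and> ?basis \<and> ?constr t)")
proof -
  note r = assms(3) and B = assms(4)
  have constr: "?fin t \<and> ?card t \<and> ?basis \<and> ?constr t" if cond: "?cond t" for t
  proof -
    have ext: "rank_preserving_extension n s t" and diag: "\<And>j. diagonalisable_over_C (mult_mat s t bs j)"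
      using cond by auto
    obtain c where "flat_extension t n bs c" using flat_extension_of_basis[OF B ext] by blast
    then interpret F: flat_extension t n bs c .
    have fin: "?fin t" by (rule F.finite_variety)
    have card: "?card t"
      using F.card_variety diag length_monomial_basis[OF B] r
      by (simp add: mult_mat_of_extension[OF B ext] F.mult_mat_eq)
    have basis: "?basis" using monomial_basis_with_leading_one[OF B ext] unfolding r .
    have constr: "?constr t"
    proof (intro allI impI, elim conjE)
      fix bs' zs
      assume bs': "monomial_basis n s bs'" "r > 0 \<longrightarrow> bs' ! 0 = 0"
        and zs: "distinct zs" and var: "complexify ` set zs = variety (n + 1) t"
      have "card (complexify ` set zs) = card (set zs)"
        by (rule card_image[OF inj_on_subset[OF inj_complexify subset_UNIV]])
      then have len: "length zs = mat_rank (hankel n s)"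
        using card r unfolding var distinct_card[OF zs] by simp
      note M = flat_extension_representing_measure[OF bs'[unfolded r] ext zs len var]
      show "invertible_mat (vandermonde zs bs') \<and>
          signed_representing_measure n s (atomic_signed_measure (weights s bs' zs) zs) \<and>
          jordan_support_cards (atomic_signed_measure (weights s bs' zs) zs) kp km"
        unfolding assms(1,2) by (intro conjI M)
    qed
    show ?thesis by (intro conjI fin card basis constr)
  qed
  have condI: "\<exists>t. ?cond t" if ?measure
  proof -
    from that obtain \<mu> where \<mu>: "signed_representing_measure n s \<mu>" "jordan_support_cards \<mu> kp km" by blast
    obtain Z w where Z: "finite Z" "card Z = kp + km"
      and s: "\<And>\<gamma>. mdeg \<gamma> \<le> 2 * n \<Longrightarrow> s \<gamma> = (\<Sum>z\<in>Z. w z * mpow z \<gamma>)"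
      using represented_by_point_masses[OF \<mu>] by blast
    \<comment> \<open>The prescribed support sizes add up to the rank; this is what makes the
      moments of the atoms a rank preserving extension.\<close>
    have "card Z = mat_rank (hankel n s)" using Z(2) hankel_inertia_sum[of n s] assms(1,2) by simp
    from point_masses_imp_extension_conditions[OF B Z(1) this s] show ?thesis .
  qed
  have measureI: ?measure if "?cond t" for t
  proof -
    have fin: "?fin t" and basis: ?basis and constr': "?constr t" using constr[OF that] by simp_all
    from basis obtain bs' where bs': "monomial_basis n s bs' \<and> (r > 0 \<longrightarrow> bs' ! 0 = 0)" ..
    \<comment> \<open>Reality of the variety makes every point of it the image of a real point, and
      these real points carry the atoms.\<close>
    define Z where "Z = {x. complexify x \<in> variety (n + 1) t}"
    have Z: "complexify ` Z = variety (n + 1) t" using that unfolding Z_def by blast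
    then have "finite (complexify ` Z)" using fin by simp
    then have "finite Z" by (rule finite_imageD[OF _ inj_on_subset[OF inj_complexify subset_UNIV]])
    then obtain zs where zs: "set zs = Z" "distinct zs" using finite_distinct_list by blast
    let ?\<mu> = "atomic_signed_measure (weights s bs' zs) zs"
    have "invertible_mat (vandermonde zs bs') \<and>
        signed_representing_measure n s ?\<mu> \<and> jordan_support_cards ?\<mu> kp km"
      using bs' zs(2) Z unfolding zs(1)[symmetric] by (intro constr'[rule_format] conjI) simp_all
    then show ?thesis by (intro exI[of _ ?\<mu>]) (elim conjE, intro conjI)
  qed
  show ?thesis
  proof (rule conjI)
    show "?measure \<longleftrightarrow> (\<exists>t. ?cond t)"
    proof
      assume ?measure
      then show "\<exists>t. ?cond t" by (rule condI)
    next
      assume "\<exists>t. ?cond t"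
      then obtain t where "?cond t" ..
      then show ?measure by (rule measureI)
    qed
    show "\<forall>t. ?cond t \<longrightarrow> ?fin t \<and> ?card t \<and> ?basis \<and> ?constr t"
      by (intro allI impI) (rule constr)
  qed
qed

end
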